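(* Let $N\ge M\ge1$, $\Omega\subset\mathbb{R}^N$ open and bounded, $\varphi:\Omega^c\to\mathbb{R}$ bounded continuous, and let $\beta,a,f,dq$ be as in the context, with $dq$ satisfying $\int_{|z|<1}|z|^2dq+\int_{|z|\ge1}|z|\,dq<\infty$ and condition (A); let $dq_0$ be the rescaled measure from condition (A), and assume $dq_0$ satisfies condition (B) and $\int_{|z|<1}|z|^2dq_0+\int_{|z|\ge1}|z|\,dq_0<\infty$. For $\varepsilon>0$ let $u_\varepsilon$ be the viscosity solution of $$u_\varepsilon(x)-a(\tfrac{x}{\varepsilon})\int_{\mathbb{R}^M}[u_\varepsilon(x+\beta(z))-u_\varepsilon(x)-\mathbf{1}_{\{|z|\le1\}}\langle\nabla u_\varepsilon(x),\beta(z)\rangle]\,dq(z)-f(\tfrac{x}{\varepsilon})=0\ \text{in }\Omega,\qquad u_\varepsilon=\varphi\ \text{in }\Omega^c.$$ Then the limit $\bar u(x)=\lim_{\varepsilon\to0}u_\varepsilon(x)$ exists for every $x\in\mathbb{R}^N$, and $\bar u$ is the unique viscosity solution of $$\bar u(x)+\bar I_1\big(I_1[\bar u](x)\big)=0\ \text{in }\Omega,\qquad \bar u=\varphi\ \text{in }\Omega^c,$$ where $I_1[u](x)=\int_{\mathbb{R}^M}[u(x+\beta(z))-u(x)-\mathbf{1}_{\{|z|\le1\}}\langle\nabla u(x),\beta(z)\rangle]\,dq(z)$ and $\bar I_1$ is defined in the context.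
   Context: $\mathbb{T}^N=[0,1]^N$. $\beta:\mathbb{R}^M\to\mathbb{R}^N$ continuous, $\beta(cz)=c\beta(z)$ for $c>0$, $|\beta(z)|\le B_1|z|$. $a,f:\mathbb{R}^N\to\mathbb{R}$ continuous and $\mathbb{Z}^N$-periodic, $a\ge a_0>0$, $|a(y)-a(y')|\le L|y-y'|^{\theta_1}$, $|f(y)-f(y')|\le L|y-y'|^{\theta_2}$, $\theta_1,\theta_2\in(0,1]$. $dq(z)=q(z)dz$ positive Radon measure on $\mathbb{R}^M$. Condition (A): there exist $\alpha\in(0,2)$ and $C_1>0$ with $\varepsilon^{M+\alpha}q(\varepsilon z)\le C_1|z|^{-(M+\alpha)}$ for all $\varepsilon\in(0,1)$, $z\in\mathbb{R}^M$, and a subset $S_0\subset\mathrm{supp}(dq)$ and a positive function $q_0$ with $\lim_{\varepsilon\downarrow0}\varepsilon^{M+\alpha}q(\varepsilon z)=q_0(z)$ for $z\in S_0$ and $=0$ for $z\notin S_0$. The rescaled measure is $dq_0(z)=q_0(z)dz$ on $S_0$ and $0$ on $\mathbb{R}^M\setminus S_0$. Condition (B): with $S_0=\mathrm{supp}(dq_0)$, for any $y,y'\in\mathbb{T}^N$ there exist $y_1=y,\dots,y_m=y'$ in $\mathbb{T}^N$ such that for any $\varepsilon_i>0$ there are $J_i\subset S_0$ ($1\le i\le m-1$) with $y_i+\beta(z)\in B_{\varepsilon_i}(y_{i+1})$ (mod $\mathbb{Z}^N$) for $z\in J_i$ and $\int_{J_i}dq_0>0$. Effective operator: for $I\in\mathbb{R}$,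 $d_I$ is the unique real number such that for every $\delta>0$ there exist a periodic viscosity subsolution of $d_I-a(y)\int_{\mathbb{R}^M}[v(y+\beta(z))-v(y)-\langle\nabla v(y),\beta(z)\rangle]dq_0(z)-a(y)I-f(y)\le\delta$ in $\mathbb{T}^N$ and a periodic viscosity supersolution of the same expression $\ge-\delta$ (such a number exists and is unique under these assumptions); set $\bar I_1(I)=-d_I$. Viscosity solutions of the $\varepsilon$-problem: $u:\mathbb{R}^N\to\mathbb{R}$ with $u=\varphi$ on $\Omega^c$; $u$ (upper semicontinuous) is a subsolution if for every $\hat x\in\Omega$ and $\psi\in C^2(\mathbb{R}^N)$ with $u-\psi$ attaining a global maximum at $\hat x$, $u(\hat x)=\psi(\hat x)$, the function $z\mapsto u(\hat x+\beta(z))-u(\hat x)-\mathbf{1}_{\{|z|\le1\}}\langle\nabla\psi(\hat x),\beta(z)\rangle$ is $dq$-integrable and $u(\hat x)-a(\hat x/\varepsilon)\int[\dots]dq-f(\hat x/\varepsilon)\le0$; supersolution: lower semicontinuous, global minimum, "$\ge0$"; solution: both. Viscosity solutions of the effective problem: $u=\varphi$ on $\Omega^c$; $u$ is a subsolution (resp. supersolution) if for every $\hat x\in\Omega$ and $\psi\in C^2$ (with $I_1[\psi](\hat x)$ finite) such that $u-\psi$ has a global maximum (resp. minimum) at $\hat x$ and $u(\hat x)=\psi(\hat x)$, one has $u(\hat x)+\bar I_1(I_1[\psi](\hat x))\le0$ (resp. $\ge0$). *)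

theory Defs
  imports "HOL-Analysis.Analysis"
begin

definition int_lattice :: "(real^'n) set" where
  "int_lattice = {k. \<forall>i. k $ i \<in> \<int>}"

definition unit_cube :: "(real^'n) set" where
  "unit_cube = {y. \<forall>i. 0 \<le> y $ i \<and> y $ i \<le> 1}"

definition zperiodic :: "(real^'n \<Rightarrow> real) \<Rightarrow> bool" where
  "zperiodic g \<longleftrightarrow> (\<forall>y. \<forall>k\<in>int_lattice. g (y + k) = g y)"

definition usc :: "('a::topological_space \<Rightarrow> real) \<Rightarrow> bool" where
  "usc u \<longleftrightarrow> (\<forall>c. open {x. u x < c})"

definition lsc :: "('a::topological_space \<Rightarrow> real) \<Rightarrow> bool" where
  "lsc u \<longleftrightarrow> (\<forall>c. open {x. u x > c})"

definition C2 :: "(real^'n \<Rightarrow> real) \<Rightarrow> bool" where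
  "C2 \<psi> \<longleftrightarrow> (\<exists>g H. (\<forall>x. GDERIV \<psi> x :> g x) \<and>
      (\<forall>x. (g has_derivative (\<lambda>h. H x *v h)) (at x)) \<and> continuous_on UNIV H)"

definition grad :: "(real^'n \<Rightarrow> real) \<Rightarrow> real^'n \<Rightarrow> real^'n" where
  "grad \<psi> x = (THE D. GDERIV \<psi> x :> D)"

definition dens :: "(real^'m \<Rightarrow> real) \<Rightarrow> (real^'m) measure" where
  "dens q = density lborel (\<lambda>z. ennreal (q z))"

definition msupp :: "'a::metric_space measure \<Rightarrow> 'a set" where
  "msupp \<mu> = {z. \<forall>e>0. emeasure \<mu> (ball z e) > 0}"

definition levy_moment :: "(real^'m \<Rightarrow> real) \<Rightarrow> bool" where
  "levy_moment q \<longleftrightarrow>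
     (\<integral>\<^sup>+ z. ennreal (if norm z < 1 then (norm z)\<^sup>2 else norm z) \<partial>(dens q)) < \<infinity>"

definition jump1 :: "(real^'m \<Rightarrow> real^'n) \<Rightarrow> (real^'n \<Rightarrow> real) \<Rightarrow> real^'n \<Rightarrow> real^'n
                      \<Rightarrow> real^'m \<Rightarrow> real" where
  "jump1 \<beta> u x p z = u (x + \<beta> z) - u x - (if norm z \<le> 1 then inner p (\<beta> z) else 0)"

definition eps_sub ::
  "(real^'m \<Rightarrow> real) \<Rightarrow> (real^'m \<Rightarrow> real^'n) \<Rightarrow> (real^'n \<Rightarrow> real) \<Rightarrow> (real^'n \<Rightarrow> real)
   \<Rightarrow> (real^'n) set \<Rightarrow> (real^'n \<Rightarrow> real) \<Rightarrow> real \<Rightarrow> (real^'n \<Rightarrow> real) \<Rightarrow> bool" where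
  "eps_sub q \<beta> a f \<Omega> \<phi> \<epsilon> u \<longleftrightarrow> usc u \<and> (\<forall>x\<in>-\<Omega>. u x = \<phi> x) \<and>
     (\<forall>xh\<in>\<Omega>. \<forall>\<psi>. C2 \<psi> \<and> (\<forall>y. u y - \<psi> y \<le> u xh - \<psi> xh) \<and> u xh = \<psi> xh \<longrightarrow>
        integrable (dens q) (jump1 \<beta> u xh (grad \<psi> xh)) \<and>
        u xh - a (xh /\<^sub>R \<epsilon>) * (\<integral>z. jump1 \<beta> u xh (grad \<psi> xh) z \<partial>(dens q))
          - f (xh /\<^sub>R \<epsilon>) \<le> 0)"

definition eps_super ::
  "(real^'m \<Rightarrow> real) \<Rightarrow> (real^'m \<Rightarrow> real^'n) \<Rightarrow> (real^'n \<Rightarrow> real) \<Rightarrow> (real^'n \<Rightarrow> real)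
   \<Rightarrow> (real^'n) set \<Rightarrow> (real^'n \<Rightarrow> real) \<Rightarrow> real \<Rightarrow> (real^'n \<Rightarrow> real) \<Rightarrow> bool" where
  "eps_super q \<beta> a f \<Omega> \<phi> \<epsilon> u \<longleftrightarrow> lsc u \<and> (\<forall>x\<in>-\<Omega>. u x = \<phi> x) \<and>
     (\<forall>xh\<in>\<Omega>. \<forall>\<psi>. C2 \<psi> \<and> (\<forall>y. u y - \<psi> y \<ge> u xh - \<psi> xh) \<and> u xh = \<psi> xh \<longrightarrow>
        integrable (dens q) (jump1 \<beta> u xh (grad \<psi> xh)) \<and>
        u xh - a (xh /\<^sub>R \<epsilon>) * (\<integral>z. jump1 \<beta> u xh (grad \<psi> xh) z \<partial>(dens q))
          - f (xh /\<^sub>R \<epsilon>) \<ge> 0)"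

definition eps_sol where
  "eps_sol q \<beta> a f \<Omega> \<phi> \<epsilon> u \<longleftrightarrow> eps_sub q \<beta> a f \<Omega> \<phi> \<epsilon> u \<and> eps_super q \<beta> a f \<Omega> \<phi> \<epsilon> u"

definition jump0 :: "(real^'m \<Rightarrow> real^'n) \<Rightarrow> (real^'n \<Rightarrow> real) \<Rightarrow> real^'n \<Rightarrow> real^'n
                      \<Rightarrow> real^'m \<Rightarrow> real" where
  "jump0 \<beta> v y p z = v (y + \<beta> z) - v y - inner p (\<beta> z)"

definition cell_sub ::
  "(real^'m \<Rightarrow> real) \<Rightarrow> (real^'m \<Rightarrow> real^'n) \<Rightarrow> (real^'n \<Rightarrow> real) \<Rightarrow> (real^'n \<Rightarrow> real)
   \<Rightarrow> real \<Rightarrow> real \<Rightarrow> real \<Rightarrow> (real^'n \<Rightarrow> real) \<Rightarrow> bool" where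
  "cell_sub q0 \<beta> a f I d \<delta> v \<longleftrightarrow> usc v \<and> zperiodic v \<and>
     (\<forall>y\<in>unit_cube. \<forall>\<psi>. C2 \<psi> \<and> (\<forall>y'. v y' - \<psi> y' \<le> v y - \<psi> y) \<and> v y = \<psi> y \<longrightarrow>
        integrable (dens q0) (jump0 \<beta> v y (grad \<psi> y)) \<and>
        d - a y * (\<integral>z. jump0 \<beta> v y (grad \<psi> y) z \<partial>(dens q0)) - a y * I - f y \<le> \<delta>)"

definition cell_super ::
  "(real^'m \<Rightarrow> real) \<Rightarrow> (real^'m \<Rightarrow> real^'n) \<Rightarrow> (real^'n \<Rightarrow> real) \<Rightarrow> (real^'n \<Rightarrow> real)
   \<Rightarrow> real \<Rightarrow> real \<Rightarrow> real \<Rightarrow> (real^'n \<Rightarrow> real) \<Rightarrow> bool" where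
  "cell_super q0 \<beta> a f I d \<delta> v \<longleftrightarrow> lsc v \<and> zperiodic v \<and>
     (\<forall>y\<in>unit_cube. \<forall>\<psi>. C2 \<psi> \<and> (\<forall>y'. v y' - \<psi> y' \<ge> v y - \<psi> y) \<and> v y = \<psi> y \<longrightarrow>
        integrable (dens q0) (jump0 \<beta> v y (grad \<psi> y)) \<and>
        d - a y * (\<integral>z. jump0 \<beta> v y (grad \<psi> y) z \<partial>(dens q0)) - a y * I - f y \<ge> - \<delta>)"

definition eff_const where
  "eff_const q0 \<beta> a f I = (THE d. \<forall>\<delta>>0. (\<exists>v. cell_sub q0 \<beta> a f I d \<delta> v) \<and>
                                           (\<exists>w. cell_super q0 \<beta> a f I d \<delta> w))"

definition Ibar1 where
  "Ibar1 q0 \<beta> a f I = - eff_const q0 \<beta> a f I"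

definition I1 where
  "I1 q \<beta> \<psi> x = (\<integral>z. jump1 \<beta> \<psi> x (grad \<psi> x) z \<partial>(dens q))"

definition eff_sub where
  "eff_sub q q0 \<beta> a f \<Omega> \<phi> u \<longleftrightarrow> usc u \<and> (\<forall>x\<in>-\<Omega>. u x = \<phi> x) \<and>
     (\<forall>xh\<in>\<Omega>. \<forall>\<psi>. C2 \<psi> \<and> integrable (dens q) (jump1 \<beta> \<psi> xh (grad \<psi> xh)) \<and>
        (\<forall>y. u y - \<psi> y \<le> u xh - \<psi> xh) \<and> u xh = \<psi> xh \<longrightarrow>
        u xh + Ibar1 q0 \<beta> a f (I1 q \<beta> \<psi> xh) \<le> 0)"

definition eff_super where
  "eff_super q q0 \<beta> a f \<Omega> \<phi> u \<longleftrightarrow> lsc u \<and> (\<forall>x\<in>-\<Omega>. u x = \<phi> x) \<and>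
     (\<forall>xh\<in>\<Omega>. \<forall>\<psi>. C2 \<psi> \<and> integrable (dens q) (jump1 \<beta> \<psi> xh (grad \<psi> xh)) \<and>
        (\<forall>y. u y - \<psi> y \<ge> u xh - \<psi> xh) \<and> u xh = \<psi> xh \<longrightarrow>
        u xh + Ibar1 q0 \<beta> a f (I1 q \<beta> \<psi> xh) \<ge> 0)"

definition eff_sol where
  "eff_sol q q0 \<beta> a f \<Omega> \<phi> u \<longleftrightarrow> eff_sub q q0 \<beta> a f \<Omega> \<phi> u \<and> eff_super q q0 \<beta> a f \<Omega> \<phi> u"

definition condA :: "(real^'m \<Rightarrow> real) \<Rightarrow> real \<Rightarrow> (real^'m) set \<Rightarrow> (real^'m \<Rightarrow> real) \<Rightarrow> bool" where
  "condA q \<alpha> S0 q0 \<longleftrightarrow> 0 < \<alpha> \<and> \<alpha> < 2 \<and>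
     (\<exists>C1>0. \<forall>\<epsilon>\<in>{0<..<1}. \<forall>z. z \<noteq> 0 \<longrightarrow>
        \<epsilon> powr (real CARD('m) + \<alpha>) * q (\<epsilon> *\<^sub>R z) \<le> C1 * norm z powr (- (real CARD('m) + \<alpha>))) \<and>
     S0 \<subseteq> msupp (dens q) \<and> (\<forall>z\<in>S0. q0 z > 0) \<and>
     (\<forall>z. ((\<lambda>\<epsilon>. \<epsilon> powr (real CARD('m) + \<alpha>) * q (\<epsilon> *\<^sub>R z)) \<longlongrightarrow>
            (if z \<in> S0 then q0 z else 0)) (at_right 0))"

definition rescaled :: "(real^'m) set \<Rightarrow> (real^'m \<Rightarrow> real) \<Rightarrow> real^'m \<Rightarrow> real" where
  "rescaled S0 q0 z = (if z \<in> S0 then q0 z else 0)"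

definition condB :: "(real^'m \<Rightarrow> real) \<Rightarrow> (real^'m \<Rightarrow> real^'n) \<Rightarrow> bool" where
  "condB q0' \<beta> \<longleftrightarrow> (\<forall>y\<in>unit_cube. \<forall>y'\<in>unit_cube. \<exists>m::nat. \<exists>ys. m \<ge> 1 \<and>
     ys 1 = y \<and> ys m = y' \<and> (\<forall>i\<in>{1..m}. ys i \<in> unit_cube) \<and>
     (\<forall>i\<in>{1..<m}. \<forall>e>0. \<exists>J. J \<in> sets lborel \<and> J \<subseteq> msupp (dens q0') \<and>
        (\<forall>z\<in>J. \<exists>k\<in>int_lattice. dist (ys i + \<beta> z + k) (ys (Suc i)) < e) \<and>
        emeasure (dens q0') J > 0))"

end

theory Submission
  imports Defs
begin

text \<open>Dividing the equation by \<open>a\<close> leaves a translation invariant linear operator \<open>I\<^sub>1\<close> with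
  oscillating coefficients \<open>b = 1 / a\<close> and \<open>g = f / a\<close>:
  \<open>b (x / \<epsilon>) u - I\<^sub>1 u = g (x / \<epsilon>)\<close>. Plane waves are eigenfunctions of \<open>I\<^sub>1\<close>. Conditions (A) and (B)
  and Fatou's lemma show that the symbol at frequency \<open>2 \<pi> k / \<epsilon>\<close> tends to infinity for every
  \<open>k \<noteq> 0\<close>, so the mean-free part of \<open>b\<close> and \<open>g\<close> (approximated by trigonometric polynomials) can be
  removed by uniformly small correctors, whatever the regularity of \<open>u\<close>. The corrected function is an
  approximate solution of \<open>K u - I\<^sub>1 u = F\<close>, where \<open>K\<close> and \<open>F\<close> are the means of \<open>b\<close> and \<open>g\<close>, and this is
  the effective equation. The comparison principle for that equation makes \<open>u \<epsilon>\<close> uniformly Cauchy as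
  \<open>\<epsilon>\<close> tends to \<open>0\<close>; in particular the limit is continuous up to the boundary.\<close>

section \<open>Paraboloid test functions\<close>

text \<open>Formally, the cell operator maps periodic functions to functions of mean zero, so
  averaging the divided cell equation leaves \<open>d * K = I + F\<close>: the effective constant is
  affine in \<open>I\<close>. The means \<open>K\<close> and \<open>F\<close> depend on the
  coefficients alone. Hence the same numbers serve the cell problem, whose operator is built on the
  rescaled density, and the oscillating problem, whose operator is built on \<open>q\<close>; the
  rescaled density reaches the latter only through a lower bound of the symbol. The obstacle is the
  zero-order term: its corrector has to be multiplied by \<open>u\<close>, and the nonlocal operator
  turns a product into a product of two increments, where that of \<open>u\<close> has no a priori
  control. Smallness of the corrector in the sup norm is therefore not enough, and a quadratic term
  in \<open>u\<close> has to help. No boundary layer appears: the functions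
  \<open>u \<epsilon>\<close> are continuous on the whole space and equal to \<open>\<phi>\<close>
  on the complement of an open set, so the differences of any two of them vanish there
  exactly.\<close>

lemma grad_eqI:
  assumes "GDERIV \<psi> x :> D"
  shows "grad \<psi> x = D"
proof -
  have "D' = D" if "GDERIV \<psi> x :> D'" for D'
  proof -
    have "(\<lambda>h. h \<bullet> D') = (\<lambda>h. h \<bullet> D)"
      using has_derivative_unique that assms unfolding gderiv_def by blast
    then show ?thesis by (metis vector_eq_ldot)
  qed
  then show ?thesis unfolding grad_def using assms by blast
qed

lemma GDERIV_quadratic:
  fixes x p :: "'a::real_inner"
  shows "GDERIV (\<lambda>y. c + p \<bullet> (y - x) + A * (norm (y - x))\<^sup>2) y :> p + (2 * A) *\<^sub>R (y - x)"
  unfolding gderiv_def power2_norm_eq_inner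
  by (auto intro!: derivative_eq_intros simp: inner_simps inner_commute algebra_simps)

lemma C2_quadratic: "C2 (\<lambda>y. c + p \<bullet> (y - x) + A * (norm (y - x))\<^sup>2)"
  unfolding C2_def
proof (intro exI conjI allI)
  show "GDERIV (\<lambda>y. c + p \<bullet> (y - x) + A * (norm (y - x))\<^sup>2) y :> p + (2 * A) *\<^sub>R (y - x)" for y
    by (rule GDERIV_quadratic)
  show "((\<lambda>y. p + (2 * A) *\<^sub>R (y - x)) has_derivative (\<lambda>h. ((2 * A) *\<^sub>R mat 1) *v h)) (at y)" for y
    by (auto intro!: derivative_eq_intros simp: scaleR_matrix_vector_assoc[symmetric])
qed (rule continuous_on_const)

lemma grad_quadratic:
  "grad (\<lambda>y. c + p \<bullet> (y - x) + A * (norm (y - x))\<^sup>2) x = p"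
  using grad_eqI[OF GDERIV_quadratic[of c p x A x]] by simp

text \<open>A solution is one function satisfying both definitions, so it is continuous on the whole
  space, in particular across the boundary; semicontinuous envelopes never enter.\<close>

lemma usc_lsc_imp_continuous:
  assumes "usc u" "lsc u"
  shows "continuous_on UNIV u"
proof -
  have "(u \<longlongrightarrow> u x) (at x)" for x
  proof (rule order_tendstoI)
    fix c
    show "eventually (\<lambda>y. c < u y) (at x)" if "c < u x"
      using assms(2) that unfolding lsc_def eventually_at_topological by blast
    show "eventually (\<lambda>y. u y < c) (at x)" if "u x < c"
      using assms(1) that unfolding usc_def eventually_at_topological by blast
  qed
  then show ?thesis by (auto simp: continuous_on_def)
qed

lemma continuous_imp_usc_lsc:
  assumes "continuous_on UNIV u"
  shows "usc u" "lsc u"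
  using assms unfolding usc_def lsc_def
  by (auto intro!: open_Collect_less continuous_on_const)

text \<open>Fatou's lemma for \<open>G - f n\<close>. Integrability of the limit is a conclusion:
  the lower bounds \<open>c n\<close>, which viscosity inequalities provide, keep the integral of
  \<open>G - g\<close> finite.\<close>

lemma reverse_fatou:
  fixes f :: "nat \<Rightarrow> 'a \<Rightarrow> real"
  assumes G: "integrable M G" and f: "\<And>n. integrable M (f n)" and le: "\<And>n z. f n z \<le> G z"
    and lim: "\<And>z. (\<lambda>n. f n z) \<longlonglongrightarrow> g z" and c: "\<And>n. c n \<le> (\<integral>z. f n z \<partial>M)" "c \<longlonglongrightarrow> c0"
  shows "integrable M g \<and> c0 \<le> (\<integral>z. g z \<partial>M)"
proof -
  have [measurable]: "G \<in> borel_measurable M" "\<And>n. f n \<in> borel_measurable M" using G f by auto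
  have [measurable]: "g \<in> borel_measurable M"
    by (rule borel_measurable_LIMSEQ_real[OF lim]) auto
  have gG: "g z \<le> G z" for z
    using LIMSEQ_le_const2[OF lim[of z]] le by blast
  have "(\<integral>\<^sup>+ z. ennreal (G z - g z) \<partial>M) = (\<integral>\<^sup>+ z. liminf (\<lambda>n. ennreal (G z - f n z)) \<partial>M)"
  proof (intro nn_integral_cong)
    fix z
    have "(\<lambda>n. ennreal (G z - f n z)) \<longlonglongrightarrow> ennreal (G z - g z)"
      by (intro tendsto_intros lim)
    then show "ennreal (G z - g z) = liminf (\<lambda>n. ennreal (G z - f n z))"
      by (simp add: lim_imp_Liminf)
  qed
  also have "\<dots> \<le> liminf (\<lambda>n. \<integral>\<^sup>+ z. ennreal (G z - f n z) \<partial>M)"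
    by (intro nn_integral_liminf) auto
  also have "\<dots> \<le> liminf (\<lambda>n. ennreal ((\<integral>z. G z \<partial>M) - c n))"
  proof (intro Liminf_mono always_eventually allI)
    fix n
    have "(\<integral>\<^sup>+ z. ennreal (G z - f n z) \<partial>M) = ennreal (\<integral>z. G z - f n z \<partial>M)"
      using le f G by (intro nn_integral_eq_integral) auto
    also have "\<dots> \<le> ennreal ((\<integral>z. G z \<partial>M) - c n)"
      using c(1)[of n] f[of n] G by (intro ennreal_leI) auto
    finally show "(\<integral>\<^sup>+ z. ennreal (G z - f n z) \<partial>M) \<le> ennreal ((\<integral>z. G z \<partial>M) - c n)" .
  qed
  also have "\<dots> = ennreal ((\<integral>z. G z \<partial>M) - c0)"
    by (intro lim_imp_Liminf tendsto_intros c) auto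
  finally have *: "(\<integral>\<^sup>+ z. ennreal (G z - g z) \<partial>M) \<le> ennreal ((\<integral>z. G z \<partial>M) - c0)" .
  have int: "integrable M (\<lambda>z. G z - g z)"
    using gG * by (intro integrableI_nonneg) (auto simp: order_le_less_trans)
  have "0 \<le> (\<integral>z. G z \<partial>M) - c n" for n
    using integral_mono[OF f[of n] G] le c(1)[of n] by (smt (verit))
  then have "0 \<le> (\<integral>z. G z \<partial>M) - c0"
    by (intro LIMSEQ_le_const[OF tendsto_diff[OF tendsto_const c(2)]]) auto
  moreover have "ennreal (\<integral>z. G z - g z \<partial>M) \<le> ennreal ((\<integral>z. G z \<partial>M) - c0)"
    using * int gG by (subst (asm) nn_integral_eq_integral) auto
  ultimately have le': "(\<integral>z. G z - g z \<partial>M) \<le> (\<integral>z. G z \<partial>M) - c0"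
    by (simp add: ennreal_le_iff)
  have g: "integrable M g"
    using Bochner_Integration.integrable_diff[OF G int]
    by (simp only: diff_diff_eq2 add_diff_cancel_left')
  with le' G show ?thesis by simp
qed

text \<open>Only the gradient of a test function enters the equation, so paraboloids suffice.
  Supersolutions \<open>u\<close> with right-hand side \<open>r\<close> appear as subsolutions \<open>- u\<close> with right-hand side \<open>- r\<close>.\<close>

definition quad_sub ::
  "(real^'m \<Rightarrow> real) \<Rightarrow> (real^'m \<Rightarrow> real^'n) \<Rightarrow> (real^'n) set \<Rightarrow> (real^'n \<Rightarrow> real) \<Rightarrow> (real^'n \<Rightarrow> real)
   \<Rightarrow> (real^'n \<Rightarrow> real) \<Rightarrow> bool" where
  "quad_sub q \<beta> \<Omega> c r u \<longleftrightarrow> (\<forall>x\<in>\<Omega>. \<forall>p A. (\<forall>h. u (x + h) \<le> u x + p \<bullet> h + A * (norm h)\<^sup>2) \<longrightarrow>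
     integrable (dens q) (jump1 \<beta> u x p) \<and> c x * u x - (\<integral>z. jump1 \<beta> u x p z \<partial>(dens q)) \<le> r x)"

text \<open>Enlarging the opening preserves touching from above, so openings
  \<open>A \<ge> 0\<close> suffice; the majorants below use this sign.\<close>

lemma quad_subI:
  assumes "\<And>x p A. x \<in> \<Omega> \<Longrightarrow> A \<ge> 0 \<Longrightarrow> (\<And>h. u (x + h) \<le> u x + p \<bullet> h + A * (norm h)\<^sup>2) \<Longrightarrow>
     integrable (dens q) (jump1 \<beta> u x p) \<and> c x * u x - (\<integral>z. jump1 \<beta> u x p z \<partial>(dens q)) \<le> r x"
  shows "quad_sub q \<beta> \<Omega> c r u"
  unfolding quad_sub_def
proof (intro ballI allI impI)
  fix x p A assume x: "x \<in> \<Omega>" and h: "\<forall>h. u (x + h) \<le> u x + p \<bullet> h + A * (norm h)\<^sup>2"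
  have t: "u (x + h) \<le> u x + p \<bullet> h + max A 0 * (norm h)\<^sup>2" for h
    using h[rule_format, of h] mult_right_mono[of A "max A 0" "(norm h)\<^sup>2"] by auto
  show "integrable (dens q) (jump1 \<beta> u x p) \<and> c x * u x - (\<integral>z. jump1 \<beta> u x p z \<partial>(dens q)) \<le> r x"
    by (rule assms[OF x _ t]) simp
qed

lemma jump1_uminus: "jump1 \<beta> (\<lambda>x. - u x) x (- p) = (\<lambda>z. - jump1 \<beta> u x p z)"
  by (auto simp: jump1_def fun_eq_iff)

lemma divided_inequality:
  fixes a u I f :: real
  assumes "a > 0" "u - a * I - f \<le> 0"
  shows "inverse a * u - I \<le> f / a"
proof -
  have "inverse a * (u - a * I - f) \<le> 0" using assms by (simp add: mult_le_0_iff)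
  moreover have "inverse a * (u - a * I - f) = inverse a * u - I - f / a"
    using assms(1) by (simp add: field_simps)
  ultimately show ?thesis by linarith
qed

lemma eps_sub_imp_quad_sub:
  assumes sub: "eps_sub q \<beta> a f \<Omega> \<phi> \<epsilon> u" and a: "\<And>y. a y > 0"
  shows "quad_sub q \<beta> \<Omega> (\<lambda>x. inverse (a (x /\<^sub>R \<epsilon>))) (\<lambda>x. f (x /\<^sub>R \<epsilon>) / a (x /\<^sub>R \<epsilon>)) u"
  unfolding quad_sub_def
proof (intro ballI allI impI)
  fix x p A assume x: "x \<in> \<Omega>" and h: "\<forall>h. u (x + h) \<le> u x + p \<bullet> h + A * (norm h)\<^sup>2"
  let ?\<psi> = "\<lambda>y. u x + p \<bullet> (y - x) + A * (norm (y - x))\<^sup>2"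
  have "u y - ?\<psi> y \<le> u x - ?\<psi> x" for y
    using h[rule_format, of "y - x"] by simp
  then have *: "integrable (dens q) (jump1 \<beta> u x p)"
     "u x - a (x /\<^sub>R \<epsilon>) * (\<integral>z. jump1 \<beta> u x p z \<partial>(dens q)) - f (x /\<^sub>R \<epsilon>) \<le> 0"
    using sub x C2_quadratic[of "u x" p x A] unfolding eps_sub_def
    by (force simp: grad_quadratic)+
  have "inverse (a (x /\<^sub>R \<epsilon>)) * u x - (\<integral>z. jump1 \<beta> u x p z \<partial>(dens q)) \<le> f (x /\<^sub>R \<epsilon>) / a (x /\<^sub>R \<epsilon>)"
    using divided_inequality[OF a *(2)] .
  with * show "integrable (dens q) (jump1 \<beta> u x p) \<and>
     inverse (a (x /\<^sub>R \<epsilon>)) * u x - (\<integral>z. jump1 \<beta> u x p z \<partial>(dens q)) \<le> f (x /\<^sub>R \<epsilon>) / a (x /\<^sub>R \<epsilon>)"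
    by blast
qed

lemma eps_super_imp_quad_sub:
  assumes sup: "eps_super q \<beta> a f \<Omega> \<phi> \<epsilon> u" and a: "\<And>y. a y > 0"
  shows "quad_sub q \<beta> \<Omega> (\<lambda>x. inverse (a (x /\<^sub>R \<epsilon>))) (\<lambda>x. - f (x /\<^sub>R \<epsilon>) / a (x /\<^sub>R \<epsilon>)) (\<lambda>x. - u x)"
  unfolding quad_sub_def
proof (intro ballI allI impI)
  fix x p A assume x: "x \<in> \<Omega>" and h: "\<forall>h. - u (x + h) \<le> - u x + p \<bullet> h + A * (norm h)\<^sup>2"
  let ?\<psi> = "\<lambda>y. u x + (- p) \<bullet> (y - x) + (- A) * (norm (y - x))\<^sup>2"
  have "u y - ?\<psi> y \<ge> u x - ?\<psi> x" for y
    using h[rule_format, of "y - x"] by simp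
  then have *: "integrable (dens q) (jump1 \<beta> u x (- p))"
     "u x - a (x /\<^sub>R \<epsilon>) * (\<integral>z. jump1 \<beta> u x (- p) z \<partial>(dens q)) - f (x /\<^sub>R \<epsilon>) \<ge> 0"
    using sup x C2_quadratic[of "u x" "-p" x "-A"] grad_quadratic[of "u x" "-p" x "-A"] unfolding eps_super_def
    by (force)+
  have "inverse (a (x /\<^sub>R \<epsilon>)) * u x - (\<integral>z. jump1 \<beta> u x (- p) z \<partial>(dens q)) \<ge> f (x /\<^sub>R \<epsilon>) / a (x /\<^sub>R \<epsilon>)"
    using *(2) a[of "x /\<^sub>R \<epsilon>"] by (simp add: field_simps)
  with * show "integrable (dens q) (jump1 \<beta> (\<lambda>x. - u x) x p) \<and>
     inverse (a (x /\<^sub>R \<epsilon>)) * - u x - (\<integral>z. jump1 \<beta> (\<lambda>x. - u x) x p z \<partial>(dens q)) \<le> - f (x /\<^sub>R \<epsilon>) / a (x /\<^sub>R \<epsilon>)"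
    using jump1_uminus[of \<beta> u x "-p"] by simp
qed

section \<open>Levy densities and their dominating weight\<close>

definition weight :: "real^'m \<Rightarrow> real" where
  "weight z = (if norm z < 1 then (norm z)\<^sup>2 else norm z)"

lemma weight_nonneg: "weight z \<ge> 0"
  and weight_ge_square: "norm z \<le> 1 \<Longrightarrow> (norm z)\<^sup>2 \<le> weight z"
  and weight_ge_norm: "norm z \<ge> 1 \<Longrightarrow> norm z \<le> weight z"
  and weight_ge_1: "norm z \<ge> 1 \<Longrightarrow> 1 \<le> weight z"
  by (auto simp: weight_def power2_eq_square mult_left_le)

lemma sets_dens [simp, measurable_cong]: "sets (dens q) = sets borel"
  and space_dens [simp]: "space (dens q) = UNIV"
  by (simp_all add: dens_def)

text \<open>Interpreted both for \<open>q\<close> and for the rescaled density, so that the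
  oscillating problem and the cell problem share the corrector lemmas.\<close>

locale levy =
  fixes \<beta> :: "real^'m \<Rightarrow> real^'n" and q :: "real^'m \<Rightarrow> real" and B :: real
  assumes \<beta>_cont: "continuous_on UNIV \<beta>"
    and \<beta>_bound: "\<And>z. norm (\<beta> z) \<le> B * norm z"
    and q_measurable: "q \<in> borel_measurable borel"
    and q_nonneg: "\<And>z. q z \<ge> 0"
    and q_moment: "levy_moment q"
begin

lemma B_nonneg: "B \<ge> 0"
proof -
  have "0 \<le> norm (\<beta> (axis undefined 1))" by simp
  also have "\<dots> \<le> B * norm (axis undefined (1::real) :: real^'m)" by (rule \<beta>_bound)
  finally show ?thesis by simp
qed

lemma \<beta>_square_le: "(norm (\<beta> z))\<^sup>2 \<le> B\<^sup>2 * (norm z)\<^sup>2"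
  using power_mono[OF \<beta>_bound[of z], of 2] by (simp add: power_mult_distrib)

lemma small_jump_le: "norm z \<le> 1 \<Longrightarrow> (norm (\<beta> z))\<^sup>2 \<le> B\<^sup>2 * weight z"
  using \<beta>_square_le[of z] mult_left_mono[OF weight_ge_square[of z], of "B\<^sup>2"] by simp

lemma large_jump_le: "norm z \<ge> 1 \<Longrightarrow> norm (\<beta> z) \<le> B * weight z"
  using \<beta>_bound[of z] mult_left_mono[OF weight_ge_norm[of z], of B] B_nonneg by simp

lemma \<beta>_measurable [measurable]: "\<beta> \<in> borel_measurable borel"
  using \<beta>_cont by (rule borel_measurable_continuous_onI)

lemma weight_measurable [measurable]: "weight \<in> borel_measurable borel"
  unfolding weight_def by measurable

lemma integrable_weight: "integrable (dens q) weight"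
proof (rule integrableI_nonneg)
  show "(\<integral>\<^sup>+ z. ennreal (weight z) \<partial>dens q) < \<infinity>"
    using q_moment unfolding levy_moment_def weight_def .
qed (auto simp: weight_nonneg)

lemma integrable_le_weight:
  assumes "F \<in> borel_measurable borel" "\<And>z. \<bar>F z\<bar> \<le> C * weight z"
  shows "integrable (dens q) (F :: real^'m \<Rightarrow> real)"
proof (rule Bochner_Integration.integrable_bound)
  show "integrable (dens q) (\<lambda>z. C * weight z)" using integrable_weight by simp
  show "AE z in dens q. norm (F z) \<le> norm (C * weight z)"
    using assms(2) by (intro always_eventually allI) (metis abs_ge_self order_trans real_norm_def)
qed (use assms in simp)

lemma jump1_measurable [measurable]:
  assumes "continuous_on UNIV u"
  shows "jump1 \<beta> u x p \<in> borel_measurable borel"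
proof -
  have [measurable]: "u \<in> borel_measurable borel"
    using assms by (rule borel_measurable_continuous_onI)
  show ?thesis unfolding jump1_def by measurable
qed

text \<open>A compensated jump has \<open>norm z \<le> 1\<close>, hence
  \<open>norm (\<beta> z) \<le> B\<close>, so the paraboloid is required only on that ball; for
  larger \<open>z\<close> the jump is at most \<open>2 * R\<close> and the weight at least 1. The
  bound is one-sided because touching from above controls nothing from below.\<close>

lemma jump1_le_weight:
  assumes "\<And>h. norm h \<le> B \<Longrightarrow> u (x + h) \<le> u x + p \<bullet> h + A * (norm h)\<^sup>2" "A \<ge> 0" "\<And>y. \<bar>u y\<bar> \<le> R"
  shows "jump1 \<beta> u x p z \<le> (A * B\<^sup>2 + 2 * R) * weight z"
proof -
  have R: "R \<ge> 0" using assms(3)[of x] by linarith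
  show ?thesis
  proof (cases "norm z \<le> 1")
    case True
    have "norm (\<beta> z) \<le> B"
      using \<beta>_bound[of z] True B_nonneg by (smt (verit) mult_left_le)
    then have "jump1 \<beta> u x p z \<le> A * (norm (\<beta> z))\<^sup>2"
      using assms(1)[of "\<beta> z"] True by (simp add: jump1_def)
    also have "\<dots> \<le> A * (B\<^sup>2 * weight z)"
      using small_jump_le[OF True] assms(2) by (rule mult_left_mono)
    also have "\<dots> \<le> A * (B\<^sup>2 * weight z) + 2 * R * weight z" using R weight_nonneg[of z] by simp
    finally show ?thesis by (simp add: algebra_simps)
  next
    case False
    have "jump1 \<beta> u x p z \<le> 2 * R"
      using False assms(3)[of "x + \<beta> z"] assms(3)[of x] by (simp add: jump1_def)
    also have "\<dots> \<le> 2 * R * weight z" using mult_left_mono[of 1 "weight z" "2 * R"] R weight_ge_1[of z] False by simp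
    also have "\<dots> \<le> A * B\<^sup>2 * weight z + 2 * R * weight z" using assms(2) weight_nonneg[of z] by simp
    finally show ?thesis by (simp add: algebra_simps)
  qed
qed

end

section \<open>The comparison principle with constant coefficients\<close>

text \<open>The smooth substitute sqrt (1 + |x|^2) for the norm; as the norm of a pair it inherits
  its Lipschitz bound from the triangle inequality.\<close>

definition japanese :: "'a::real_inner \<Rightarrow> real" where
  "japanese x = norm (1::real, x)"

lemma japanese_square: "(japanese x)\<^sup>2 = 1 + (norm x)\<^sup>2"
  by (simp add: japanese_def norm_Pair)

lemma japanese_ge_1: "japanese x \<ge> 1"
  using norm_fst_le[of "1::real" x] by (simp add: japanese_def)

lemma norm_le_japanese: "norm x \<le> japanese x"
  using norm_snd_le[of x "1::real"] by (simp add: japanese_def)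

lemma japanese_diff_le: "japanese (x + h) - japanese x \<le> norm h"
  using norm_triangle_ineq[of "(1::real, x)" "(0, h)"] by (simp add: japanese_def norm_Pair)

lemma continuous_on_japanese: "continuous_on S japanese"
  unfolding japanese_def by (intro continuous_intros)

text \<open>For the values \<open>s\<close>, \<open>t\<close> at \<open>x\<close> and
  \<open>x + h\<close>, the inequality \<open>2 * s * t \<le> s^2 + t^2\<close> and the exact
  expansion of \<open>t^2\<close> give the claim after division by \<open>2 * s\<close>, since
  \<open>s \<ge> 1\<close>. The paraboloid is valid for all \<open>h\<close>, which the nonlocal
  operator requires.\<close>

lemma japanese_quadratic:
  "japanese (x + h) \<le> japanese x + (x /\<^sub>R japanese x) \<bullet> h + (norm h)\<^sup>2 / 2"
proof -
  define s where "s = japanese x"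
  define t where "t = japanese (x + h)"
  have s: "s \<ge> 1" unfolding s_def by (rule japanese_ge_1)
  have "t\<^sup>2 = s\<^sup>2 + 2 * (x \<bullet> h) + (norm h)\<^sup>2"
    unfolding s_def t_def japanese_square by (simp add: power2_norm_eq_inner inner_simps inner_commute)
  moreover have "0 \<le> (t - s)\<^sup>2" by simp
  ultimately have "2 * s * t \<le> 2 * s\<^sup>2 + 2 * (x \<bullet> h) + (norm h)\<^sup>2"
    by (simp add: power2_diff algebra_simps)
  also have "\<dots> \<le> 2 * s\<^sup>2 + 2 * (x \<bullet> h) + s * (norm h)\<^sup>2"
    using mult_right_mono[OF s, of "(norm h)\<^sup>2"] by simp
  also have "\<dots> = 2 * s * (s + (x \<bullet> h) / s + (norm h)\<^sup>2 / 2)"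
    using s by (simp add: field_simps power2_eq_square)
  finally have "t \<le> s + (x \<bullet> h) / s + (norm h)\<^sup>2 / 2" using s by simp
  then show ?thesis unfolding s_def t_def inner_scaleR_left divide_inverse_commute[of "x \<bullet> h"] .
qed

lemma continuous_coercive_attains_sup:
  fixes \<Phi> :: "'a::euclidean_space \<Rightarrow> real"
  assumes "continuous_on UNIV \<Phi>" "bounded {w. \<Phi> w0 \<le> \<Phi> w}"
  obtains w where "\<And>w'. \<Phi> w' \<le> \<Phi> w"
proof -
  let ?S = "{w. \<Phi> w0 \<le> \<Phi> w}"
  have "closed ?S" using assms(1) by (intro closed_Collect_le continuous_intros)
  then have "compact ?S" using assms(2) compact_eq_bounded_closed by blast
  moreover have "w0 \<in> ?S" by simp
  ultimately obtain w where w: "\<Phi> w0 \<le> \<Phi> w" "\<And>w'. \<Phi> w0 \<le> \<Phi> w' \<Longrightarrow> \<Phi> w' \<le> \<Phi> w"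
    using continuous_attains_sup[of ?S \<Phi>] continuous_on_subset[OF assms(1)] by blast
  have "\<Phi> w' \<le> \<Phi> w" for w'
    using w(1) w(2)[of w'] by linarith
  then show ?thesis by (rule that)
qed

context levy
begin

text \<open>Doubling of variables: both points jump by the same vector, so the integrands of the two
  nonlocal terms add up pointwise.\<close>

lemma comparison:
  fixes U V :: "real^'n \<Rightarrow> real"
  assumes \<Omega>: "open \<Omega>" and U: "continuous_on UNIV U" "\<And>x. \<bar>U x\<bar> \<le> R"
    and V: "continuous_on UNIV V" "\<And>x. \<bar>V x\<bar> \<le> R" and K: "K > 0"
    and subU: "quad_sub q \<beta> \<Omega> (\<lambda>_. K) (\<lambda>_. F1) U"
    and subV: "quad_sub q \<beta> \<Omega> (\<lambda>_. K) (\<lambda>_. F2) V"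
    and out: "\<And>x. x \<notin> \<Omega> \<Longrightarrow> U x + V x \<le> \<sigma>"
  shows "U x0 + V x0 \<le> max \<sigma> ((F1 + F2) / K)"
proof (rule ccontr)
  assume neg: "\<not> U x0 + V x0 \<le> max \<sigma> ((F1 + F2) / K)"
  define m where "m = max \<sigma> ((F1 + F2) / K)"
  \<comment> \<open>Half of the excess pays for the localising term at \<open>x0\<close>; the other
    half is the margin contradicted at the end.\<close>
  define d where "d = (U x0 + V x0 - m) / 2"
  have d: "d > 0" "U x0 + V x0 = m + 2 * d"
    using neg unfolding d_def m_def[symmetric] not_le by (auto simp: field_simps)
  \<comment> \<open>\<open>\<kappa> * C\<close> will bound the nonlocal contribution of the
    localising term; \<open>\<kappa>\<close> is fitted to ensure both
    \<open>\<kappa> * japanese x0 \<le> d\<close> and \<open>\<kappa> * (C / K) < d\<close>.\<close>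
  define C where "C = (B\<^sup>2 + B) * (\<integral>z. weight z \<partial>(dens q))"
  have C: "C \<ge> 0" unfolding C_def using B_nonneg by (intro mult_nonneg_nonneg Bochner_Integration.integral_nonneg) (simp_all add: weight_nonneg)
  define \<kappa> where "\<kappa> = d / (japanese x0 + C / K + 1)"
  have CK: "C / K \<ge> 0" using C K by simp
  have pos: "japanese x0 + C / K + 1 > 0" using japanese_ge_1[of x0] CK by linarith
  have \<kappa>: "\<kappa> > 0" unfolding \<kappa>_def using d(1) pos by (rule divide_pos_pos)
  have "\<kappa> * (japanese x0 + C / K + 1) = d" unfolding \<kappa>_def using pos by (intro nonzero_eq_divide_eq[THEN iffD1, OF _ refl]) linarith
  then have \<kappa>d: "\<kappa> * japanese x0 + \<kappa> * (C / K) + \<kappa> = d" by (simp only: distrib_left mult_1_right)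
  have nn: "0 \<le> \<kappa> * japanese x0" "0 \<le> \<kappa> * (C / K)"
    using \<kappa> CK japanese_ge_1[of x0] by (auto simp del: times_divide_eq_right intro!: mult_nonneg_nonneg)
  have \<kappa>0: "\<kappa> * japanese x0 \<le> d" using \<kappa>d \<kappa> nn by linarith
  have \<kappa>C: "\<kappa> * (C / K) < d" using \<kappa>d \<kappa> nn japanese_ge_1[of x0] mult_pos_pos[of \<kappa> "japanese x0"] by linarith
  \<comment> \<open>Only the first variable is localised; the quadratic penalty keeps the second one
    near it.\<close>
  define \<Phi> where "\<Phi> n w = U (fst w) + V (snd w) - real (Suc n) * (norm (fst w - snd w))\<^sup>2
      - \<kappa> * japanese (fst w)" for n :: nat and w :: "(real^'n) \<times> (real^'n)"
  have \<Phi>0: "\<Phi> n (x0, x0) \<ge> m + d" for n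
    unfolding \<Phi>_def using d \<kappa>0 by simp
  define c where "c = 2 * R - (m + d)"
  have level: "\<kappa> * japanese (fst w) \<le> c \<and> real (Suc n) * (norm (fst w - snd w))\<^sup>2 \<le> c
      \<and> m + d \<le> U (fst w) + V (snd w)"
    if "\<Phi> n w \<ge> m + d" for n w
  proof -
    have "0 \<le> \<kappa> * japanese (fst w)" using \<kappa> japanese_ge_1[of "fst w"] by simp
    moreover have "0 \<le> real (Suc n) * (norm (fst w - snd w))\<^sup>2" by simp
    ultimately show ?thesis
      using that U(2)[of "fst w"] V(2)[of "snd w"] unfolding \<Phi>_def c_def by linarith
  qed
  have bnd: "norm (fst w) \<le> c / \<kappa>" "norm (fst w - snd w) \<le> c + 1" if "\<Phi> n w \<ge> m + d" for n w
  proof -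
    have "\<kappa> * norm (fst w) \<le> c"
      using level[OF that] mult_left_mono[OF norm_le_japanese[of "fst w"], of \<kappa>] \<kappa> by linarith
    then show "norm (fst w) \<le> c / \<kappa>" using \<kappa> by (simp add: field_simps)
    have "1 * (norm (fst w - snd w))\<^sup>2 \<le> real (Suc n) * (norm (fst w - snd w))\<^sup>2"
      by (rule mult_right_mono) auto
    then have "(norm (fst w - snd w))\<^sup>2 \<le> c" using level[OF that] by linarith
    moreover have "2 * norm (fst w - snd w) \<le> (norm (fst w - snd w))\<^sup>2 + 1"
      using zero_le_power2[of "norm (fst w - snd w) - 1"] by (simp add: power2_diff)
    ultimately show "norm (fst w - snd w) \<le> c + 1" using norm_ge_zero[of "fst w - snd w"] by linarith
  qed
  have "\<exists>w. \<forall>w'. \<Phi> n w' \<le> \<Phi> n w" for n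
  proof -
    have "continuous_on UNIV (\<lambda>w. U (fst w))" "continuous_on UNIV (\<lambda>w. V (snd w))"
      "continuous_on UNIV (\<lambda>w. japanese (fst w :: real^'n))"
      by (rule continuous_on_compose2[OF U(1)] continuous_on_compose2[OF V(1)]
           continuous_on_compose2[OF continuous_on_japanese[of UNIV]],
          rule continuous_on_fst continuous_on_snd, rule continuous_on_id, rule subset_UNIV)+
    then have "continuous_on UNIV (\<Phi> n)" unfolding \<Phi>_def
      by (intro continuous_on_add continuous_on_diff continuous_on_mult continuous_on_const
            continuous_on_power continuous_on_norm continuous_on_fst continuous_on_snd continuous_on_id)
    moreover have "bounded {w. \<Phi> n (x0, x0) \<le> \<Phi> n w}"
    proof (rule boundedI)
      fix w assume "w \<in> {w. \<Phi> n (x0, x0) \<le> \<Phi> n w}"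
      then have "\<Phi> n w \<ge> m + d" using \<Phi>0[of n] by simp
      from bnd[OF this] show "norm w \<le> c / \<kappa> + (c / \<kappa> + (c + 1))"
        using norm_Pair_le[of "fst w" "snd w"] norm_triangle_sub[of "snd w" "fst w"]
        by (simp add: norm_minus_commute)
    qed
    ultimately show ?thesis by (rule continuous_coercive_attains_sup) blast
  qed
  then obtain w where w: "\<And>n w'. \<Phi> n w' \<le> \<Phi> n (w n)" by metis
  have lev: "\<Phi> n (w n) \<ge> m + d" for n using w[of n "(x0,x0)"] \<Phi>0[of n] by linarith
  define x y where "x n = fst (w n)" and "y n = snd (w n)" for n
  have "bounded (range x)"
    using bnd(1)[OF lev] unfolding x_def by (intro boundedI[of _ "c / \<kappa>"]) auto
  then obtain l r where r: "strict_mono r" "(x \<circ> r) \<longlonglongrightarrow> l"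
    using bounded_imp_convergent_subsequence by blast
  have "(\<lambda>n. norm (x n - y n)) \<longlonglongrightarrow> 0"
  proof (rule tendsto_sandwich[OF _ _ tendsto_const])
    show "eventually (\<lambda>n. norm (x n - y n) \<le> sqrt (c * inverse (real (Suc n)))) sequentially"
    proof (intro always_eventually allI real_le_rsqrt)
      fix n
      have "real (Suc n) * (norm (x n - y n))\<^sup>2 \<le> c"
        using level[OF lev[of n]] unfolding x_def y_def by blast
      then show "(norm (x n - y n))\<^sup>2 \<le> c * inverse (real (Suc n))"
        by (simp add: field_simps)
    qed
    show "(\<lambda>n. sqrt (c * inverse (real (Suc n)))) \<longlonglongrightarrow> 0"
      using tendsto_real_sqrt[OF tendsto_mult_right_zero[OF LIMSEQ_inverse_real_of_nat, of c]] by simp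
  qed auto
  then have "(\<lambda>n. x n - y n) \<longlonglongrightarrow> 0" using tendsto_norm_zero_iff by blast
  then have "((\<lambda>n. x n - y n) \<circ> r) \<longlonglongrightarrow> 0" by (rule LIMSEQ_subseq_LIMSEQ[OF _ r(1)])
  from tendsto_diff[OF r(2) this] have ry: "(\<lambda>n. y (r n)) \<longlonglongrightarrow> l"
    by (simp add: o_def)
  have rx: "(\<lambda>n. x (r n)) \<longlonglongrightarrow> l" using r(2) by (simp add: o_def)
  have "(\<lambda>n. U (x (r n)) + V (y (r n))) \<longlonglongrightarrow> U l + V l"
    using U(1) V(1) rx ry
    by (intro tendsto_add continuous_on_tendsto_compose[of UNIV U] continuous_on_tendsto_compose[of UNIV V]) auto
  moreover have "m + d \<le> U (x (r n)) + V (y (r n))" for n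
    using level[OF lev[of "r n"]] unfolding x_def y_def by blast
  ultimately have "m + d \<le> U l + V l" by (intro LIMSEQ_le_const) auto
  \<comment> \<open>Outside \<open>\<Omega>\<close> the sum is at most
    \<open>\<sigma> \<le> m\<close>, against \<open>m + d\<close> at \<open>l\<close>. As
    \<open>\<Omega>\<close> is open, both maximising points eventually lie in it along the
    subsequence.\<close>
  then have "l \<in> \<Omega>" using out[of l] d(1) unfolding m_def by force
  then have "eventually (\<lambda>n. x (r n) \<in> \<Omega> \<and> y (r n) \<in> \<Omega>) sequentially"
    using rx ry \<Omega> by (intro eventually_conj) (auto dest: topological_tendstoD)
  then obtain k where k: "x (r k) \<in> \<Omega>" "y (r k) \<in> \<Omega>"
    by (auto simp: eventually_sequentially)
  define n where "n = r k"
  define X Y N where "X = x n" and "Y = y n" and "N = real (Suc n)"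
  have XY: "X \<in> \<Omega>" "Y \<in> \<Omega>" using k by (simp_all add: X_def Y_def n_def)
  have max: "U (X + h) + V (Y + h') - N * (norm (X + h - (Y + h')))\<^sup>2 - \<kappa> * japanese (X + h)
      \<le> U X + V Y - N * (norm (X - Y))\<^sup>2 - \<kappa> * japanese X" for h h'
    using w[of n "(X + h, Y + h')"] unfolding \<Phi>_def X_def Y_def N_def x_def y_def by simp
  \<comment> \<open>Slopes of the penalty in the two variables. They add up to
    \<open>\<kappa>\<close> times the gradient of \<open>japanese\<close>, so the parts of size
    \<open>N\<close> cancel in the compensators.\<close>
  define p1 where "p1 = (2 * N) *\<^sub>R (X - Y) + \<kappa> *\<^sub>R (X /\<^sub>R japanese X)"
  define p2 where "p2 = (2 * N) *\<^sub>R (Y - X)"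
  have sq: "N * (norm (X + h - (Y + h')))\<^sup>2
      = N * (norm (X - Y))\<^sup>2 + (2 * N) * ((X - Y) \<bullet> (h - h')) + N * (norm (h - h'))\<^sup>2" for h h'
  proof -
    have "X + h - (Y + h') = (X - Y) + (h - h')" by simp
    then have "(norm (X + h - (Y + h')))\<^sup>2 = (norm (X - Y))\<^sup>2 + 2 * ((X - Y) \<bullet> (h - h')) + (norm (h - h'))\<^sup>2"
      by (simp only: power2_norm_eq_inner) (simp add: inner_simps inner_commute algebra_simps)
    then show ?thesis by (simp add: distrib_left)
  qed
  have "U (X + h) \<le> U X + p1 \<bullet> h + (N + \<kappa> / 2) * (norm h)\<^sup>2" for h
    using max[of h 0] sq[of h 0] mult_left_mono[OF japanese_quadratic[of X h], of \<kappa>] \<kappa>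
    unfolding p1_def by (simp add: inner_simps algebra_simps)
  then have A1: "integrable (dens q) (jump1 \<beta> U X p1)" "K * U X - (\<integral>z. jump1 \<beta> U X p1 z \<partial>(dens q)) \<le> F1"
    using subU XY unfolding quad_sub_def by blast+
  have "V (Y + h) \<le> V Y + p2 \<bullet> h + N * (norm h)\<^sup>2" for h
    using max[of 0 h] sq[of 0 h] unfolding p2_def by (simp add: inner_simps algebra_simps)
  then have A2: "integrable (dens q) (jump1 \<beta> V Y p2)" "K * V Y - (\<integral>z. jump1 \<beta> V Y p2 z \<partial>(dens q)) \<le> F2"
    using subV XY unfolding quad_sub_def by blast+
  have "jump1 \<beta> U X p1 z + jump1 \<beta> V Y p2 z \<le> (\<kappa> * (B\<^sup>2 + B)) * weight z" for z
  proof -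
    let ?j = "japanese (X + \<beta> z) - japanese X"
    have *: "U (X + \<beta> z) - U X + (V (Y + \<beta> z) - V Y) \<le> \<kappa> * ?j"
      using max[of "\<beta> z" "\<beta> z"] sq[of "\<beta> z" "\<beta> z"] by (simp add: algebra_simps)
    have **: "p1 \<bullet> h + p2 \<bullet> h = \<kappa> * ((X /\<^sub>R japanese X) \<bullet> h)" for h
      unfolding p1_def p2_def by (simp add: inner_simps algebra_simps)
    have w0: "0 \<le> weight z * B" "0 \<le> weight z * B\<^sup>2" using weight_nonneg[of z] B_nonneg by simp_all
    have "?j - (if norm z \<le> 1 then (X /\<^sub>R japanese X) \<bullet> \<beta> z else 0) \<le> (B\<^sup>2 + B) * weight z"
    proof (cases "norm z \<le> 1")
      case True
      then show ?thesis using japanese_quadratic[of X "\<beta> z"] small_jump_le[OF True] w0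
        by (simp add: algebra_simps)
    next
      case False
      then show ?thesis using japanese_diff_le[of X "\<beta> z"] large_jump_le[of z] w0
        by (simp add: algebra_simps)
    qed
    from mult_left_mono[OF this, of \<kappa>] \<kappa> * **[of "\<beta> z"] show ?thesis
      by (auto simp: jump1_def algebra_simps)
  qed
  then have "(\<integral>z. jump1 \<beta> U X p1 z + jump1 \<beta> V Y p2 z \<partial>(dens q)) \<le> (\<integral>z. (\<kappa> * (B\<^sup>2 + B)) * weight z \<partial>(dens q))"
    using A1(1) A2(1) integrable_weight by (intro integral_mono) auto
  also have "\<dots> = \<kappa> * C" by (simp add: C_def)
  finally have "(\<integral>z. jump1 \<beta> U X p1 z \<partial>(dens q)) + (\<integral>z. jump1 \<beta> V Y p2 z \<partial>(dens q)) \<le> \<kappa> * C"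
    using A1(1) A2(1) by simp
  then have "K * (U X + V Y) \<le> F1 + F2 + \<kappa> * C"
    using A1(2) A2(2) unfolding distrib_left by linarith
  then have "U X + V Y \<le> (F1 + F2 + \<kappa> * C) / K"
    using K by (simp add: pos_le_divide_eq mult.commute)
  then have "U X + V Y \<le> (F1 + F2) / K + \<kappa> * (C / K)"
    by (simp add: add_divide_distrib)
  moreover have "m + d \<le> U X + V Y"
    using level[OF lev[of n]] unfolding x_def y_def X_def Y_def by blast
  ultimately show False using \<kappa>C unfolding m_def by linarith
qed

end

section \<open>Stability and twice differentiable test functions\<close>

context levy
begin

text \<open>Raising the opening from \<open>A\<close> to \<open>A + 1\<close> makes the contact at
  \<open>x\<close> strict: \<open>U n\<close> minus the new paraboloid attains its maximum within
  distance sqrt (2 * s n) of \<open>x\<close>. \<open>reverse_fatou\<close> passes to the limit in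
  the inequalities at these contact points.\<close>

lemma quad_sub_uniform_limit:
  fixes U :: "nat \<Rightarrow> real^'n \<Rightarrow> real"
  assumes \<Omega>: "open \<Omega>" and U: "\<And>n. continuous_on UNIV (U n)" "\<And>n x. \<bar>U n x\<bar> \<le> R"
    and u: "continuous_on UNIV u" and close: "\<And>n x. \<bar>U n x - u x\<bar> \<le> s n" and s: "s \<longlonglongrightarrow> 0"
    and sub: "\<And>n. quad_sub q \<beta> \<Omega> (\<lambda>_. K) (\<lambda>_. F n) (U n)" and F: "F \<longlonglongrightarrow> F0"
  shows "quad_sub q \<beta> \<Omega> (\<lambda>_. K) (\<lambda>_. F0) u"
proof (rule quad_subI)
  fix x p A assume x: "x \<in> \<Omega>" and A: "A \<ge> 0"
    and h: "\<And>h. u (x + h) \<le> u x + p \<bullet> h + A * (norm h)\<^sup>2"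
  define \<Phi> where "\<Phi> n h = U n (x + h) - p \<bullet> h - (A + 1) * (norm h)\<^sup>2" for n h
  have lev: "(norm h)\<^sup>2 \<le> 2 * s n" if "\<Phi> n 0 \<le> \<Phi> n h" for n and h :: "real^'n"
    using that close[of n x] close[of n "x + h"] h[of h] unfolding \<Phi>_def by (simp add: algebra_simps)
  have "\<exists>w. \<forall>w'. \<Phi> n w' \<le> \<Phi> n w" for n
  proof -
    have "continuous_on UNIV (\<lambda>h. U n (x + h))"
      by (rule continuous_on_compose2[OF U(1)]) (auto intro!: continuous_intros)
    then have "continuous_on UNIV (\<Phi> n)" unfolding \<Phi>_def by (intro continuous_intros)
    moreover have "bounded {w. \<Phi> n 0 \<le> \<Phi> n w}"
    proof (rule boundedI)
      fix w assume "w \<in> {w. \<Phi> n 0 \<le> \<Phi> n w}"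
      then have "(norm w)\<^sup>2 \<le> 2 * s n" using lev by blast
      then show "norm w \<le> sqrt (2 * s n)" by (rule real_le_rsqrt)
    qed
    ultimately show ?thesis by (rule continuous_coercive_attains_sup) blast
  qed
  then obtain w where w: "\<And>n w'. \<Phi> n w' \<le> \<Phi> n (w n)" by metis
  have "(\<lambda>n. norm (w n)) \<longlonglongrightarrow> 0"
  proof (rule tendsto_sandwich[OF _ _ tendsto_const])
    show "eventually (\<lambda>n. norm (w n) \<le> sqrt (2 * s n)) sequentially"
      using lev[OF w] by (intro always_eventually allI real_le_rsqrt)
    show "(\<lambda>n. sqrt (2 * s n)) \<longlonglongrightarrow> 0"
      using tendsto_real_sqrt[OF tendsto_mult_right_zero[OF s, of 2]] by simp
  qed auto
  then have w0: "w \<longlonglongrightarrow> 0" using tendsto_norm_zero_iff by blast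
  then have xw: "(\<lambda>n. x + w n) \<longlonglongrightarrow> x" using tendsto_add[OF tendsto_const w0, of x] by simp
  then have "eventually (\<lambda>n. x + w n \<in> \<Omega>) sequentially"
    using topological_tendstoD[OF xw \<Omega> x] by simp
  then obtain N where N: "\<And>n. n \<ge> N \<Longrightarrow> x + w n \<in> \<Omega>" by (auto simp: eventually_sequentially)
  \<comment> \<open>Slope of the paraboloid of opening \<open>A + 1\<close> at the moved contact
    point.\<close>
  define P where "P n = p + (2 * (A + 1)) *\<^sub>R w n" for n
  have P: "P \<longlonglongrightarrow> p"
    using tendsto_add[OF tendsto_const[of p] tendsto_scaleR[OF tendsto_const[of "2 * (A + 1)"] w0]]
    unfolding P_def by simp
  have touch: "U n (x + w n + k) \<le> U n (x + w n) + P n \<bullet> k + (A + 1) * (norm k)\<^sup>2" for n k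
  proof -
    have "(norm (w n + k))\<^sup>2 = (norm (w n))\<^sup>2 + 2 * (w n \<bullet> k) + (norm k)\<^sup>2"
      by (simp add: power2_norm_eq_inner inner_simps inner_commute)
    then show ?thesis using w[of n "w n + k"] unfolding \<Phi>_def P_def
      by (simp add: inner_simps algebra_simps)
  qed
  let ?J = "\<lambda>n. jump1 \<beta> (U n) (x + w n) (P n)"
  have *: "integrable (dens q) (?J n) \<and> K * U n (x + w n) - (\<integral>z. ?J n z \<partial>(dens q)) \<le> F n"
    if "n \<ge> N" for n
    using sub[of n] N[OF that] touch[of n] unfolding quad_sub_def by blast
  have Uy: "(\<lambda>n. U n (y n)) \<longlonglongrightarrow> u y0" if "y \<longlonglongrightarrow> y0" for y y0
  proof -
    have "(\<lambda>n. U n (y n) - u (y n)) \<longlonglongrightarrow> 0"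
      by (rule Lim_null_comparison[OF _ s]) (simp add: close)
    from tendsto_add[OF this continuous_on_tendsto_compose[OF u that]] show ?thesis by simp
  qed
  have "integrable (dens q) (jump1 \<beta> u x p) \<and> K * u x - F0 \<le> (\<integral>z. jump1 \<beta> u x p z \<partial>(dens q))"
  \<comment> \<open>The shift by \<open>N\<close> is there because the contact points are known to
    lie in \<open>\<Omega>\<close> only from that index on.\<close>
  proof (rule reverse_fatou[where f = "\<lambda>n. ?J (n + N)" and c = "\<lambda>n. K * U (n + N) (x + w (n + N)) - F (n + N)"
        and G = "\<lambda>z. ((A + 1) * B\<^sup>2 + 2 * R) * weight z"])
    show "integrable (dens q) (\<lambda>z. ((A + 1) * B\<^sup>2 + 2 * R) * weight z)"
      using integrable_weight by simp
    show "integrable (dens q) (?J (n + N))" for n using *[of "n + N"] by simp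
    show "?J (n + N) z \<le> ((A + 1) * B\<^sup>2 + 2 * R) * weight z" for n z
      by (rule jump1_le_weight) (use touch A U(2) in auto)
    show "K * U (n + N) (x + w (n + N)) - F (n + N) \<le> (\<integral>z. ?J (n + N) z \<partial>(dens q))" for n
      using *[of "n + N"] by simp
    show "(\<lambda>n. ?J (n + N) z) \<longlonglongrightarrow> jump1 \<beta> u x p z" for z
      unfolding jump1_def
      by (rule LIMSEQ_ignore_initial_segment[of "\<lambda>n. ?J n z" for z, unfolded jump1_def])
         (auto intro!: tendsto_intros Uy xw P)
    show "(\<lambda>n. K * U (n + N) (x + w (n + N)) - F (n + N)) \<longlonglongrightarrow> K * u x - F0"
      by (rule LIMSEQ_ignore_initial_segment[of "\<lambda>n. K * U n (x + w n) - F n"])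
         (intro tendsto_intros Uy xw F)
  qed
  then show "integrable (dens q) (jump1 \<beta> u x p) \<and> K * u x - (\<integral>z. jump1 \<beta> u x p z \<partial>(dens q)) \<le> F0"
    by auto
qed

end

section \<open>Calculus of twice differentiable functions\<close>

lemma C2_I:
  assumes "\<And>x. GDERIV \<psi> x :> g x" "\<And>x. (g has_derivative (\<lambda>h. H x *v h)) (at x)" "continuous_on UNIV H"
  shows "C2 \<psi>"
  using assms unfolding C2_def by blast

lemma C2_GDERIV: "C2 \<psi> \<Longrightarrow> GDERIV \<psi> x :> grad \<psi> x"
  unfolding C2_def using grad_eqI by metis

lemma has_derivative_imp_continuous_on_UNIV:
  "(\<And>x. (f has_derivative D x) (at x)) \<Longrightarrow> continuous_on UNIV f"
  by (rule continuous_at_imp_continuous_on) (auto intro: has_derivative_continuous)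

lemma C2_continuous: "C2 \<psi> \<Longrightarrow> continuous_on UNIV \<psi>"
  using C2_GDERIV[of \<psi>] unfolding gderiv_def
  by (rule has_derivative_imp_continuous_on_UNIV)

text \<open>The rank-one matrix of the mixed terms in the Hessians of products and
  compositions.\<close>

definition outer_prod :: "real^'n \<Rightarrow> real^'n \<Rightarrow> real^'n^'n" where
  "outer_prod a b = (\<chi> i j. a $ i * b $ j)"

lemma outer_prod_mult: "outer_prod a b *v h = (b \<bullet> h) *\<^sub>R a"
  by (simp add: outer_prod_def matrix_vector_mult_def vec_eq_iff inner_vec_def sum_distrib_left
      mult_ac)

lemma continuous_on_outer_prod:
  "continuous_on S f \<Longrightarrow> continuous_on S g \<Longrightarrow> continuous_on S (\<lambda>x. outer_prod (f x) (g x))"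
  unfolding outer_prod_def by (intro continuous_on_vec_lambda continuous_intros)

lemma C2_const: "C2 (\<lambda>_. c)"
  by (rule C2_I[of _ "\<lambda>_. 0" "\<lambda>_. 0"]) (auto simp: GDERIV_const)

lemma C2_bounded_linear:
  assumes "bounded_linear (f :: real^'n \<Rightarrow> real)"
  shows "C2 f"
proof -
  have "f = (\<lambda>x. x \<bullet> adjoint f 1)"
    using adjoint_works[OF bounded_linear.linear[OF assms], of _ 1] by auto
  then obtain v where "f = (\<lambda>x. x \<bullet> v)" ..
  then show ?thesis
    by (intro C2_I[of _ "\<lambda>_. v" "\<lambda>_. 0"]) (auto simp: gderiv_def intro!: derivative_eq_intros)
qed

lemma C2_add:
  assumes "C2 f" "C2 g"
  shows "C2 (\<lambda>x. f x + g x)"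
proof -
  obtain f' f'' where f: "\<And>x. GDERIV f x :> f' x" "\<And>x. (f' has_derivative (\<lambda>h. f'' x *v h)) (at x)"
      "continuous_on UNIV f''" using assms(1) unfolding C2_def by blast
  obtain g' g'' where g: "\<And>x. GDERIV g x :> g' x" "\<And>x. (g' has_derivative (\<lambda>h. g'' x *v h)) (at x)"
      "continuous_on UNIV g''" using assms(2) unfolding C2_def by blast
  show ?thesis
  proof (rule C2_I)
    show "GDERIV (\<lambda>x. f x + g x) x :> f' x + g' x" for x by (rule GDERIV_add[OF f(1) g(1)])
    show "((\<lambda>x. f' x + g' x) has_derivative (\<lambda>h. (f'' x + g'' x) *v h)) (at x)" for x
      using has_derivative_add[OF f(2) g(2)] by (simp add: matrix_vector_mult_add_rdistrib)
    show "continuous_on UNIV (\<lambda>x. f'' x + g'' x)" using f(3) g(3) by (intro continuous_intros)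
  qed
qed

lemma C2_mult:
  fixes f g :: "real^'n \<Rightarrow> real"
  assumes "C2 f" "C2 g"
  shows "C2 (\<lambda>x. f x * g x)"
proof -
  obtain f' f'' where f: "\<And>x. GDERIV f x :> f' x" "\<And>x. (f' has_derivative (\<lambda>h. f'' x *v h)) (at x)"
      "continuous_on UNIV f''" using assms(1) unfolding C2_def by blast
  obtain g' g'' where g: "\<And>x. GDERIV g x :> g' x" "\<And>x. (g' has_derivative (\<lambda>h. g'' x *v h)) (at x)"
      "continuous_on UNIV g''" using assms(2) unfolding C2_def by blast
  have cont: "continuous_on UNIV f'" "continuous_on UNIV g'"
    by (rule has_derivative_imp_continuous_on_UNIV, rule f(2) g(2))+
  let ?H = "\<lambda>x. f x *\<^sub>R g'' x + g x *\<^sub>R f'' x + outer_prod (f' x) (g' x) + outer_prod (g' x) (f' x)"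
  show ?thesis
  proof (rule C2_I)
    show "GDERIV (\<lambda>x. f x * g x) x :> f x *\<^sub>R g' x + g x *\<^sub>R f' x" for x
      by (rule GDERIV_mult[OF f(1) g(1)])
    show "((\<lambda>x. f x *\<^sub>R g' x + g x *\<^sub>R f' x) has_derivative (\<lambda>h. ?H x *v h)) (at x)" for x
    proof -
      have "((\<lambda>x. f x *\<^sub>R g' x + g x *\<^sub>R f' x) has_derivative
        (\<lambda>h. (f x *\<^sub>R (g'' x *v h) + (h \<bullet> f' x) *\<^sub>R g' x) + (g x *\<^sub>R (f'' x *v h) + (h \<bullet> g' x) *\<^sub>R f' x))) (at x)"
        using f g by (intro has_derivative_add has_derivative_scaleR) (auto simp: gderiv_def)
      then show ?thesis
        by (simp add: matrix_vector_mult_add_rdistrib outer_prod_mult scaleR_matrix_vector_assoc[symmetric]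
            inner_commute add_ac)
    qed
    show "continuous_on UNIV ?H"
      using f(3) g(3) cont C2_continuous[OF assms(1)] C2_continuous[OF assms(2)]
      by (intro continuous_intros continuous_on_outer_prod)
  qed
qed

lemma C2_compose_real:
  fixes f :: "real^'n \<Rightarrow> real"
  assumes "C2 f" and \<phi>: "\<And>t. (\<phi> has_field_derivative \<phi>' t) (at t)"
    "\<And>t. (\<phi>' has_field_derivative \<phi>'' t) (at t)" "continuous_on UNIV \<phi>''"
  shows "C2 (\<lambda>x. \<phi> (f x))"
proof -
  obtain f' f'' where f: "\<And>x. GDERIV f x :> f' x" "\<And>x. (f' has_derivative (\<lambda>h. f'' x *v h)) (at x)"
      "continuous_on UNIV f''" using assms(1) unfolding C2_def by blast
  have cont: "continuous_on UNIV f'"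
    using f(2) by (rule has_derivative_imp_continuous_on_UNIV)
  have cf: "continuous_on UNIV f" by (rule C2_continuous[OF assms(1)])
  have c1: "continuous_on UNIV \<phi>'"
    by (rule continuous_at_imp_continuous_on) (auto intro: DERIV_isCont \<phi>(2))
  let ?H = "\<lambda>x. \<phi>' (f x) *\<^sub>R f'' x + \<phi>'' (f x) *\<^sub>R outer_prod (f' x) (f' x)"
  show ?thesis
  proof (rule C2_I)
    show g: "GDERIV (\<lambda>x. \<phi> (f x)) x :> \<phi>' (f x) *\<^sub>R f' x" for x
      by (rule GDERIV_DERIV_compose[OF f(1) \<phi>(1)])
    have "GDERIV (\<lambda>x. \<phi>' (f x)) x :> \<phi>'' (f x) *\<^sub>R f' x" for x
      by (rule GDERIV_DERIV_compose[OF f(1) \<phi>(2)])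
    then have "((\<lambda>x. \<phi>' (f x) *\<^sub>R f' x) has_derivative
        (\<lambda>h. \<phi>' (f x) *\<^sub>R (f'' x *v h) + (h \<bullet> (\<phi>'' (f x) *\<^sub>R f' x)) *\<^sub>R f' x)) (at x)" for x
      using f by (intro has_derivative_scaleR) (auto simp: gderiv_def)
    then show "((\<lambda>x. \<phi>' (f x) *\<^sub>R f' x) has_derivative (\<lambda>h. ?H x *v h)) (at x)" for x
      by (simp add: matrix_vector_mult_add_rdistrib outer_prod_mult scaleR_matrix_vector_assoc[symmetric] inner_commute)
    show "continuous_on UNIV ?H"
      by (intro continuous_intros continuous_on_outer_prod f(3) cont
          continuous_on_compose2[OF c1 cf] continuous_on_compose2[OF \<phi>(3) cf]) auto
  qed
qed

text \<open>Makes the polynomials supplied by the Stone-Weierstrass theorem admissible as parts of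
  test functions.\<close>

lemma C2_real_polynomial_function:
  "real_polynomial_function f \<Longrightarrow> C2 (f :: real^'n \<Rightarrow> real)"
  by (induction rule: real_polynomial_function.induct)
     (auto intro: C2_const C2_bounded_linear C2_add C2_mult)

lemma C2_translate:
  assumes "C2 f"
  shows "C2 (\<lambda>y. f (y - x))"
proof -
  obtain f' f'' where f: "\<And>x. GDERIV f x :> f' x" "\<And>x. (f' has_derivative (\<lambda>h. f'' x *v h)) (at x)"
      "continuous_on UNIV f''" using assms(1) unfolding C2_def by blast
  have s: "((\<lambda>y. y - x) has_derivative (\<lambda>h. h)) (at y)" for y
    by (auto intro!: derivative_eq_intros)
  show ?thesis
  proof (rule C2_I)
    show "GDERIV (\<lambda>y. f (y - x)) y :> f' (y - x)" for y
      using has_derivative_compose[OF s f(1)[unfolded gderiv_def]] unfolding gderiv_def .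
    show "((\<lambda>y. f' (y - x)) has_derivative (\<lambda>h. f'' (y - x) *v h)) (at y)" for y
      using has_derivative_compose[OF s f(2)] .
    show "continuous_on UNIV (\<lambda>y. f'' (y - x))"
      by (rule continuous_on_compose2[OF f(3)]) (auto intro!: continuous_intros)
  qed
qed

text \<open>Used for the exponents 3 and 2: the positive part cubed is twice continuously
  differentiable, and the cutoff is built from it. At 0 the difference quotient is at most
  \<open>\<bar>h\<bar> ^ Suc n\<close>.\<close>

lemma DERIV_max_0_power:
  "((\<lambda>t. max 0 t ^ Suc (Suc n)) has_field_derivative real (Suc (Suc n)) * max 0 t ^ Suc n) (at (t::real))"
proof -
  consider "t > 0" | "t < 0" | "t = 0" by linarith
  then show ?thesis
  proof cases
    case 1
    have "((\<lambda>t. t ^ Suc (Suc n)) has_field_derivative real (Suc (Suc n)) * t ^ Suc n) (at t)"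
      by (auto intro!: derivative_eq_intros simp del: power_Suc)
    then have "((\<lambda>t. max 0 t ^ Suc (Suc n)) has_field_derivative real (Suc (Suc n)) * t ^ Suc n) (at t)"
      by (rule has_field_derivative_transform_within_open[of _ _ _ "{0<..}"]) (use 1 in auto)
    then show ?thesis using 1 by (simp add: max_def)
  next
    case 2
    have "((\<lambda>_. 0) has_field_derivative 0) (at t)" by simp
    then have "((\<lambda>t. max 0 t ^ Suc (Suc n)) has_field_derivative 0) (at t)"
      by (rule has_field_derivative_transform_within_open[of _ _ _ "{..<0}"]) (use 2 in auto)
    then show ?thesis using 2 by (simp add: max_def)
  next
    case 3
    have "(\<lambda>h. max 0 h ^ Suc (Suc n) / h) \<midarrow>0\<rightarrow> (0::real)"
    proof (rule Lim_null_comparison)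
      have "norm (max 0 h ^ Suc (Suc n) / h) \<le> \<bar>h\<bar> ^ Suc n" for h :: real
      proof (cases "h > 0")
        case True
        then show ?thesis by simp
      next
        case False
        then have m: "max 0 h = 0" by simp
        show ?thesis unfolding m using zero_le_power_abs[of h "Suc n"] by (simp del: power_Suc)
      qed
      then show "\<forall>\<^sub>F h in at 0. norm (max 0 h ^ Suc (Suc n) / h) \<le> \<bar>h\<bar> ^ Suc n"
        by (intro always_eventually allI)
      have "(\<lambda>h::real. \<bar>h\<bar> ^ Suc n) \<midarrow>0\<rightarrow> \<bar>0\<bar> ^ Suc n" by (intro tendsto_intros)
      then show "(\<lambda>h::real. \<bar>h\<bar> ^ Suc n) \<midarrow>0\<rightarrow> 0" by simp
    qed
    then show ?thesis using 3 by (simp add: DERIV_def)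
  qed
qed

text \<open>The mean value inequality twice: a bound of the Hessian on the ball controls the change
  of the gradient from its centre; then \<open>\<psi>\<close> minus its linear part is estimated on
  the ball of radius \<open>norm h\<close>, where the derivative is at most
  \<open>C * norm h\<close>.\<close>

lemma C2_taylor:
  fixes \<psi> :: "real^'n \<Rightarrow> real"
  assumes "C2 \<psi>"
  obtains C where "C \<ge> 0" "\<And>h. norm h \<le> \<rho> \<Longrightarrow> \<bar>\<psi> (x + h) - \<psi> x - grad \<psi> x \<bullet> h\<bar> \<le> C * (norm h)\<^sup>2"
proof -
  obtain g H where g: "\<And>x. GDERIV \<psi> x :> g x" "\<And>x. (g has_derivative (\<lambda>h. H x *v h)) (at x)"
      "continuous_on UNIV H" using assms unfolding C2_def by blast
  have "compact (H ` cball x \<rho>)"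
    by (rule compact_continuous_image[OF continuous_on_subset[OF g(3) subset_UNIV] compact_cball])
  then obtain b where b: "\<And>y. y \<in> cball x \<rho> \<Longrightarrow> norm (H y) \<le> b"
    using compact_imp_bounded[of "H ` cball x \<rho>"] unfolding bounded_iff by blast
  define C where "C = real CARD('n) * real CARD('n) * max b 0"
  have C: "C \<ge> 0" by (simp add: C_def)
  have on: "onorm (\<lambda>h. H y *v h) \<le> C" if "y \<in> cball x \<rho>" for y
    unfolding C_def
  proof (rule onorm_le_matrix_component)
    fix i j
    have "\<bar>H y $ i $ j\<bar> \<le> norm (H y $ i)" by (rule component_le_norm_cart)
    also have "\<dots> \<le> norm (H y)" by (rule Finite_Cartesian_Product.norm_nth_le)
    also have "\<dots> \<le> max b 0" using b[OF that] by simp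
    finally show "\<bar>H y $ i $ j\<bar> \<le> max b 0" .
  qed
  have lip: "norm (g y - g x) \<le> C * norm (y - x)" if "y \<in> cball x \<rho>" for y
  proof (rule differentiable_bound[of "cball x \<rho>" g "\<lambda>y h. H y *v h"])
    show "(g has_derivative (\<lambda>h. H y *v h)) (at y within cball x \<rho>)" for y
      using g(2) by (rule has_derivative_at_withinI)
    show "x \<in> cball x \<rho>" using that by (auto intro: order_trans[OF zero_le_dist])
  qed (use that on in auto)
  have "\<bar>\<psi> (x + h) - \<psi> x - g x \<bullet> h\<bar> \<le> C * (norm h)\<^sup>2" if h: "norm h \<le> \<rho>" for h
  proof -
    have "norm ((\<psi> (x + h) - g x \<bullet> (x + h)) - (\<psi> x - g x \<bullet> x)) \<le> (C * norm h) * norm ((x + h) - x)"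
    proof (rule differentiable_bound[of "cball x (norm h)" "\<lambda>y. \<psi> y - g x \<bullet> y" "\<lambda>y k. k \<bullet> (g y - g x)"])
      fix y assume y: "y \<in> cball x (norm h)"
      have "((\<lambda>y. \<psi> y - g x \<bullet> y) has_derivative (\<lambda>k. k \<bullet> g y - g x \<bullet> k)) (at y)"
        by (intro has_derivative_diff g(1)[unfolded gderiv_def]
            bounded_linear_imp_has_derivative bounded_linear_inner_right)
      moreover have "(\<lambda>k. k \<bullet> g y - g x \<bullet> k) = (\<lambda>k. k \<bullet> (g y - g x))"
        by (rule ext) (simp add: inner_diff_right inner_commute[of "g x"])
      ultimately show "((\<lambda>y. \<psi> y - g x \<bullet> y) has_derivative (\<lambda>k. k \<bullet> (g y - g x))) (at y within cball x (norm h))"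
        using has_derivative_at_withinI by fastforce
      have "norm (k \<bullet> (g y - g x)) \<le> norm (g y - g x) * norm k" for k
        using Cauchy_Schwarz_ineq2[of k "g y - g x"] by (simp add: mult.commute)
      then have "onorm (\<lambda>k. k \<bullet> (g y - g x)) \<le> norm (g y - g x)" by (rule onorm_le)
      also have "\<dots> \<le> C * norm (y - x)" using y h by (intro lip) auto
      also have "\<dots> \<le> C * norm h" using y C by (intro mult_left_mono) (auto simp: dist_norm norm_minus_commute)
      finally show "onorm (\<lambda>k. k \<bullet> (g y - g x)) \<le> C * norm h" .
    qed (auto simp: dist_norm)
    then show ?thesis by (simp add: inner_simps power2_eq_square algebra_simps)
  qed
  moreover have "g x = grad \<psi> x" using grad_eqI[OF g(1)] by simp
  ultimately show ?thesis using that[of C] C by simp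
qed

text \<open>Meant for \<open>t = (norm h)^2 / N^2\<close>. The last bound is Bernoulli's inequality;
  it makes the error of the cutoff quadratic in \<open>h\<close>.\<close>

lemma cutoff_bounds:
  fixes t :: real
  assumes "t \<ge> 0"
  shows "0 \<le> max 0 (1 - t) ^ 3" "max 0 (1 - t) ^ 3 \<le> 1" "1 - max 0 (1 - t) ^ 3 \<le> 3 * t"
proof -
  show "0 \<le> max 0 (1 - t) ^ 3" by simp
  show "max 0 (1 - t) ^ 3 \<le> 1" using assms by (intro power_le_one) auto
  show "1 - max 0 (1 - t) ^ 3 \<le> 3 * t"
  proof (cases "t \<le> 1")
    case True
    have "1 - 3 * t \<le> (1 - t) ^ 3"
      using Bernoulli_inequality[of "- t" 3] True by simp
    then show ?thesis using True by (simp add: max_def)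
  next
    case False
    have "0 \<le> max 0 (1 - t) ^ 3" by simp
    then show ?thesis using False by linarith
  qed
qed

text \<open>Near \<open>x\<close> the approximant is a polynomial above \<open>u\<close>; a cutoff glues it to the constant \<open>R\<close>.
  Since the quotient of \<open>u (x + h) - u x - p \<bullet> h\<close> by \<open>(norm h)\<^sup>2\<close> may tend to minus infinity at \<open>0\<close>,
  it is first regularised from above.\<close>

lemma C2_upper_approximation:
  fixes u :: "real^'n \<Rightarrow> real"
  assumes u: "continuous_on UNIV u" "\<And>y. \<bar>u y\<bar> \<le> R"
    and touch: "\<And>h. u (x + h) \<le> u x + p \<bullet> h + A * (norm h)\<^sup>2" and A: "A \<ge> 0"
    and N: "N \<ge> 1" and b: "b \<ge> 0"
  obtains \<psi> where "C2 \<psi>" "\<psi> x = u x" "grad \<psi> x = p" "\<And>y. u y \<le> \<psi> y"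
    "\<And>y. \<bar>\<psi> y\<bar> \<le> A + norm p + 5 * R + 2"
    "\<And>h. norm h \<le> b \<Longrightarrow> \<psi> (x + h) \<le> u x + p \<bullet> h + (A + 2 + 3 * (2 * R + norm p * b)) * (norm h)\<^sup>2"
    "\<And>h. norm h \<le> N \<Longrightarrow> \<psi> (x + h) \<le> u (x + h)
        + ((A * (norm h)\<^sup>2 + p \<bullet> h + u x - u (x + h)) / (norm h)\<^sup>2 + 2 * (norm h)\<^sup>2 + 6 * R * (norm h)\<^sup>2) / N"
proof -
  have R: "R \<ge> 0" using u(2)[of x] by linarith
  define D where "D h = A * (norm h)\<^sup>2 + p \<bullet> h + u x - u (x + h)" for h
  have D: "D h \<ge> 0" for h using touch[of h] by (simp add: D_def)
  \<comment> \<open>Dividing the gap \<open>D\<close> by \<open>(norm h)^2 + 1 / N\<close> in place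
    of \<open>(norm h)^2\<close> gives a continuous function above the true quotient and below
    \<open>A\<close>.\<close>
  define w where "w h = A - D h / ((norm h)\<^sup>2 + 1 / N)" for h
  have den: "(norm h)\<^sup>2 + 1 / N > 0" for h :: "real^'n"
    using N by (intro add_nonneg_pos) auto
  have wA: "w h \<le> A" for h unfolding w_def using D[of h] den[of h] by (simp add: less_imp_le)
  have "continuous_on UNIV (\<lambda>h. u (x + h))"
    by (rule continuous_on_compose2[OF u(1)]) (auto intro!: continuous_intros)
  then have "continuous_on UNIV D" unfolding D_def by (intro continuous_intros)
  then have "continuous_on UNIV w" unfolding w_def
    using den by (intro continuous_intros) (auto simp: less_imp_neq[THEN not_sym])
  \<comment> \<open>The lift equals the tolerance of the approximation, so the polynomial
    \<open>W\<close> lies above \<open>w\<close>, by at most \<open>2 / N ^ 3\<close>; multiplied by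
    \<open>(norm h)^2 \<le> N^2\<close> this stays small.\<close>
  then have "continuous_on (cball 0 N) (\<lambda>h. w h + 1 / N ^ 3)"
    by (intro continuous_intros) (auto intro: continuous_on_subset)
  then obtain W where W: "real_polynomial_function W"
      "\<And>h. h \<in> cball 0 N \<Longrightarrow> \<bar>(w h + 1 / N ^ 3) - W h\<bar> < 1 / N ^ 3"
    using N by (elim Stone_Weierstrass_real_polynomial_function[OF compact_cball, of _ _ _ "1 / N ^ 3"]) auto
  have W2: "w h \<le> W h" "W h \<le> w h + 2 / N ^ 3" if "norm h \<le> N" for h
    using W(2)[of h] that by (auto simp: abs_less_iff)
  \<comment> \<open>The zero summands and the factors \<open>- 1\<close> make every piece an
    instance of \<open>C2_quadratic\<close> or of the sum and product rules. \<open>br\<close> is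
    the polynomial above \<open>u\<close> on the ball, and \<open>k\<close> interpolates between it
    and \<open>R\<close>.\<close>
  define k where "k y = max 0 (1 + 0 \<bullet> (y - x) + (- (1 / N\<^sup>2)) * (norm (y - x))\<^sup>2) ^ 3" for y
  define br where "br y = (u x + p \<bullet> (y - x) + 0 * (norm (y - x))\<^sup>2)
     + (0 + 0 \<bullet> (y - x) + 1 * (norm (y - x))\<^sup>2) * W (y - x)" for y
  define \<psi> where "\<psi> y = k y * br y + (1 + (- 1) * k y) * R" for y
  have d1: "((\<lambda>t. max 0 t ^ 3) has_field_derivative 3 * max 0 t ^ 2) (at (t::real))" for t
    using DERIV_max_0_power[of 1 t] by (simp add: numeral_3_eq_3 numeral_2_eq_2)
  have d2: "((\<lambda>t. 3 * max 0 t ^ 2) has_field_derivative 3 * (2 * max 0 t)) (at (t::real))" for t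
    using DERIV_cmult[OF DERIV_max_0_power[of 0 t], of 3] by (simp add: numeral_2_eq_2)
  have C2k: "C2 k" unfolding k_def
    by (rule C2_compose_real[OF C2_quadratic d1 d2]) (intro continuous_intros)
  have C2W: "C2 (\<lambda>y. W (y - x))" using C2_translate[OF C2_real_polynomial_function[OF W(1)]] .
  have C2br: "C2 br" unfolding br_def by (intro C2_add C2_mult C2_quadratic C2W)
  have C2\<psi>: "C2 \<psi>" unfolding \<psi>_def by (intro C2_add C2_mult C2_const C2k C2br)
  have kx: "k x = 1" and brx: "br x = u x" by (simp_all add: k_def br_def)
  have gk: "GDERIV k x :> 0"
    using GDERIV_DERIV_compose[OF GDERIV_quadratic[of 1 0 x "- (1 / N\<^sup>2)" x] d1] unfolding k_def by simp
  have "GDERIV br x :> (p + (2 * 0) *\<^sub>R (x - x)) + ((0 + 0 \<bullet> (x - x) + 1 * (norm (x - x))\<^sup>2) *\<^sub>R grad (\<lambda>y. W (y - x)) x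
       + W (x - x) *\<^sub>R (0 + (2 * 1) *\<^sub>R (x - x)))"
    unfolding br_def
    by (intro GDERIV_add GDERIV_mult GDERIV_quadratic C2_GDERIV C2W)
  then have gbr: "GDERIV br x :> p" by simp
  have "GDERIV \<psi> x :> (k x *\<^sub>R p + br x *\<^sub>R 0) + ((1 + (- 1) * k x) *\<^sub>R 0 + R *\<^sub>R (0 + ((- 1) *\<^sub>R 0 + k x *\<^sub>R 0)))"
    unfolding \<psi>_def by (intro GDERIV_add GDERIV_mult GDERIV_const gk gbr)
  then have g\<psi>: "grad \<psi> x = p" using kx by (intro grad_eqI) simp
  have k_eq: "k (x + h) = max 0 (1 - (norm h)\<^sup>2 / N\<^sup>2) ^ 3" for h by (simp add: k_def)
  have kb: "0 \<le> k (x + h)" "k (x + h) \<le> 1" "1 - k (x + h) \<le> 3 * (norm h)\<^sup>2 / N\<^sup>2" for h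
    using cutoff_bounds[of "(norm h)\<^sup>2 / N\<^sup>2"] unfolding k_eq by simp_all
  have k0: "k (x + h) = 0" if "\<not> norm h \<le> N" for h
  proof -
    have "N\<^sup>2 \<le> (norm h)\<^sup>2" using that N by (intro power_mono) auto
    then have "1 - (norm h)\<^sup>2 / N\<^sup>2 \<le> 0" using N by simp
    then show ?thesis unfolding k_eq by simp
  qed
  define E where "E h = br (x + h) - u (x + h)" for h
  \<comment> \<open>The first term is the price of the regularised denominator, which is
    \<open>N * (norm h)^2 + 1\<close> divided by \<open>N\<close>; the second is the price of the
    polynomial.\<close>
  have E_eq: "E h = D h / (N * (norm h)\<^sup>2 + 1) + (norm h)\<^sup>2 * (W h - w h)" for h
  proof -
    have pos: "N * (norm h)\<^sup>2 + 1 > 0" using N by (intro add_nonneg_pos) auto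
    have "(norm h)\<^sup>2 + 1 / N = (N * (norm h)\<^sup>2 + 1) / N" using N by (simp add: field_simps)
    then have "w h = A - D h * N / (N * (norm h)\<^sup>2 + 1)" unfolding w_def by simp
    moreover have "(norm h)\<^sup>2 * (D h * N / (N * (norm h)\<^sup>2 + 1)) = D h - D h / (N * (norm h)\<^sup>2 + 1)"
      using pos by (simp add: field_simps)
    ultimately have "(norm h)\<^sup>2 * w h = A * (norm h)\<^sup>2 - (D h - D h / (N * (norm h)\<^sup>2 + 1))"
      by (simp add: right_diff_distrib mult.commute)
    then show ?thesis unfolding E_def br_def D_def by (simp add: right_diff_distrib)
  qed
  have \<psi>_eq: "\<psi> (x + h) = u (x + h) + k (x + h) * E h + (1 - k (x + h)) * (R - u (x + h))" for h
    unfolding \<psi>_def E_def by (simp add: algebra_simps)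
  have E0: "0 \<le> E h" "E h \<le> D h / (N * (norm h)\<^sup>2 + 1) + 2 * (norm h)\<^sup>2 / N ^ 3" if "norm h \<le> N" for h
  proof -
    have pos: "N * (norm h)\<^sup>2 + 1 > 0" using N by (intro add_nonneg_pos) auto
    show "0 \<le> E h" unfolding E_eq using W2(1)[OF that] D[of h] pos by simp
    show "E h \<le> D h / (N * (norm h)\<^sup>2 + 1) + 2 * (norm h)\<^sup>2 / N ^ 3"
      unfolding E_eq using mult_left_mono[of "W h - w h" "2 / N ^ 3" "(norm h)\<^sup>2"] W2(2)[OF that]
      by (simp add: mult.commute)
  qed
  have kE: "0 \<le> k (x + h) * E h" for h
    using E0[of h] kb[of h] k0[of h] by (cases "norm h \<le> N") auto
  have Ru: "0 \<le> R - u y" "R - u y \<le> 2 * R" for y using u(2)[of y] by linarith+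
  have u_le: "u (x + h) \<le> \<psi> (x + h)" for h
    unfolding \<psi>_eq using kE[of h] kb[of h] Ru[of "x + h"] by simp
  have N3: "N ^ 3 \<ge> N" "N\<^sup>2 \<ge> N" "N ^ 3 \<ge> N\<^sup>2" "N\<^sup>2 \<ge> 1"
    using N power_increasing[of 1 3 N] power_increasing[of 1 2 N] power_increasing[of 2 3 N] by simp_all
  \<comment> \<open>Uniform in \<open>N\<close>: the gap grows at most quadratically, and
    \<open>?d\<close> dominates \<open>(norm h)^2\<close>, \<open>norm h\<close> and 1.\<close>
  have kE_le: "k (x + h) * E h \<le> A + norm p + 2 * R + 2" for h
  proof (cases "norm h \<le> N")
    case True
    let ?d = "N * (norm h)\<^sup>2 + 1"
    have d: "?d \<ge> 1" using N by simp
    have d2: "(norm h)\<^sup>2 + 1 \<le> ?d" using mult_right_mono[OF N, of "(norm h)\<^sup>2"] by simp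
    have "2 * norm h \<le> (norm h)\<^sup>2 + 1"
      using zero_le_power2[of "norm h - 1"] by (simp add: power2_diff)
    then have nh: "norm h \<le> ?d" using d2 norm_ge_zero[of h] by linarith
    have "D h \<le> A * (norm h)\<^sup>2 + norm p * norm h + 2 * R"
      using norm_cauchy_schwarz[of p h] u(2)[of x] u(2)[of "x + h"] unfolding D_def by linarith
    also have "\<dots> \<le> A * ?d + norm p * ?d + 2 * R * ?d"
      using A R d nh d2 by (intro add_mono mult_left_mono) (auto simp: mult_le_cancel_left1)
    also have "\<dots> = (A + norm p + 2 * R) * ?d" by (simp only: distrib_right)
    finally have "D h / ?d \<le> A + norm p + 2 * R" using d by (subst pos_divide_le_eq) auto
    moreover have "(norm h)\<^sup>2 \<le> N ^ 3" using power_mono[OF True, of 2] N3 by simp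
    then have "2 * (norm h)\<^sup>2 / N ^ 3 \<le> 2" using N by (simp add: divide_le_eq)
    ultimately have "E h \<le> A + norm p + 2 * R + 2" using E0(2)[OF True] by linarith
    then show ?thesis using kb(1,2)[of h] E0(1)[OF True] mult_left_le_one_le[of "E h" "k (x + h)"] by linarith
  next
    case False
    then show ?thesis using k0[OF False] A R by simp
  qed
  have kR: "(1 - k (x + h)) * (R - u (x + h)) \<le> 2 * R" for h
    using kb[of h] Ru[of "x + h"] mult_left_le_one_le[of "R - u (x + h)" "1 - k (x + h)"] by linarith
  have \<psi>b: "\<bar>\<psi> (x + h)\<bar> \<le> A + norm p + 5 * R + 2" for h
    using u_le[of h] kE_le[of h] kR[of h] u(2)[of "x + h"] A R norm_ge_zero[of p] unfolding \<psi>_eq abs_le_iff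
    by linarith
  \<comment> \<open>Also uniform in \<open>N\<close>, for use on small jumps: \<open>A + 2\<close>
    bounds the polynomial, and the cutoff adds the rest through its quadratic error.\<close>
  have up: "\<psi> (x + h) \<le> u x + p \<bullet> h + (A + 2 + 3 * (2 * R + norm p * b)) * (norm h)\<^sup>2"
    if h: "norm h \<le> b" for h
  proof -
    have "k (x + h) * ((norm h)\<^sup>2 * W h) \<le> (A + 2) * (norm h)\<^sup>2"
    proof (cases "norm h \<le> N")
      case True
      have "2 / N ^ 3 \<le> 2" using N3 N by (simp add: divide_le_eq)
      then have "W h \<le> A + 2" using W2(2)[OF True] wA[of h] by linarith
      then have "k (x + h) * ((norm h)\<^sup>2 * W h) \<le> k (x + h) * ((norm h)\<^sup>2 * (A + 2))"
        using kb(1)[of h] by (intro mult_left_mono) auto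
      also have "\<dots> \<le> (norm h)\<^sup>2 * (A + 2)"
        using kb(1,2)[of h] A by (intro mult_left_le_one_le) auto
      finally show ?thesis by (simp add: mult.commute)
    next
      case False
      then show ?thesis using k0[OF False] A by simp
    qed
    moreover have "(1 - k (x + h)) * (R - u x - p \<bullet> h) \<le> (3 * (norm h)\<^sup>2) * (2 * R + norm p * b)"
    proof -
      have "- (p \<bullet> h) \<le> norm p * b"
        using norm_cauchy_schwarz[of p "- h"] mult_left_mono[OF h, of "norm p"] by simp
      then have "R - u x - p \<bullet> h \<le> 2 * R + norm p * b" using Ru(2)[of x] by linarith
      then have "(1 - k (x + h)) * (R - u x - p \<bullet> h) \<le> (1 - k (x + h)) * (2 * R + norm p * b)"
        using kb[of h] by (intro mult_left_mono) auto
      also have "3 * (norm h)\<^sup>2 / N\<^sup>2 \<le> 3 * (norm h)\<^sup>2"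
        using N3 mult_left_mono[of 1 "N\<^sup>2" "3 * (norm h)\<^sup>2"] N by (simp add: divide_le_eq)
      then have "(1 - k (x + h)) * (2 * R + norm p * b) \<le> (3 * (norm h)\<^sup>2) * (2 * R + norm p * b)"
        using kb(3)[of h] R b by (intro mult_right_mono) auto
      finally show ?thesis .
    qed
    ultimately show ?thesis unfolding \<psi>_def br_def by (simp add: algebra_simps)
  qed
  have lim: "\<psi> (x + h) \<le> u (x + h) + (D h / (norm h)\<^sup>2 + 2 * (norm h)\<^sup>2 + 6 * R * (norm h)\<^sup>2) / N"
    if h: "norm h \<le> N" for h
  proof -
    have "D h / (N * (norm h)\<^sup>2 + 1) \<le> D h / (norm h)\<^sup>2 / N"
    proof (cases "h = 0")
      \<comment> \<open>For \<open>h = 0\<close> the quotient by \<open>(norm h)^2\<close> is 0 by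
        convention, and \<open>D 0 = 0\<close> agrees with it.\<close>
      case True then show ?thesis by (simp add: D_def)
    next
      case False
      then have "D h / (N * (norm h)\<^sup>2 + 1) \<le> D h / (N * (norm h)\<^sup>2)"
        using D[of h] N by (intro divide_left_mono mult_pos_pos) (auto intro: add_pos_nonneg add_nonneg_pos)
      then show ?thesis by (simp add: mult.commute)
    qed
    moreover have "2 * (norm h)\<^sup>2 / N ^ 3 \<le> 2 * (norm h)\<^sup>2 / N"
      using N3 N by (intro divide_left_mono) auto
    moreover have "k (x + h) * E h \<le> E h"
      using kb(1,2)[of h] E0(1)[OF h] by (intro mult_left_le_one_le) auto
    moreover have "(1 - k (x + h)) * (R - u (x + h)) \<le> 6 * R * (norm h)\<^sup>2 / N"
    proof -
      have "(1 - k (x + h)) * (R - u (x + h)) \<le> (3 * (norm h)\<^sup>2 / N) * (2 * R)"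
      proof (intro mult_mono)
        have "3 * (norm h)\<^sup>2 / N\<^sup>2 \<le> 3 * (norm h)\<^sup>2 / N"
          using N3 N by (intro divide_left_mono) auto
        then show "1 - k (x + h) \<le> 3 * (norm h)\<^sup>2 / N" using kb(3)[of h] by linarith
      qed (use Ru[of "x + h"] N in auto)
      then show ?thesis by (simp add: mult_ac)
    qed
    ultimately show ?thesis unfolding \<psi>_eq using E0(2)[OF h] by (simp add: add_divide_distrib)
  qed
  show ?thesis
  proof (rule that[OF C2\<psi> _ g\<psi>])
    show "\<psi> x = u x" using kx brx by (simp add: \<psi>_def)
    show "u y \<le> \<psi> y" for y using u_le[of "y - x"] by simp
    show "\<bar>\<psi> y\<bar> \<le> A + norm p + 5 * R + 2" for y using \<psi>b[of "y - x"] by simp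
  qed (use up lim in \<open>auto simp: D_def\<close>)
qed

section \<open>Paraboloid tests versus twice differentiable tests\<close>

context levy
begin

lemma integrable_jump1_C2:
  assumes "C2 \<psi>" "\<And>y. \<bar>\<psi> y\<bar> \<le> R"
  shows "integrable (dens q) (jump1 \<beta> \<psi> x (grad \<psi> x))"
proof -
  obtain C where C: "C \<ge> 0" "\<And>h. norm h \<le> B \<Longrightarrow> \<bar>\<psi> (x + h) - \<psi> x - grad \<psi> x \<bullet> h\<bar> \<le> C * (norm h)\<^sup>2"
    using C2_taylor[OF assms(1)] by blast
  show ?thesis
  proof (rule integrable_le_weight)
    show "jump1 \<beta> \<psi> x (grad \<psi> x) \<in> borel_measurable borel"
      by (rule jump1_measurable[OF C2_continuous[OF assms(1)]])
    fix z
    have "jump1 \<beta> \<psi> x (grad \<psi> x) z \<le> (C * B\<^sup>2 + 2 * R) * weight z"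
    proof (rule jump1_le_weight[OF _ C(1) assms(2)])
      show "\<psi> (x + h) \<le> \<psi> x + grad \<psi> x \<bullet> h + C * (norm h)\<^sup>2" if "norm h \<le> B" for h
        using C(2)[OF that] by (simp add: abs_le_iff)
    qed
    moreover have "jump1 \<beta> (\<lambda>y. - \<psi> y) x (- grad \<psi> x) z \<le> (C * B\<^sup>2 + 2 * R) * weight z"
    proof (rule jump1_le_weight[OF _ C(1)])
      show "- \<psi> (x + h) \<le> - \<psi> x + (- grad \<psi> x) \<bullet> h + C * (norm h)\<^sup>2" if "norm h \<le> B" for h
        using C(2)[OF that] by (simp add: abs_le_iff)
      show "\<bar>- \<psi> y\<bar> \<le> R" for y using assms(2)[of y] by simp
    qed
    ultimately show "\<bar>jump1 \<beta> \<psi> x (grad \<psi> x) z\<bar> \<le> (C * B\<^sup>2 + 2 * R) * weight z"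
      unfolding jump1_uminus by (simp add: abs_le_iff)
  qed
qed

text \<open>Taylor's formula gives a touching paraboloid only near \<open>x\<close>; beyond distance
  1 the bound \<open>R\<close> on \<open>u\<close> and \<open>norm h \<le> (norm h)^2\<close> extend
  it to all \<open>h\<close>. The inequality passes from \<open>u\<close> to \<open>\<psi>\<close>
  because the jumps of \<open>u\<close> lie below those of \<open>\<psi>\<close>.\<close>

lemma quad_sub_imp_C2_test:
  assumes sub: "quad_sub q \<beta> \<Omega> (\<lambda>_. K) (\<lambda>_. F) u" and u: "\<And>y. \<bar>u y\<bar> \<le> R" and x: "x \<in> \<Omega>"
    and \<psi>: "C2 \<psi>" "integrable (dens q) (jump1 \<beta> \<psi> x (grad \<psi> x))" "\<And>y. u y - \<psi> y \<le> u x - \<psi> x"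
  shows "K * u x - I1 q \<beta> \<psi> x \<le> F"
proof -
  obtain C where C: "C \<ge> 0" "\<And>h. norm h \<le> 1 \<Longrightarrow> \<bar>\<psi> (x + h) - \<psi> x - grad \<psi> x \<bullet> h\<bar> \<le> C * (norm h)\<^sup>2"
    using C2_taylor[OF \<psi>(1)] by blast
  have R: "R \<ge> 0" using u[of x] by linarith
  let ?p = "grad \<psi> x"
  have "u (x + h) \<le> u x + ?p \<bullet> h + (C + 2 * R + norm ?p) * (norm h)\<^sup>2" for h
  proof (cases "norm h \<le> 1")
    case True
    have "u (x + h) \<le> u x + ?p \<bullet> h + C * (norm h)\<^sup>2"
      using C(2)[OF True] \<psi>(3)[of "x + h"] by (simp add: abs_le_iff)
    also have "\<dots> \<le> u x + ?p \<bullet> h + (C + 2 * R + norm ?p) * (norm h)\<^sup>2"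
      using R by (simp add: mult_right_mono)
    finally show ?thesis .
  next
    case False
    have n: "norm h \<le> (norm h)\<^sup>2" "1 \<le> (norm h)\<^sup>2" using False by (auto simp: power2_eq_square mult_le_cancel_left1 less_1_mult less_imp_le)
    have "- (?p \<bullet> h) \<le> norm ?p * norm h" using norm_cauchy_schwarz[of ?p "- h"] by simp
    also have "\<dots> \<le> norm ?p * (norm h)\<^sup>2" using n by (intro mult_left_mono) auto
    finally have "u (x + h) - u x - ?p \<bullet> h \<le> 2 * R * 1 + norm ?p * (norm h)\<^sup>2"
      using u[of x] u[of "x + h"] by linarith
    also have "\<dots> \<le> 2 * R * (norm h)\<^sup>2 + norm ?p * (norm h)\<^sup>2"
      using n R by (intro add_right_mono mult_left_mono) auto
    also have "\<dots> \<le> (C + 2 * R + norm ?p) * (norm h)\<^sup>2" using C(1) by (simp add: algebra_simps)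
    finally show ?thesis by simp
  qed
  then have *: "integrable (dens q) (jump1 \<beta> u x ?p)" "K * u x - (\<integral>z. jump1 \<beta> u x ?p z \<partial>(dens q)) \<le> F"
    using sub x unfolding quad_sub_def by blast+
  have "(\<integral>z. jump1 \<beta> u x ?p z \<partial>(dens q)) \<le> I1 q \<beta> \<psi> x"
    unfolding I1_def
  proof (intro integral_mono *(1) \<psi>(2))
    show "jump1 \<beta> u x ?p z \<le> jump1 \<beta> \<psi> x ?p z" for z
      using \<psi>(3)[of "x + \<beta> z"] by (simp add: jump1_def)
  qed
  then show ?thesis using *(2) by linarith
qed

text \<open>The effective equation evaluates the operator on the test function and not on
  \<open>u\<close>. Twice differentiable functions above \<open>u\<close>, with the same value and
  slope at \<open>x\<close> and converging pointwise to \<open>u\<close>, close this gap through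
  \<open>reverse_fatou\<close>; the majorant comes from their two uniform bounds.\<close>

lemma C2_test_imp_quad_sub:
  assumes u: "continuous_on UNIV u" "\<And>y. \<bar>u y\<bar> \<le> R"
    and test: "\<And>x \<psi>. x \<in> \<Omega> \<Longrightarrow> C2 \<psi> \<Longrightarrow> integrable (dens q) (jump1 \<beta> \<psi> x (grad \<psi> x)) \<Longrightarrow>
      (\<And>y. u y - \<psi> y \<le> u x - \<psi> x) \<Longrightarrow> u x = \<psi> x \<Longrightarrow> K * u x - I1 q \<beta> \<psi> x \<le> F"
  shows "quad_sub q \<beta> \<Omega> (\<lambda>_. K) (\<lambda>_. F) u"
proof (rule quad_subI)
  fix x p A assume x: "x \<in> \<Omega>" and A: "A \<ge> 0"
    and h: "\<And>h. u (x + h) \<le> u x + p \<bullet> h + A * (norm h)\<^sup>2"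
  have R: "R \<ge> 0" using u(2)[of x] by linarith
  define R' where "R' = A + norm p + 5 * R + 2"
  define A' where "A' = A + 2 + 3 * (2 * R + norm p * B)"
  define c where "c h = (A * (norm h)\<^sup>2 + p \<bullet> h + u x - u (x + h)) / (norm h)\<^sup>2 + 2 * (norm h)\<^sup>2 + 6 * R * (norm h)\<^sup>2" for h
  have A': "A' \<ge> 0" unfolding A'_def using A R B_nonneg by simp
  have "\<exists>\<psi>. C2 \<psi> \<and> \<psi> x = u x \<and> grad \<psi> x = p \<and> (\<forall>y. u y \<le> \<psi> y) \<and> (\<forall>y. \<bar>\<psi> y\<bar> \<le> R') \<and>
     (\<forall>h. norm h \<le> B \<longrightarrow> \<psi> (x + h) \<le> u x + p \<bullet> h + A' * (norm h)\<^sup>2) \<and>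
     (\<forall>h. norm h \<le> real (Suc n) \<longrightarrow> \<psi> (x + h) \<le> u (x + h) + c h / real (Suc n))" for n
    unfolding R'_def A'_def c_def
    by (rule C2_upper_approximation[OF u h A _ B_nonneg, of "real (Suc n)"]) (simp, blast)
  then obtain \<psi> where \<psi>: "\<And>n. C2 (\<psi> n)" "\<And>n. \<psi> n x = u x" "\<And>n. grad (\<psi> n) x = p" "\<And>n y. u y \<le> \<psi> n y"
     "\<And>n y. \<bar>\<psi> n y\<bar> \<le> R'" "\<And>n h. norm h \<le> B \<Longrightarrow> \<psi> n (x + h) \<le> u x + p \<bullet> h + A' * (norm h)\<^sup>2"
     "\<And>n h. norm h \<le> real (Suc n) \<Longrightarrow> \<psi> n (x + h) \<le> u (x + h) + c h / real (Suc n)"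
    by metis
  have lim: "(\<lambda>n. \<psi> n (x + h)) \<longlonglongrightarrow> u (x + h)" for h
  proof (rule tendsto_sandwich[OF _ _ tendsto_const])
    obtain m :: nat where m: "norm h \<le> real m" using real_arch_simple by blast
    show "eventually (\<lambda>n. \<psi> n (x + h) \<le> u (x + h) + c h * inverse (real (Suc n))) sequentially"
      using eventually_ge_at_top[of m]
    proof eventually_elim
      case (elim n)
      then have "norm h \<le> real (Suc n)" using m by simp
      from \<psi>(7)[OF this] show ?case by (simp add: divide_inverse)
    qed
    show "(\<lambda>n. u (x + h) + c h * inverse (real (Suc n))) \<longlonglongrightarrow> u (x + h)"
      using tendsto_add[OF tendsto_const tendsto_mult_right_zero[OF LIMSEQ_inverse_real_of_nat, of "c h"]] by simp
  qed (simp add: \<psi>(4))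
  have int: "integrable (dens q) (jump1 \<beta> (\<psi> n) x p)" for n
    using integrable_jump1_C2[OF \<psi>(1,5), of n x] \<psi>(3) by simp
  have "integrable (dens q) (jump1 \<beta> u x p) \<and> K * u x - F \<le> (\<integral>z. jump1 \<beta> u x p z \<partial>(dens q))"
  proof (rule reverse_fatou[where f = "\<lambda>n. jump1 \<beta> (\<psi> n) x p" and c = "\<lambda>n. K * u x - F"
        and G = "\<lambda>z. (A' * B\<^sup>2 + 2 * R') * weight z"])
    show "integrable (dens q) (\<lambda>z. (A' * B\<^sup>2 + 2 * R') * weight z)"
      using integrable_weight by simp
    show "integrable (dens q) (jump1 \<beta> (\<psi> n) x p)" for n by (rule int)
    show "jump1 \<beta> (\<psi> n) x p z \<le> (A' * B\<^sup>2 + 2 * R') * weight z" for n z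
      by (rule jump1_le_weight[OF _ A' \<psi>(5)]) (use \<psi>(2,6) in auto)
    show "(\<lambda>n. jump1 \<beta> (\<psi> n) x p z) \<longlonglongrightarrow> jump1 \<beta> u x p z" for z
      unfolding jump1_def \<psi>(2) by (intro tendsto_intros lim)
    show "K * u x - F \<le> (\<integral>z. jump1 \<beta> (\<psi> n) x p z \<partial>(dens q))" for n
    proof -
      have "K * u x - I1 q \<beta> (\<psi> n) x \<le> F"
      proof (rule test[OF x \<psi>(1)])
        show "integrable (dens q) (jump1 \<beta> (\<psi> n) x (grad (\<psi> n) x))" unfolding \<psi>(3) by (rule int)
        show "u y - \<psi> n y \<le> u x - \<psi> n x" for y using \<psi>(4)[of y n] \<psi>(2)[of n] by linarith
        show "u x = \<psi> n x" by (simp only: \<psi>(2))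
      qed
      then show ?thesis unfolding I1_def \<psi>(3) by linarith
    qed
  qed simp
  then show "integrable (dens q) (jump1 \<beta> u x p) \<and> K * u x - (\<integral>z. jump1 \<beta> u x p z \<partial>(dens q)) \<le> F"
    by auto
qed

end

section \<open>Plane waves and correctors\<close>

lemma cos_lipschitz: "\<bar>cos (a + t) - cos a\<bar> \<le> \<bar>t :: real\<bar>"
proof -
  have "norm (cos (a + t) - cos a) \<le> 1 * norm ((a + t) - a)"
  proof (rule field_differentiable_bound[where S = UNIV and f' = "\<lambda>s. - sin s"])
    show "(cos has_field_derivative - sin z) (at z within UNIV)" for z :: real by (rule DERIV_cos)
  qed auto
  then show ?thesis by simp
qed

lemma cos_taylor: "\<bar>cos (a + t) - cos a + t * sin a\<bar> \<le> (t::real)\<^sup>2"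
proof -
  have "norm ((cos (a + t) + (a + t) * sin a) - (cos a + a * sin a)) \<le> \<bar>t\<bar> * norm ((a + t) - a)"
  proof (rule field_differentiable_bound[where S = "cball a \<bar>t\<bar>" and f' = "\<lambda>s. sin a - sin s"])
    fix s assume s: "s \<in> cball a \<bar>t\<bar>"
    show "((\<lambda>s. cos s + s * sin a) has_field_derivative sin a - sin s) (at s within cball a \<bar>t\<bar>)"
      by (auto intro!: derivative_eq_intros)
    have "\<bar>sin a - sin s\<bar> \<le> \<bar>a - s\<bar>"
      using cos_lipschitz[of "s - pi / 2" "a - s"] by (simp add: cos_diff)
    then show "norm (sin a - sin s) \<le> \<bar>t\<bar>" using s by (simp add: dist_real_def)
  qed (auto simp: dist_real_def)
  then show ?thesis by (simp add: algebra_simps power2_eq_square abs_mult_self_eq)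
qed

lemma sin_taylor: "\<bar>sin t - t\<bar> \<le> (t::real)\<^sup>2"
  using cos_taylor[of "- (pi / 2)" t] by (simp add: cos_diff)

text \<open>The predicate \<open>T\<close> says where the compensator is active: on the unit ball for \<open>jump1\<close>,
  everywhere for \<open>jump0\<close>.\<close>

definition tjump :: "('m \<Rightarrow> bool) \<Rightarrow> ('m \<Rightarrow> real^'n) \<Rightarrow> (real^'n \<Rightarrow> real) \<Rightarrow> real^'n \<Rightarrow> real^'n \<Rightarrow> 'm \<Rightarrow> real" where
  "tjump T \<beta> u x p z = u (x + \<beta> z) - u x - (if T z then p \<bullet> \<beta> z else 0)"

lemma jump1_eq_tjump: "jump1 \<beta> u x p = tjump (\<lambda>z. norm z \<le> 1) \<beta> u x p"
  by (simp add: fun_eq_iff jump1_def tjump_def)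

lemma jump0_eq_tjump: "jump0 \<beta> u x p = tjump (\<lambda>_. True) \<beta> u x p"
  by (simp add: fun_eq_iff jump0_def tjump_def)

text \<open>What touching arguments use of a corrector: global paraboloids on both sides and a
  global Lipschitz bound. The notion is stable under linear combinations and avoids second
  derivatives; \<open>g\<close> is the gradient.\<close>

definition smooth_with :: "(real^'n \<Rightarrow> real) \<Rightarrow> (real^'n \<Rightarrow> real^'n) \<Rightarrow> bool" where
  "smooth_with \<zeta> g \<longleftrightarrow> (\<exists>C\<ge>0. \<forall>x h. \<bar>\<zeta> (x + h) - \<zeta> x - g x \<bullet> h\<bar> \<le> C * (norm h)\<^sup>2
      \<and> \<bar>\<zeta> (x + h) - \<zeta> x\<bar> \<le> C * norm h)"

lemma smooth_with_continuous:
  assumes "smooth_with \<zeta> g"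
  shows "continuous_on UNIV \<zeta>"
proof -
  obtain C where C: "C \<ge> 0" "\<And>x h. \<bar>\<zeta> (x + h) - \<zeta> x\<bar> \<le> C * norm h"
    using assms unfolding smooth_with_def by blast
  have "C-lipschitz_on UNIV \<zeta>"
    using C(2)[of y "x - y" for x y] C(1) by (intro lipschitz_onI) (auto simp: dist_norm)
  then show ?thesis by (rule lipschitz_on_continuous_on)
qed

lemma smooth_with_GDERIV:
  assumes "smooth_with \<zeta> g"
  shows "GDERIV \<zeta> x :> g x"
proof -
  obtain C where C: "C \<ge> 0" "\<And>h. \<bar>\<zeta> (x + h) - \<zeta> x - g x \<bullet> h\<bar> \<le> C * (norm h)\<^sup>2"
    using assms unfolding smooth_with_def by blast
  have "(\<lambda>h. norm (\<zeta> (x + h) - \<zeta> x - h \<bullet> g x) / norm h) \<midarrow>0\<rightarrow> 0"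
  proof (rule Lim_null_comparison)
    have "\<bar>\<zeta> (x + h) - \<zeta> x - h \<bullet> g x\<bar> / norm h \<le> C * norm h" for h
      using C(2)[of h] by (cases "h = 0") (auto simp: divide_le_eq power2_eq_square inner_commute mult_ac)
    then show "\<forall>\<^sub>F h in at 0. norm (norm (\<zeta> (x + h) - \<zeta> x - h \<bullet> g x) / norm h) \<le> C * norm h"
      by (intro always_eventually allI) simp
    show "(\<lambda>h. C * norm (h :: real^'n)) \<midarrow>0\<rightarrow> 0"
      by (intro tendsto_mult_right_zero tendsto_norm_zero tendsto_ident_at)
  qed
  then show ?thesis unfolding gderiv_def has_derivative_at
    by (auto intro: bounded_linear_inner_left)
qed

lemma smooth_with_zero: "smooth_with (\<lambda>_. 0) (\<lambda>_. 0)"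
  unfolding smooth_with_def by auto

lemma smooth_with_add:
  assumes "smooth_with \<zeta> g" "smooth_with \<zeta>' g'"
  shows "smooth_with (\<lambda>x. \<zeta> x + \<zeta>' x) (\<lambda>x. g x + g' x)"
proof -
  obtain C C' where C: "C \<ge> 0" "\<And>x h. \<bar>\<zeta> (x + h) - \<zeta> x - g x \<bullet> h\<bar> \<le> C * (norm h)\<^sup>2"
      "\<And>x h. \<bar>\<zeta> (x + h) - \<zeta> x\<bar> \<le> C * norm h"
    and C': "C' \<ge> 0" "\<And>x h. \<bar>\<zeta>' (x + h) - \<zeta>' x - g' x \<bullet> h\<bar> \<le> C' * (norm h)\<^sup>2"
      "\<And>x h. \<bar>\<zeta>' (x + h) - \<zeta>' x\<bar> \<le> C' * norm h"
    using assms unfolding smooth_with_def by blast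
  show ?thesis unfolding smooth_with_def
  proof (intro exI[of _ "C + C'"] conjI allI)
    fix x h
    show "\<bar>\<zeta> (x + h) + \<zeta>' (x + h) - (\<zeta> x + \<zeta>' x) - (g x + g' x) \<bullet> h\<bar> \<le> (C + C') * (norm h)\<^sup>2"
      using C(2)[of x h] C'(2)[of x h] by (simp add: inner_add_left distrib_right)
    show "\<bar>\<zeta> (x + h) + \<zeta>' (x + h) - (\<zeta> x + \<zeta>' x)\<bar> \<le> (C + C') * norm h"
      using C(3)[of x h] C'(3)[of x h] by (simp add: distrib_right)
  qed (use C C' in simp)
qed

lemma smooth_with_cmult:
  assumes "smooth_with \<zeta> g"
  shows "smooth_with (\<lambda>x. c * \<zeta> x) (\<lambda>x. c *\<^sub>R g x)"
proof -
  obtain C where C: "C \<ge> 0" "\<And>x h. \<bar>\<zeta> (x + h) - \<zeta> x - g x \<bullet> h\<bar> \<le> C * (norm h)\<^sup>2"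
      "\<And>x h. \<bar>\<zeta> (x + h) - \<zeta> x\<bar> \<le> C * norm h"
    using assms unfolding smooth_with_def by blast
  show ?thesis unfolding smooth_with_def
  proof (intro exI[of _ "\<bar>c\<bar> * C"] conjI allI)
    fix x h
    have "c * \<zeta> (x + h) - c * \<zeta> x - (c *\<^sub>R g x) \<bullet> h = c * (\<zeta> (x + h) - \<zeta> x - g x \<bullet> h)"
      "c * \<zeta> (x + h) - c * \<zeta> x = c * (\<zeta> (x + h) - \<zeta> x)"
      by (simp_all add: right_diff_distrib)
    then show "\<bar>c * \<zeta> (x + h) - c * \<zeta> x - (c *\<^sub>R g x) \<bullet> h\<bar> \<le> \<bar>c\<bar> * C * (norm h)\<^sup>2"
      "\<bar>c * \<zeta> (x + h) - c * \<zeta> x\<bar> \<le> \<bar>c\<bar> * C * norm h"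
      using C(2,3)[of x h] by (auto simp: abs_mult mult.assoc intro: mult_left_mono)
  qed (use C in simp)
qed

lemma smooth_with_wave:
  "smooth_with (\<lambda>y. cos (\<xi> \<bullet> y + \<theta>)) (\<lambda>x. - sin (\<xi> \<bullet> x + \<theta>) *\<^sub>R \<xi>)"
  unfolding smooth_with_def
proof (intro exI[of _ "(norm \<xi>)\<^sup>2 + norm \<xi>"] conjI allI)
  fix x h
  have e: "\<xi> \<bullet> (x + h) + \<theta> = (\<xi> \<bullet> x + \<theta>) + \<xi> \<bullet> h" by (simp add: inner_add_right)
  have a: "\<bar>\<xi> \<bullet> h\<bar> \<le> norm \<xi> * norm h" by (rule Cauchy_Schwarz_ineq2)
  have "(\<xi> \<bullet> h)\<^sup>2 \<le> (norm \<xi>)\<^sup>2 * (norm h)\<^sup>2"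
    using power_mono[OF a, of 2] by (simp add: power_mult_distrib)
  also have "\<dots> \<le> ((norm \<xi>)\<^sup>2 + norm \<xi>) * (norm h)\<^sup>2" by (simp add: mult_right_mono)
  finally have "(\<xi> \<bullet> h)\<^sup>2 \<le> ((norm \<xi>)\<^sup>2 + norm \<xi>) * (norm h)\<^sup>2" .
  with cos_taylor[of "\<xi> \<bullet> x + \<theta>" "\<xi> \<bullet> h"]
  show "\<bar>cos (\<xi> \<bullet> (x + h) + \<theta>) - cos (\<xi> \<bullet> x + \<theta>) - (- sin (\<xi> \<bullet> x + \<theta>) *\<^sub>R \<xi>) \<bullet> h\<bar> \<le> ((norm \<xi>)\<^sup>2 + norm \<xi>) * (norm h)\<^sup>2"
    unfolding e by (simp add: mult.commute)
  have "norm \<xi> * norm h \<le> ((norm \<xi>)\<^sup>2 + norm \<xi>) * norm h" by (simp add: mult_right_mono)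
  with cos_lipschitz[of "\<xi> \<bullet> x + \<theta>" "\<xi> \<bullet> h"] a
  show "\<bar>cos (\<xi> \<bullet> (x + h) + \<theta>) - cos (\<xi> \<bullet> x + \<theta>)\<bar> \<le> ((norm \<xi>)\<^sup>2 + norm \<xi>) * norm h"
    unfolding e by linarith
qed simp

text \<open>The real part of the Levy-Khintchine exponent of the image of \<open>dens q\<close>
  under \<open>\<beta>\<close>; the compensator enters the imaginary part only.\<close>

definition char_exp_real :: "(real^'m \<Rightarrow> real) \<Rightarrow> (real^'m \<Rightarrow> real^'n) \<Rightarrow> real^'n \<Rightarrow> real" where
  "char_exp_real q \<beta> \<xi> = (\<integral>z. 1 - cos (\<xi> \<bullet> \<beta> z) \<partial>(dens q))"

text \<open>Besides solving the equation with right-hand side \<open>P\<close>, a corrector has to have a small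
  carre du champ, the last clause.\<close>

definition corrects ::
  "(real^'m \<Rightarrow> bool) \<Rightarrow> (real^'m \<Rightarrow> real) \<Rightarrow> (real^'m \<Rightarrow> real^'n) \<Rightarrow> real \<Rightarrow> (real^'n \<Rightarrow> real)
   \<Rightarrow> (real^'n \<Rightarrow> real) \<Rightarrow> (real^'n \<Rightarrow> real^'n) \<Rightarrow> bool" where
  "corrects T q \<beta> \<delta> P \<zeta> g \<longleftrightarrow> smooth_with \<zeta> g \<and> (\<forall>x. \<bar>\<zeta> x\<bar> \<le> \<delta>) \<and>
     (\<forall>x. integrable (dens q) (tjump T \<beta> \<zeta> x (g x)) \<and> (\<integral>z. tjump T \<beta> \<zeta> x (g x) z \<partial>(dens q)) = P x) \<and>
     (\<forall>x. integrable (dens q) (\<lambda>z. (\<zeta> (x + \<beta> z) - \<zeta> x)\<^sup>2) \<and> (\<integral>z. (\<zeta> (x + \<beta> z) - \<zeta> x)\<^sup>2 \<partial>(dens q)) \<le> \<delta>)"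

lemma corrects_mono: "corrects T q \<beta> \<delta> P \<zeta> g \<Longrightarrow> \<delta> \<le> \<delta>' \<Longrightarrow> corrects T q \<beta> \<delta>' P \<zeta> g"
  unfolding corrects_def by (meson order_trans)

lemma corrects_nonneg: "corrects T q \<beta> \<delta> P \<zeta> g \<Longrightarrow> \<delta> \<ge> 0"
  unfolding corrects_def by (meson abs_ge_zero order_trans)

lemma corrects_zero: "corrects T q \<beta> 0 (\<lambda>_. 0) (\<lambda>_. 0) (\<lambda>_. 0)"
  unfolding corrects_def using smooth_with_zero by (simp add: tjump_def[abs_def] cong: if_cong)

text \<open>The sup norm scales with \<open>\<bar>c\<bar>\<close> and the carre du champ with
  \<open>c^2\<close>; the factor covers both.\<close>

lemma corrects_cmult:
  assumes "corrects T q \<beta> \<delta> P \<zeta> g"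
  shows "corrects T q \<beta> ((\<bar>c\<bar> + c\<^sup>2) * \<delta>) (\<lambda>x. c * P x) (\<lambda>x. c * \<zeta> x) (\<lambda>x. c *\<^sub>R g x)"
proof -
  note a = assms[unfolded corrects_def]
  have d: "\<delta> \<ge> 0" by (rule corrects_nonneg[OF assms])
  have j: "tjump T \<beta> (\<lambda>x. c * \<zeta> x) x (c *\<^sub>R g x) = (\<lambda>z. c * tjump T \<beta> \<zeta> x (g x) z)" for x
    by (auto simp: tjump_def fun_eq_iff right_diff_distrib)
  have s: "(c * \<zeta> (x + \<beta> z) - c * \<zeta> x)\<^sup>2 = c\<^sup>2 * (\<zeta> (x + \<beta> z) - \<zeta> x)\<^sup>2" for x z
    by (simp add: power_mult_distrib[symmetric] right_diff_distrib)
  show ?thesis unfolding corrects_def j s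
  proof (intro conjI allI)
    show "smooth_with (\<lambda>x. c * \<zeta> x) (\<lambda>x. c *\<^sub>R g x)" using a smooth_with_cmult by blast
    fix x
    have "\<bar>c * \<zeta> x\<bar> \<le> \<bar>c\<bar> * \<delta>" using a by (simp add: abs_mult mult_left_mono)
    also have "\<dots> \<le> (\<bar>c\<bar> + c\<^sup>2) * \<delta>" using d by (simp add: mult_right_mono)
    finally show "\<bar>c * \<zeta> x\<bar> \<le> (\<bar>c\<bar> + c\<^sup>2) * \<delta>" .
    have "(\<integral>z. c\<^sup>2 * (\<zeta> (x + \<beta> z) - \<zeta> x)\<^sup>2 \<partial>(dens q)) \<le> c\<^sup>2 * \<delta>"
      using a by (simp add: mult_left_mono)
    also have "\<dots> \<le> (\<bar>c\<bar> + c\<^sup>2) * \<delta>" using d by (simp add: mult_right_mono)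
    finally show "(\<integral>z. c\<^sup>2 * (\<zeta> (x + \<beta> z) - \<zeta> x)\<^sup>2 \<partial>(dens q)) \<le> (\<bar>c\<bar> + c\<^sup>2) * \<delta>" .
  qed (use a in auto)
qed

text \<open>The factor 2 is that of \<open>(s + t)^2 \<le> 2 * s^2 + 2 * t^2\<close>, applied to the
  carre du champ.\<close>

lemma corrects_add:
  assumes "corrects T q \<beta> \<delta>1 P1 \<zeta>1 g1" "corrects T q \<beta> \<delta>2 P2 \<zeta>2 g2" "continuous_on UNIV \<beta>"
  shows "corrects T q \<beta> (2 * (\<delta>1 + \<delta>2)) (\<lambda>x. P1 x + P2 x) (\<lambda>x. \<zeta>1 x + \<zeta>2 x) (\<lambda>x. g1 x + g2 x)"
proof -
  note a = assms(1)[unfolded corrects_def] and b = assms(2)[unfolded corrects_def]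
  have d: "\<delta>1 \<ge> 0" "\<delta>2 \<ge> 0" using corrects_nonneg assms by blast+
  have j: "tjump T \<beta> (\<lambda>x. \<zeta>1 x + \<zeta>2 x) x (g1 x + g2 x) = (\<lambda>z. tjump T \<beta> \<zeta>1 x (g1 x) z + tjump T \<beta> \<zeta>2 x (g2 x) z)" for x
    by (auto simp: tjump_def fun_eq_iff inner_add_left)
  have [measurable]: "\<zeta>1 \<in> borel_measurable borel" "\<zeta>2 \<in> borel_measurable borel" "\<beta> \<in> borel_measurable borel"
    using a b assms(3) smooth_with_continuous borel_measurable_continuous_onI by blast+
  have le: "(\<zeta>1 (x + \<beta> z) + \<zeta>2 (x + \<beta> z) - (\<zeta>1 x + \<zeta>2 x))\<^sup>2
      \<le> 2 * (\<zeta>1 (x + \<beta> z) - \<zeta>1 x)\<^sup>2 + 2 * (\<zeta>2 (x + \<beta> z) - \<zeta>2 x)\<^sup>2" for x z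
    using zero_le_power2[of "(\<zeta>1 (x + \<beta> z) - \<zeta>1 x) - (\<zeta>2 (x + \<beta> z) - \<zeta>2 x)"]
    by (simp add: power2_eq_square algebra_simps)
  have int: "integrable (dens q) (\<lambda>z. 2 * (\<zeta>1 (x + \<beta> z) - \<zeta>1 x)\<^sup>2 + 2 * (\<zeta>2 (x + \<beta> z) - \<zeta>2 x)\<^sup>2)" for x
    using a b by auto
  have int2: "integrable (dens q) (\<lambda>z. (\<zeta>1 (x + \<beta> z) + \<zeta>2 (x + \<beta> z) - (\<zeta>1 x + \<zeta>2 x))\<^sup>2)" for x
    by (rule Bochner_Integration.integrable_bound[OF int[of x]]) (use le in auto)
  show ?thesis unfolding corrects_def j
  proof (intro conjI allI)
    show "smooth_with (\<lambda>x. \<zeta>1 x + \<zeta>2 x) (\<lambda>x. g1 x + g2 x)" using a b smooth_with_add by blast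
    fix x
    have "\<bar>\<zeta>1 x\<bar> \<le> \<delta>1" "\<bar>\<zeta>2 x\<bar> \<le> \<delta>2" using a b by auto
    then show "\<bar>\<zeta>1 x + \<zeta>2 x\<bar> \<le> 2 * (\<delta>1 + \<delta>2)"
      using d abs_triangle_ineq[of "\<zeta>1 x" "\<zeta>2 x"] unfolding distrib_left by linarith
    have "(\<integral>z. (\<zeta>1 (x + \<beta> z) + \<zeta>2 (x + \<beta> z) - (\<zeta>1 x + \<zeta>2 x))\<^sup>2 \<partial>(dens q))
        \<le> (\<integral>z. 2 * (\<zeta>1 (x + \<beta> z) - \<zeta>1 x)\<^sup>2 + 2 * (\<zeta>2 (x + \<beta> z) - \<zeta>2 x)\<^sup>2 \<partial>(dens q))"
      by (intro integral_mono int int2 le)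
    also have "\<dots> = 2 * (\<integral>z. (\<zeta>1 (x + \<beta> z) - \<zeta>1 x)\<^sup>2 \<partial>(dens q)) + 2 * (\<integral>z. (\<zeta>2 (x + \<beta> z) - \<zeta>2 x)\<^sup>2 \<partial>(dens q))"
      using a b by simp
    also have "\<dots> \<le> 2 * (\<delta>1 + \<delta>2)" using a b by (simp add: add_mono)
    finally show "(\<integral>z. (\<zeta>1 (x + \<beta> z) + \<zeta>2 (x + \<beta> z) - (\<zeta>1 x + \<zeta>2 x))\<^sup>2 \<partial>(dens q)) \<le> 2 * (\<delta>1 + \<delta>2)" .
  qed (use a b int2 in auto)
qed

lemma integral_linear_combination:
  fixes f g :: "'a \<Rightarrow> real"
  assumes "integrable M f" "integrable M g"
  shows "(\<integral>z. c * (a * f z - b * g z) \<partial>M) = c * (a * (\<integral>z. f z \<partial>M) - b * (\<integral>z. g z \<partial>M))"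
  using assms by simp

context levy
begin

lemma integrable_one_minus_cos: "integrable (dens q) (\<lambda>z. 1 - cos (\<xi> \<bullet> \<beta> z))"
proof (rule integrable_le_weight)
  fix z
  show "\<bar>1 - cos (\<xi> \<bullet> \<beta> z)\<bar> \<le> ((norm \<xi>)\<^sup>2 * B\<^sup>2 + 2) * weight z"
  proof (cases "norm z \<le> 1")
    case True
    have "\<bar>1 - cos (\<xi> \<bullet> \<beta> z)\<bar> \<le> (\<xi> \<bullet> \<beta> z)\<^sup>2"
      using cos_taylor[of 0 "\<xi> \<bullet> \<beta> z"] by (simp add: abs_minus_commute)
    also have "\<dots> \<le> (norm \<xi>)\<^sup>2 * (norm (\<beta> z))\<^sup>2"
      using power_mono[OF Cauchy_Schwarz_ineq2[of \<xi> "\<beta> z"], of 2] by (simp add: power_mult_distrib)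
    also have "\<dots> \<le> (norm \<xi>)\<^sup>2 * (B\<^sup>2 * weight z)"
      by (intro mult_left_mono small_jump_le True) auto
    finally show ?thesis using weight_nonneg[of z] by (simp add: distrib_right mult.assoc)
  next
    case False
    have "\<bar>1 - cos (\<xi> \<bullet> \<beta> z)\<bar> \<le> 2"
      using cos_le_one[of "\<xi> \<bullet> \<beta> z"] cos_ge_minus_one[of "\<xi> \<bullet> \<beta> z"] by linarith
    moreover have "1 \<le> weight z" using False by (intro weight_ge_1) simp
    moreover have "0 \<le> (norm \<xi>)\<^sup>2 * B\<^sup>2 * weight z" using weight_nonneg[of z] by simp
    ultimately show ?thesis unfolding distrib_right by linarith
  qed
qed measurable

lemma integrable_sin_compensated:
  fixes T :: "real^'m \<Rightarrow> bool"
  assumes T: "Measurable.pred borel T" "\<And>z. norm z \<le> 1 \<Longrightarrow> T z"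
  shows "integrable (dens q) (\<lambda>z. sin (\<xi> \<bullet> \<beta> z) - (if T z then \<xi> \<bullet> \<beta> z else 0))"
proof (rule integrable_le_weight)
  fix z :: "real^'m"
  have w: "0 \<le> (norm \<xi>)\<^sup>2 * B\<^sup>2 * weight z" "0 \<le> norm \<xi> * B * weight z"
    using weight_nonneg[of z] B_nonneg by simp_all
  show "\<bar>sin (\<xi> \<bullet> \<beta> z) - (if T z then \<xi> \<bullet> \<beta> z else 0)\<bar> \<le> ((norm \<xi>)\<^sup>2 * B\<^sup>2 + norm \<xi> * B + 1) * weight z"
  proof (cases "norm z \<le> 1")
    case True
    have "\<bar>sin (\<xi> \<bullet> \<beta> z) - \<xi> \<bullet> \<beta> z\<bar> \<le> (\<xi> \<bullet> \<beta> z)\<^sup>2" by (rule sin_taylor)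
    also have "\<dots> \<le> (norm \<xi>)\<^sup>2 * (norm (\<beta> z))\<^sup>2"
      using power_mono[OF Cauchy_Schwarz_ineq2[of \<xi> "\<beta> z"], of 2] by (simp add: power_mult_distrib)
    also have "\<dots> \<le> (norm \<xi>)\<^sup>2 * (B\<^sup>2 * weight z)"
      by (intro mult_left_mono small_jump_le True) auto
    finally show ?thesis using w weight_nonneg[of z] T(2)[OF True] by (simp add: distrib_right mult.assoc)
  next
    case False
    have "\<bar>\<xi> \<bullet> \<beta> z\<bar> \<le> norm \<xi> * norm (\<beta> z)" by (rule Cauchy_Schwarz_ineq2)
    also have "\<dots> \<le> norm \<xi> * (B * weight z)" using False by (intro mult_left_mono large_jump_le) auto
    finally have "\<bar>\<xi> \<bullet> \<beta> z\<bar> \<le> norm \<xi> * B * weight z" by (simp add: mult.assoc)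
    moreover have "\<bar>sin (\<xi> \<bullet> \<beta> z)\<bar> \<le> 1" by (rule abs_sin_le_one)
    moreover have "1 \<le> weight z" using False by (intro weight_ge_1) simp
    moreover have "\<bar>sin (\<xi> \<bullet> \<beta> z) - (if T z then \<xi> \<bullet> \<beta> z else 0)\<bar> \<le> \<bar>sin (\<xi> \<bullet> \<beta> z)\<bar> + \<bar>\<xi> \<bullet> \<beta> z\<bar>"
      by auto
    ultimately show ?thesis using w unfolding distrib_right mult_1 by linarith
  qed
qed (use T(1) in measurable)

text \<open>The operator multiplies the plane wave by a modulus, at least \<open>char_exp_real q \<beta> \<xi>\<close>, and
  shifts its phase.\<close>

lemma wave_corrector:
  fixes T :: "real^'m \<Rightarrow> bool"
  assumes T: "Measurable.pred borel T" "\<And>z. norm z \<le> 1 \<Longrightarrow> T z"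
    and pos: "char_exp_real q \<beta> \<xi> > 0"
  shows "\<exists>c \<eta> g. corrects T q \<beta> (2 / char_exp_real q \<beta> \<xi>) (\<lambda>x. cos (\<xi> \<bullet> x + \<theta>)) (\<lambda>y. c * cos (\<xi> \<bullet> y + \<eta>)) g"
proof -
  \<comment> \<open>\<open>- E\<close> and \<open>D\<close> are the real and imaginary parts of the
    eigenvalue of the operator on the complex exponential of frequency \<open>\<xi>\<close>;
    \<open>r\<close> and \<open>\<omega>\<close> are its polar coordinates, and the phase
    \<open>\<theta> - \<omega>\<close> undoes the rotation.\<close>
  define E where "E = char_exp_real q \<beta> \<xi>"
  define D where "D = (\<integral>z. sin (\<xi> \<bullet> \<beta> z) - (if T z then \<xi> \<bullet> \<beta> z else 0) \<partial>(dens q))"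
  define r where "r = cmod (Complex (- E) D)"
  define \<omega> where "\<omega> = Arg (Complex (- E) D)"
  have E: "E > 0" using pos by (simp add: E_def)
  have pol: "- E = r * cos \<omega>" "D = r * sin \<omega>"
    using rcis_cmod_Arg[of "Complex (- E) D"] unfolding r_def \<omega>_def
    by (metis complex.sel(1) Re_rcis, metis complex.sel(2) Im_rcis)
  then have E_pol: "E = - (r * cos \<omega>)" by simp
  have rE: "E \<le> r" using abs_Re_le_cmod[of "Complex (- E) D"] E unfolding r_def by simp
  have r: "r > 0" using rE E by linarith
  define \<eta> where "\<eta> = \<theta> - \<omega>"
  define \<zeta> where "\<zeta> y = (1 / r) * cos (\<xi> \<bullet> y + \<eta>)" for y
  define g where "g x = (1 / r) *\<^sub>R (- sin (\<xi> \<bullet> x + \<eta>) *\<^sub>R \<xi>)" for x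
  have add: "\<xi> \<bullet> (x + h) + \<eta> = (\<xi> \<bullet> x + \<eta>) + \<xi> \<bullet> h" for x h by (simp add: inner_add_right)
  have j: "tjump T \<beta> \<zeta> x (g x) z = (1 / r) * (- cos (\<xi> \<bullet> x + \<eta>) * (1 - cos (\<xi> \<bullet> \<beta> z))
      - sin (\<xi> \<bullet> x + \<eta>) * (sin (\<xi> \<bullet> \<beta> z) - (if T z then \<xi> \<bullet> \<beta> z else 0)))" for x z
    unfolding tjump_def \<zeta>_def g_def add cos_add by (simp add: algebra_simps)
  \<comment> \<open>Adding the squared increment of the sine completes the left side to |exp (i t) -
    1|^2 = 2 (1 - cos t), whose integral is twice the symbol.\<close>
  have sq: "(\<zeta> (x + \<beta> z) - \<zeta> x)\<^sup>2 \<le> 2 / r\<^sup>2 * (1 - cos (\<xi> \<bullet> \<beta> z))" for x z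
  proof -
    let ?a = "\<xi> \<bullet> x + \<eta>" and ?t = "\<xi> \<bullet> \<beta> z"
    have "(cos (?a + ?t) - cos ?a)\<^sup>2 \<le> (cos (?a + ?t) - cos ?a)\<^sup>2 + (sin (?a + ?t) - sin ?a)\<^sup>2" by simp
    also have "\<dots> = ((cos (?a + ?t))\<^sup>2 + (sin (?a + ?t))\<^sup>2) + ((cos ?a)\<^sup>2 + (sin ?a)\<^sup>2)
        - 2 * (cos (?a + ?t) * cos ?a + sin (?a + ?t) * sin ?a)"
      by (simp add: power2_diff algebra_simps)
    also have "\<dots> = 2 * (1 - cos ?t)"
      unfolding cos_diff[symmetric] by simp
    finally have "(1 / r)\<^sup>2 * (cos (?a + ?t) - cos ?a)\<^sup>2 \<le> (1 / r)\<^sup>2 * (2 * (1 - cos ?t))"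
      by (rule mult_left_mono) simp
    moreover have "\<zeta> (x + \<beta> z) - \<zeta> x = (1 / r) * (cos (?a + ?t) - cos ?a)"
      unfolding \<zeta>_def add by (simp only: right_diff_distrib)
    ultimately show ?thesis by (simp add: power_mult_distrib power_divide)
  qed
  have cont: "smooth_with \<zeta> g" unfolding \<zeta>_def g_def by (intro smooth_with_cmult smooth_with_wave)
  then have [measurable]: "\<zeta> \<in> borel_measurable borel"
    by (intro borel_measurable_continuous_onI smooth_with_continuous)
  have r2: "2 / r\<^sup>2 * E \<le> 2 / E"
  proof -
    have "E * E \<le> r\<^sup>2" using power_mono[OF rE, of 2] E by (simp add: power2_eq_square)
    then show ?thesis using E r by (simp add: divide_simps)
  qed
  have "corrects T q \<beta> (2 / E) (\<lambda>x. cos (\<xi> \<bullet> x + \<theta>)) \<zeta> g"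
    unfolding corrects_def
  proof (intro conjI allI)
    show "smooth_with \<zeta> g" by (rule cont)
    fix x
    have "\<bar>\<zeta> x\<bar> = \<bar>cos (\<xi> \<bullet> x + \<eta>)\<bar> / r" unfolding \<zeta>_def using r by (simp add: abs_mult)
    also have "\<dots> \<le> 1 / r" using r by (intro divide_right_mono) auto
    also have "\<dots> \<le> 2 / E" using rE E by (intro frac_le) auto
    finally show "\<bar>\<zeta> x\<bar> \<le> 2 / E" .
    show "integrable (dens q) (tjump T \<beta> \<zeta> x (g x))"
      unfolding j
      by (intro integrable_mult_right Bochner_Integration.integrable_diff integrable_one_minus_cos
          integrable_sin_compensated T)
    have "(\<integral>z. tjump T \<beta> \<zeta> x (g x) z \<partial>(dens q)) = (1 / r) * (- cos (\<xi> \<bullet> x + \<eta>) * E - sin (\<xi> \<bullet> x + \<eta>) * D)"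
      unfolding j D_def E_def char_exp_real_def
      by (rule integral_linear_combination integrable_one_minus_cos integrable_sin_compensated T)+
    also have "\<dots> = cos (\<xi> \<bullet> x + \<eta>) * cos \<omega> - sin (\<xi> \<bullet> x + \<eta>) * sin \<omega>"
      unfolding E_pol pol(2) using r by (simp add: field_simps)
    also have "\<dots> = cos (\<xi> \<bullet> x + \<theta>)" unfolding cos_add[symmetric] \<eta>_def by simp
    finally show "(\<integral>z. tjump T \<beta> \<zeta> x (g x) z \<partial>(dens q)) = cos (\<xi> \<bullet> x + \<theta>)" .
    show int: "integrable (dens q) (\<lambda>z. (\<zeta> (x + \<beta> z) - \<zeta> x)\<^sup>2)"
    proof (rule Bochner_Integration.integrable_bound)
      show "integrable (dens q) (\<lambda>z. 2 / r\<^sup>2 * (1 - cos (\<xi> \<bullet> \<beta> z)))"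
        by (intro integrable_mult_right integrable_one_minus_cos)
      show "AE z in dens q. norm ((\<zeta> (x + \<beta> z) - \<zeta> x)\<^sup>2) \<le> norm (2 / r\<^sup>2 * (1 - cos (\<xi> \<bullet> \<beta> z)))"
        using order_trans[OF sq abs_ge_self] by (intro always_eventually allI) simp
    qed measurable
    have "(\<integral>z. (\<zeta> (x + \<beta> z) - \<zeta> x)\<^sup>2 \<partial>(dens q)) \<le> (\<integral>z. 2 / r\<^sup>2 * (1 - cos (\<xi> \<bullet> \<beta> z)) \<partial>(dens q))"
      by (intro integral_mono int sq integrable_mult_right integrable_one_minus_cos)
    also have "\<dots> = 2 / r\<^sup>2 * E" unfolding E_def char_exp_real_def by (rule integral_mult_right_zero)
    also note r2
    finally show "(\<integral>z. (\<zeta> (x + \<beta> z) - \<zeta> x)\<^sup>2 \<partial>(dens q)) \<le> 2 / E" .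
  qed
  then show ?thesis unfolding E_def \<zeta>_def[abs_def] by blast
qed

end

section \<open>Trigonometric polynomials on the torus\<close>

lemma int_lattice_add: "k \<in> int_lattice \<Longrightarrow> k' \<in> int_lattice \<Longrightarrow> k + k' \<in> int_lattice"
  and int_lattice_diff: "k \<in> int_lattice \<Longrightarrow> k' \<in> int_lattice \<Longrightarrow> k - k' \<in> int_lattice"
  by (auto simp: int_lattice_def)

lemma int_lattice_zero: "0 \<in> int_lattice"
  and int_lattice_axis: "axis i 1 \<in> int_lattice"
  by (auto simp: int_lattice_def axis_def)

lemma int_lattice_inner: "k \<in> int_lattice \<Longrightarrow> k' \<in> int_lattice \<Longrightarrow> k \<bullet> k' \<in> \<int>"
  by (auto simp: int_lattice_def inner_vec_def intro!: Ints_sum Ints_mult)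

lemma reduce_to_unit_cube:
  fixes y :: "real^'n"
  obtains k where "k \<in> int_lattice" "y + k \<in> unit_cube"
proof
  let ?k = "(\<chi> i. - real_of_int \<lfloor>y $ i\<rfloor>) :: real^'n"
  show "?k \<in> int_lattice" by (simp add: int_lattice_def)
  show "y + ?k \<in> unit_cube"
    unfolding unit_cube_def by (auto; linarith)
qed

lemma compact_unit_cube: "compact (unit_cube :: (real^'n) set)"
proof -
  have "unit_cube = cbox 0 (1 :: real^'n)" by (auto simp: unit_cube_def mem_box_cart)
  then show ?thesis by (metis compact_cbox)
qed

lemma zero_in_unit_cube: "0 \<in> unit_cube"
  by (simp add: unit_cube_def)

text \<open>A free phase covers sines and cosines at once, so products reduce to one product-to-sum
  formula.\<close>

inductive trig :: "(real^'n \<Rightarrow> real) \<Rightarrow> bool" where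
  trig_wave: "k \<in> int_lattice \<Longrightarrow> trig (\<lambda>y. c * cos ((2 * pi) *\<^sub>R k \<bullet> y + \<theta>))"
| trig_add: "trig P \<Longrightarrow> trig Q \<Longrightarrow> trig (\<lambda>y. P y + Q y)"

text \<open>Frequency 0, where the symbol vanishes, is excluded; at the other lattice frequencies
  the operator can be inverted.\<close>

inductive trig0 :: "(real^'n \<Rightarrow> real) \<Rightarrow> bool" where
  trig0_zero: "trig0 (\<lambda>_. 0)"
| trig0_wave: "k \<in> int_lattice \<Longrightarrow> k \<noteq> 0 \<Longrightarrow> trig0 (\<lambda>y. c * cos ((2 * pi) *\<^sub>R k \<bullet> y + \<theta>))"
| trig0_add: "trig0 P \<Longrightarrow> trig0 Q \<Longrightarrow> trig0 (\<lambda>y. P y + Q y)"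

lemma trig_const: "trig (\<lambda>_. c)"
  using trig_wave[OF int_lattice_zero, of c 0] by simp

lemma trig_decompose: "trig P \<Longrightarrow> \<exists>c Q. trig0 Q \<and> P = (\<lambda>y. c + Q y)"
proof (induction rule: trig.induct)
  case (trig_wave k c \<theta>)
  show ?case
  proof (cases "k = 0")
    case True
    then show ?thesis using trig0_zero by (intro exI[of _ "c * cos \<theta>"] exI[of _ "\<lambda>_. 0"]) auto
  next
    case False
    then show ?thesis using trig0_wave[OF trig_wave False]
      by (intro exI[of _ 0] exI[of _ "\<lambda>y. c * cos ((2 * pi) *\<^sub>R k \<bullet> y + \<theta>)"]) auto
  qed
next
  case (trig_add P P')
  then obtain c Q c' Q' where "trig0 Q" "P = (\<lambda>y. c + Q y)" "trig0 Q'" "P' = (\<lambda>y. c' + Q' y)" by blast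
  then show ?case using trig0_add[of Q Q']
    by (intro exI[of _ "c + c'"] exI[of _ "\<lambda>y. Q y + Q' y"]) auto
qed

lemma trig_mult:
  assumes "trig P" "trig Q"
  shows "trig (\<lambda>y. P y * Q y)"
  using assms(1)
proof (induction rule: trig.induct)
  case (trig_wave k c \<theta>)
  show ?case
    using assms(2)
  proof (induction rule: trig.induct)
    case (trig_wave k' c' \<theta>')
    have e: "(c * cos ((2 * pi) *\<^sub>R k \<bullet> y + \<theta>)) * (c' * cos ((2 * pi) *\<^sub>R k' \<bullet> y + \<theta>'))
      = (c * c' / 2) * cos ((2 * pi) *\<^sub>R (k - k') \<bullet> y + (\<theta> - \<theta>'))
      + (c * c' / 2) * cos ((2 * pi) *\<^sub>R (k + k') \<bullet> y + (\<theta> + \<theta>'))" for y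
    proof -
      have "cos ((2 * pi) *\<^sub>R k \<bullet> y + \<theta>) * cos ((2 * pi) *\<^sub>R k' \<bullet> y + \<theta>')
        = (cos (((2 * pi) *\<^sub>R k \<bullet> y + \<theta>) - ((2 * pi) *\<^sub>R k' \<bullet> y + \<theta>'))
          + cos (((2 * pi) *\<^sub>R k \<bullet> y + \<theta>) + ((2 * pi) *\<^sub>R k' \<bullet> y + \<theta>'))) / 2"
        by (rule cos_times_cos)
      moreover have "((2 * pi) *\<^sub>R k \<bullet> y + \<theta>) - ((2 * pi) *\<^sub>R k' \<bullet> y + \<theta>') = (2 * pi) *\<^sub>R (k - k') \<bullet> y + (\<theta> - \<theta>')"
        "((2 * pi) *\<^sub>R k \<bullet> y + \<theta>) + ((2 * pi) *\<^sub>R k' \<bullet> y + \<theta>') = (2 * pi) *\<^sub>R (k + k') \<bullet> y + (\<theta> + \<theta>')"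
        by (simp_all add: inner_diff_left inner_add_left algebra_simps)
      ultimately show ?thesis by (simp add: field_simps)
    qed
    show ?case unfolding e
      by (intro trig_add trig.trig_wave int_lattice_add int_lattice_diff trig_wave \<open>k \<in> int_lattice\<close>)
  next
    case (trig_add P Q)
    then show ?case unfolding distrib_left by (intro trig.trig_add)
  qed
next
  case (trig_add P P')
  then show ?case unfolding distrib_right by (intro trig.trig_add)
qed

lemma trig0_continuous: "trig0 P \<Longrightarrow> continuous_on UNIV P"
  by (induction rule: trig0.induct) (auto intro!: continuous_intros)

lemma trig0_cmult: "trig0 P \<Longrightarrow> trig0 (\<lambda>y. c * P y)"
proof (induction rule: trig0.induct)
  case (trig0_wave k c' \<theta>)
  then show ?case using trig0.trig0_wave[of k "c * c'" \<theta>] by (simp add: mult.assoc)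
qed (auto simp: distrib_left intro: trig0.intros)

lemma trig0_diff: "trig0 P \<Longrightarrow> trig0 Q \<Longrightarrow> trig0 (\<lambda>y. P y - Q y)"
  using trig0_add[of P "\<lambda>y. (- 1) * Q y"] trig0_cmult[of Q "- 1"] by simp

lemma trig0_periodic: "trig0 P \<Longrightarrow> zperiodic P"
proof (induction rule: trig0.induct)
  case (trig0_wave k c \<theta>)
  show ?case unfolding zperiodic_def
  proof (intro allI ballI)
    fix y k' :: "real^'a" assume "k' \<in> int_lattice"
    with trig0_wave obtain n where n: "k \<bullet> k' = of_int n" using int_lattice_inner Ints_cases by metis
    have "(2 * pi) *\<^sub>R k \<bullet> (y + k') + \<theta> = ((2 * pi) *\<^sub>R k \<bullet> y + \<theta>) + 2 * pi * of_int n"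
      using n by (simp add: inner_add_right algebra_simps)
    moreover have "cos (t + 2 * pi * of_int n) = cos t" for t by (simp add: cos_add)
    ultimately show "c * cos ((2 * pi) *\<^sub>R k \<bullet> (y + k') + \<theta>) = c * cos ((2 * pi) *\<^sub>R k \<bullet> y + \<theta>)"
      by (simp only:)
  qed
qed (auto simp: zperiodic_def)

section \<open>Density of trigonometric polynomials\<close>

definition torus_map :: "real^'n \<Rightarrow> complex^'n" where
  "torus_map y = (\<chi> i. cis (2 * pi * y $ i))"

lemma torus_map_eqD:
  assumes "torus_map y = torus_map y'"
  shows "\<exists>k\<in>int_lattice. y' = y + k"
proof (intro bexI[of _ "y' - y"])
  show "y' - y \<in> int_lattice"
    unfolding int_lattice_def
  proof (intro CollectI allI)
    fix i
    have "cis (2 * pi * y' $ i) = cis (2 * pi * y $ i)"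
      using assms by (simp add: torus_map_def vec_eq_iff)
    then have "sin (2 * pi * y' $ i) = sin (2 * pi * y $ i) \<and> cos (2 * pi * y' $ i) = cos (2 * pi * y $ i)"
      by (simp add: complex_eq_iff)
    then obtain n :: int where "2 * pi * y' $ i = 2 * pi * y $ i + 2 * pi * n"
      unfolding sin_cos_eq_iff by blast
    then have "2 * pi * ((y' - y) $ i) = 2 * pi * real_of_int n" by (simp add: algebra_simps)
    then have "(y' - y) $ i = real_of_int n" by simp
    then show "(y' - y) $ i \<in> \<int>" by simp
  qed
qed simp

lemma continuous_on_torus_map: "continuous_on S torus_map"
  unfolding torus_map_def by (intro continuous_on_vec_lambda continuous_intros)

text \<open>\<open>b\<close> descends to a function \<open>F\<close> on the image of the cube under
  \<open>torus_map\<close>, a compact set on which the coordinate functions separate points.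
  Stone-Weierstrass applies to the ring of functions whose pullback is a trigonometric
  polynomial.\<close>

lemma trig_dense:
  fixes b :: "real^'n \<Rightarrow> real"
  assumes b: "continuous_on UNIV b" "zperiodic b" and \<delta>: "\<delta> > 0"
  shows "\<exists>P. trig P \<and> (\<forall>y\<in>unit_cube. \<bar>b y - P y\<bar> < \<delta>)"
proof -
  define S where "S = torus_map ` (unit_cube :: (real^'n) set)"
  define R where "R = {F. continuous_on S F \<and> (\<exists>P. trig P \<and> (\<forall>y\<in>unit_cube. F (torus_map y) = P (y :: real^'n)))}"
  define F where "F w = b (SOME y. y \<in> unit_cube \<and> torus_map y = w)" for w
  have Fb: "F (torus_map y) = b y" if "y \<in> unit_cube" for y
  proof -
    let ?y = "SOME y'. y' \<in> unit_cube \<and> torus_map y' = torus_map y"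
    have "?y \<in> unit_cube \<and> torus_map ?y = torus_map y"
      by (rule someI[of "\<lambda>y'. y' \<in> unit_cube \<and> torus_map y' = torus_map y"]) (use that in simp)
    then obtain k where "k \<in> int_lattice" "y = ?y + k" using torus_map_eqD by blast
    then have "b y = b ?y" using b(2) unfolding zperiodic_def by metis
    then show ?thesis by (simp add: F_def)
  qed
  have cS: "compact S" unfolding S_def
    by (rule compact_continuous_image[OF continuous_on_torus_map compact_unit_cube])
  have cF: "continuous_on S F"
    unfolding continuous_on_closed_vimage[OF compact_imp_closed[OF cS]]
  proof (intro allI impI)
    \<comment> \<open>The preimage of a closed set is the image of a compact part of the cube; thus
      \<open>F\<close> is continuous although representatives are chosen arbitrarily.\<close>
    fix C :: "real set" assume C: "closed C"
    have "F -` C \<inter> S = torus_map ` (unit_cube \<inter> b -` C)"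
      unfolding S_def using Fb by auto
    moreover have "closed (b -` C)" using b(1) C by (simp add: continuous_on_closed_vimage)
    then have "compact (unit_cube \<inter> b -` C)" by (intro compact_Int_closed compact_unit_cube)
    then have "compact (torus_map ` (unit_cube \<inter> b -` C))"
      by (rule compact_continuous_image[OF continuous_on_torus_map])
    ultimately show "closed (F -` C \<inter> S)" by (simp add: compact_imp_closed)
  qed
  have re: "(\<lambda>w. Re (w $ i)) \<in> R" and im: "(\<lambda>w. Im (w $ i)) \<in> R" for i
  proof -
    have "trig (\<lambda>y. 1 * cos ((2 * pi) *\<^sub>R axis i 1 \<bullet> y + 0) :: real)"
      "trig (\<lambda>y. 1 * cos ((2 * pi) *\<^sub>R axis i 1 \<bullet> y + (- pi / 2)) :: real)"
      by (rule trig_wave[OF int_lattice_axis])+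
    moreover have "(2 * pi) *\<^sub>R axis i 1 \<bullet> y = 2 * pi * y $ i" for y :: "real^'n"
      by (simp add: inner_axis')
    moreover have "cos (s + - pi / 2) = sin s" for s :: real by (simp add: cos_diff)
    ultimately have "trig (\<lambda>y::real^'n. cos (2 * pi * y $ i))" "trig (\<lambda>y::real^'n. sin (2 * pi * y $ i))"
      by simp_all
    then show "(\<lambda>w. Re (w $ i)) \<in> R" "(\<lambda>w. Im (w $ i)) \<in> R"
      unfolding R_def torus_map_def by (auto intro!: continuous_intros)
  qed
  interpret function_ring_on R S
  proof
    show "compact S" by (rule cS)
    show "continuous_on S f" if "f \<in> R" for f using that by (simp add: R_def)
    show "(\<lambda>x. f x + g x) \<in> R" if fg: "f \<in> R" "g \<in> R" for f g
    proof -
      obtain P Q where "trig P" "\<And>y :: real^'n. y \<in> unit_cube \<Longrightarrow> f (torus_map y) = P y"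
        "trig Q" "\<And>y :: real^'n. y \<in> unit_cube \<Longrightarrow> g (torus_map y) = Q y"
        using fg unfolding R_def by blast
      then have "\<exists>P. trig P \<and> (\<forall>y\<in>unit_cube. f (torus_map y) + g (torus_map y) = P y)"
        by (intro exI[of _ "\<lambda>y. P y + Q y"]) (auto intro: trig_add)
      then show ?thesis using fg unfolding R_def by (auto intro: continuous_on_add)
    qed
    show "(\<lambda>x. f x * g x) \<in> R" if fg: "f \<in> R" "g \<in> R" for f g
    proof -
      obtain P Q where "trig P" "\<And>y :: real^'n. y \<in> unit_cube \<Longrightarrow> f (torus_map y) = P y"
        "trig Q" "\<And>y :: real^'n. y \<in> unit_cube \<Longrightarrow> g (torus_map y) = Q y"
        using fg unfolding R_def by blast
      then have "\<exists>P. trig P \<and> (\<forall>y\<in>unit_cube. f (torus_map y) * g (torus_map y) = P y)"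
        by (intro exI[of _ "\<lambda>y. P y * Q y"]) (auto intro: trig_mult)
      then show ?thesis using fg unfolding R_def by (auto intro: continuous_on_mult)
    qed
    show "(\<lambda>_. c) \<in> R" for c unfolding R_def using trig_const[of c] by auto
    show "\<exists>f\<in>R. f v \<noteq> f w" if vw: "v \<in> S" "w \<in> S" "v \<noteq> w" for v w
    proof -
      obtain i where "v $ i \<noteq> w $ i" using vw(3) by (auto simp: vec_eq_iff)
      then have "Re (v $ i) \<noteq> Re (w $ i) \<or> Im (v $ i) \<noteq> Im (w $ i)" by (auto simp: complex_eq_iff)
      then show ?thesis
        by (elim disjE) (rule bexI[OF _ re[of i]], assumption, rule bexI[OF _ im[of i]], assumption)
    qed
  qed
  obtain g where g: "g \<in> R" "\<forall>x\<in>S. \<bar>F x - g x\<bar> < \<delta>"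
    using Stone_Weierstrass_basic[OF cF \<delta>] by blast
  then obtain P where P: "trig P" "\<forall>y\<in>unit_cube. g (torus_map y) = P y" unfolding R_def by blast
  have "\<bar>b y - P y\<bar> < \<delta>" if "y \<in> unit_cube" for y
    using g(2) P(2) Fb[OF that] that unfolding S_def by force
  with P show ?thesis by blast
qed

lemma trig0_dense:
  fixes b :: "real^'n \<Rightarrow> real"
  assumes b: "continuous_on UNIV b" "zperiodic b" and \<delta>: "\<delta> > 0"
  shows "\<exists>c P. trig0 P \<and> (\<forall>y. \<bar>b y - c - P y\<bar> \<le> \<delta>)"
proof -
  obtain Q where Q: "trig Q" "\<forall>y\<in>unit_cube. \<bar>b y - Q y\<bar> < \<delta>" using trig_dense[OF b \<delta>] by blast
  obtain c P where P: "trig0 P" "Q = (\<lambda>y. c + P y)" using trig_decompose[OF Q(1)] by blast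
  have "\<bar>b y - c - P y\<bar> \<le> \<delta>" for y
  proof -
    obtain k where k: "k \<in> int_lattice" "y + k \<in> unit_cube" by (rule reduce_to_unit_cube)
    have "b (y + k) = b y" "P (y + k) = P y"
      using b(2) trig0_periodic[OF P(1)] k(1) unfolding zperiodic_def by auto
    then show ?thesis using Q(2) k(2) P(2) by force
  qed
  with P show ?thesis by blast
qed

text \<open>Without a maximum, the open sets where \<open>v\<close> is below one of its values would
  cover the cube; the point with the largest value in a finite subcover lies in none of its
  members.\<close>

lemma usc_attains_sup_periodic:
  fixes v :: "real^'n \<Rightarrow> real"
  assumes "usc v" "zperiodic v"
  shows "\<exists>y\<in>unit_cube. \<forall>y'. v y' \<le> v y"
proof -
  have "\<exists>y\<in>unit_cube. \<forall>y'\<in>unit_cube. v y' \<le> v y"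
  proof (rule ccontr)
    assume "\<not> ?thesis"
    then have cov: "unit_cube \<subseteq> (\<Union>y\<in>unit_cube. {x. v x < v y})" by (force simp: not_le)
    have op: "open {x. v x < v y}" for y using assms(1) unfolding usc_def by blast
    obtain Y where Y: "Y \<subseteq> unit_cube" "finite Y" "unit_cube \<subseteq> (\<Union>y\<in>Y. {x. v x < v y})"
      using compactE_image[OF compact_unit_cube op cov] by metis
    have "Y \<noteq> {}" using Y(3) zero_in_unit_cube by auto
    then have mx: "Max (v ` Y) \<in> v ` Y" using Y(2) by (intro Max_in) auto
    then obtain y0 where y0: "y0 \<in> Y" "v y0 = Max (v ` Y)" by auto
    then obtain y where "y \<in> Y" "v y0 < v y" using Y by blast
    moreover have "v y \<le> Max (v ` Y)" using \<open>y \<in> Y\<close> Y(2) by (intro Max_ge) auto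
    ultimately show False using y0(2) by simp
  qed
  then obtain y where y: "y \<in> unit_cube" "\<And>y'. y' \<in> unit_cube \<Longrightarrow> v y' \<le> v y" by blast
  have "v y' \<le> v y" for y'
  proof -
    obtain k where "k \<in> int_lattice" "y' + k \<in> unit_cube" by (rule reduce_to_unit_cube)
    then show ?thesis using y(2)[of "y' + k"] assms(2) unfolding zperiodic_def by auto
  qed
  with y show ?thesis by blast
qed

lemma usc_diff_continuous:
  fixes v w :: "'a::topological_space \<Rightarrow> real"
  assumes "usc v" "continuous_on UNIV w"
  shows "usc (\<lambda>x. v x - w x)"
  unfolding usc_def
proof (intro allI)
  fix c
  have "{x. v x - w x < c} = (\<Union>r. {x. v x < r} \<inter> {x. r - c < w x})"
  proof (intro set_eqI iffI)
    fix x assume "x \<in> {x. v x - w x < c}"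
    then have "v x < (v x + (w x + c)) / 2" "(v x + (w x + c)) / 2 - c < w x" by (auto simp: field_simps)
    then show "x \<in> (\<Union>r. {x. v x < r} \<inter> {x. r - c < w x})" by blast
  qed auto
  moreover have "open {x. v x < r}" for r using assms(1) unfolding usc_def by blast
  moreover have "open {x. r - c < w x}" for r
    by (intro open_Collect_less continuous_intros assms(2))
  ultimately show "open {x. v x - w x < c}" by (simp only:) (intro open_UN ballI open_Int)
qed

section \<open>Positivity of the symbol at lattice frequencies\<close>

context levy
begin

text \<open>If the symbol vanished at \<open>(2 * pi) *\<^sub>R k\<close>, then
  \<open>k \<bullet> \<beta> z\<close> would be an integer for almost every jump. Each step of a
  chain in condition (B) is approximated by jumps, so it would change \<open>k \<bullet> y\<close>
  by an integer, and \<open>k \<bullet> y\<close> modulo 1 would be constant on the torus, which is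
  false for \<open>k \<noteq> 0\<close>.\<close>

lemma char_exp_real_pos:
  assumes B: "condB q \<beta>" and k: "k \<in> int_lattice" "k \<noteq> 0"
  shows "char_exp_real q \<beta> ((2 * pi) *\<^sub>R k) > 0"
proof (rule ccontr)
  assume "\<not> ?thesis"
  moreover have "0 \<le> char_exp_real q \<beta> ((2 * pi) *\<^sub>R k)"
    unfolding char_exp_real_def by (intro Bochner_Integration.integral_nonneg) simp
  ultimately have "(\<integral>z. 1 - cos ((2 * pi) *\<^sub>R k \<bullet> \<beta> z) \<partial>(dens q)) = 0"
    unfolding char_exp_real_def by linarith
  then have ae: "AE z in dens q. 1 - cos ((2 * pi) *\<^sub>R k \<bullet> \<beta> z) = 0"
    by (subst (asm) integral_nonneg_eq_0_iff_AE[OF integrable_one_minus_cos]) auto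
  have hit: "\<exists>z\<in>J. k \<bullet> \<beta> z \<in> \<int>" if J: "J \<in> sets lborel" "emeasure (dens q) J > 0" for J
  proof (rule ccontr)
    assume no: "\<not> ?thesis"
    have "AE z in dens q. z \<notin> J"
      using ae
    proof eventually_elim
      case (elim z)
      then obtain n :: int where "(2 * pi) *\<^sub>R k \<bullet> \<beta> z = of_int n * 2 * pi"
        using cos_one_2pi_int[of "(2 * pi) *\<^sub>R k \<bullet> \<beta> z"] by auto
      then have "k \<bullet> \<beta> z = of_int n" by simp
      then show ?case using no by auto
    qed
    then have "emeasure (dens q) J = 0"
      using J(1) by (subst (asm) AE_iff_measurable[of J]) auto
    then show False using J(2) by simp
  qed
  obtain j where j: "k $ j \<noteq> 0" using k(2) by (auto simp: vec_eq_iff)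
  have "k $ j \<in> \<int>" using k(1) by (simp add: int_lattice_def)
  then have "\<bar>k $ j\<bar> \<ge> 1" using j Ints_nonzero_abs_ge1 by blast
  \<comment> \<open>On the axis of a nonzero entry of \<open>k\<close>, at distance
    \<open>1 / (2 * \<bar>k $ j\<bar>)\<close> from 0: it lies in the cube, and
    \<open>k \<bullet> y'\<close> is 1/2 or -1/2.\<close>
  define y' where "y' = (axis j (1 / (2 * k $ j * sgn (k $ j))) :: real^'n)"
  have ss: "k $ j * sgn (k $ j) = \<bar>k $ j\<bar>" by (simp add: abs_sgn)
  have "0 \<le> 1 / (2 * \<bar>k $ j\<bar>)" "1 / (2 * \<bar>k $ j\<bar>) \<le> 1" using \<open>\<bar>k $ j\<bar> \<ge> 1\<close> by simp_all
  then have y'c: "y' \<in> unit_cube"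
    unfolding y'_def unit_cube_def mult.assoc ss by (auto simp: axis_def)
  have ky': "k \<bullet> y' = sgn (k $ j) / 2"
    unfolding y'_def mult.assoc ss using j by (simp add: inner_axis sgn_if)
  obtain m :: nat and ys where ys: "m \<ge> 1" "ys 1 = 0" "ys m = y'"
    "\<And>i e. i \<in> {1..<m} \<Longrightarrow> e > 0 \<Longrightarrow> \<exists>J. J \<in> sets lborel \<and> J \<subseteq> msupp (dens q) \<and>
        (\<forall>z\<in>J. \<exists>k\<in>int_lattice. dist (ys i + \<beta> z + k) (ys (Suc i)) < e) \<and> emeasure (dens q) J > 0"
    using B zero_in_unit_cube y'c unfolding condB_def by metis
  \<comment> \<open>Condition (B) gives only approximate hits, but for every tolerance; since the
    integers are closed, the exact increment is an integer.\<close>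
  have step: "k \<bullet> (ys (Suc i) - ys i) \<in> \<int>" if i: "i \<in> {1..<m}" for i
  proof -
    have "k \<bullet> (ys (Suc i) - ys i) \<in> closure \<int>"
      unfolding closure_approachable
    proof (intro allI impI)
      fix e :: real assume e: "e > 0"
      have nk: "norm k > 0" using k(2) by simp
      then have "e / norm k > 0" using e by simp
      from ys(4)[OF i this] obtain J where J: "J \<in> sets lborel"
        "\<forall>z\<in>J. \<exists>k'\<in>int_lattice. dist (ys i + \<beta> z + k') (ys (Suc i)) < e / norm k" "emeasure (dens q) J > 0"
        by blast
      obtain z where z: "z \<in> J" "k \<bullet> \<beta> z \<in> \<int>" using hit[OF J(1,3)] by blast
      obtain l where l: "l \<in> int_lattice" "dist (ys i + \<beta> z + l) (ys (Suc i)) < e / norm k" using bspec[OF J(2) z(1)] by blast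
      have "\<bar>k \<bullet> ((ys i + \<beta> z + l) - ys (Suc i))\<bar> \<le> norm k * norm ((ys i + \<beta> z + l) - ys (Suc i))"
        by (rule Cauchy_Schwarz_ineq2)
      also have "\<dots> < e" using l(2) nk by (simp add: dist_norm field_simps)
      finally have "dist (k \<bullet> \<beta> z + k \<bullet> l) (k \<bullet> (ys (Suc i) - ys i)) < e"
        by (simp add: dist_real_def inner_diff_right inner_add_right algebra_simps)
      moreover have "k \<bullet> \<beta> z + k \<bullet> l \<in> \<int>" using z(2) int_lattice_inner[OF k(1) l(1)] by simp
      ultimately show "\<exists>y\<in>\<int>. dist y (k \<bullet> (ys (Suc i) - ys i)) < e" by blast
    qed
    then show ?thesis by simp
  qed
  have "k \<bullet> ys (Suc i) \<in> \<int>" if "Suc i \<le> m" for i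
    using that
  proof (induction i)
    case 0 then show ?case using ys(2) by simp
  next
    case (Suc i)
    then have "k \<bullet> ys (Suc i) \<in> \<int>" "k \<bullet> (ys (Suc (Suc i)) - ys (Suc i)) \<in> \<int>" using step[of "Suc i"] by auto
    then have "k \<bullet> ys (Suc i) + k \<bullet> (ys (Suc (Suc i)) - ys (Suc i)) \<in> \<int>" by (rule Ints_add)
    then show ?case by (simp add: inner_diff_right)
  qed
  from this[of "m - 1"] have "sgn (k $ j) / 2 \<in> \<int>" using ys(1,3) ky' by simp
  then obtain n :: int where "sgn (k $ j) / 2 = of_int n" by (auto elim: Ints_cases)
  then have "real_of_int (2 * n) = 1 \<or> real_of_int (2 * n) = - 1" using j by (auto simp: sgn_if split: if_splits)
  then have "2 * n = 1 \<or> 2 * n = - 1" by linarith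
  then show False by presburger
qed

end

section \<open>Means and the effective constant\<close>

text \<open>The mean over the torus, expressed without integration: this is the form in which
  correctors can use it, since they exist precisely for the waves of nonzero frequency.\<close>

definition is_mean :: "(real^'n \<Rightarrow> real) \<Rightarrow> real \<Rightarrow> bool" where
  "is_mean b c \<longleftrightarrow> (\<forall>\<delta>>0. \<exists>P. trig0 P \<and> (\<forall>y. \<bar>b y - c - P y\<bar> \<le> \<delta>))"

lemma smooth_with_max_zero:
  assumes "smooth_with v g" "\<And>y'. v y' \<le> v y"
  shows "g y = 0"
proof -
  have D: "(v has_derivative (\<lambda>h. h \<bullet> g y)) (at y)"
    using smooth_with_GDERIV[OF assms(1)] unfolding gderiv_def .
  have "(\<lambda>h. h \<bullet> g y) = (\<lambda>h. 0)"
    by (rule differential_zero_maxmin[OF UNIV_I open_UNIV D]) (use assms(2) in auto)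
  then have "g y \<bullet> g y = 0" by meson
  then show ?thesis by simp
qed

lemma GDERIV_touch_eq:
  assumes "GDERIV v y :> g" "GDERIV \<psi> y :> p" "(\<forall>y'. v y' - \<psi> y' \<le> v y - \<psi> y) \<or> (\<forall>y'. v y' - \<psi> y' \<ge> v y - \<psi> y)"
  shows "p = g"
proof -
  have D: "((\<lambda>y. v y - \<psi> y) has_derivative (\<lambda>h. h \<bullet> (g - p))) (at y)"
    using GDERIV_diff[OF assms(1,2)] unfolding gderiv_def .
  have "(\<lambda>h. h \<bullet> (g - p)) = (\<lambda>h. 0)"
    by (rule differential_zero_maxmin[OF UNIV_I open_UNIV D]) (use assms(3) in auto)
  then have "(g - p) \<bullet> (g - p) = 0" by meson
  then show ?thesis by simp
qed

definition symbol_diverges :: "(real^'m \<Rightarrow> real) \<Rightarrow> (real^'m \<Rightarrow> real^'n) \<Rightarrow> bool" where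
  "symbol_diverges q \<beta> \<longleftrightarrow> (\<forall>k\<in>int_lattice. k \<noteq> 0 \<longrightarrow> (\<forall>C.
     eventually (\<lambda>\<epsilon>. C \<le> char_exp_real q \<beta> (((2 * pi) *\<^sub>R k) /\<^sub>R \<epsilon>)) (at_right 0)))"

context levy
begin

text \<open>For the cell problem at a fixed scale: no smallness is claimed, but the corrector is
  itself a trigonometric polynomial and hence periodic.\<close>

lemma trig0_corrector:
  fixes T :: "real^'m \<Rightarrow> bool"
  assumes T: "Measurable.pred borel T" "\<And>z. norm z \<le> 1 \<Longrightarrow> T z"
    and pos: "\<And>k. k \<in> int_lattice \<Longrightarrow> k \<noteq> 0 \<Longrightarrow> char_exp_real q \<beta> ((2 * pi) *\<^sub>R k) > 0"
    and P: "trig0 P"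
  shows "\<exists>\<delta> v g. corrects T q \<beta> \<delta> P v g \<and> trig0 v"
  using P
proof (induction rule: trig0.induct)
  case trig0_zero
  then show ?case using corrects_zero trig0.trig0_zero by blast
next
  case (trig0_wave k c \<theta>)
  obtain c' \<eta> g where "corrects T q \<beta> (2 / char_exp_real q \<beta> ((2 * pi) *\<^sub>R k))
      (\<lambda>x. cos ((2 * pi) *\<^sub>R k \<bullet> x + \<theta>)) (\<lambda>y. c' * cos ((2 * pi) *\<^sub>R k \<bullet> y + \<eta>)) g"
    using wave_corrector[OF T pos[OF trig0_wave]] by blast
  from corrects_cmult[OF this, of c] show ?case
    using trig0_cmult[OF trig0.trig0_wave[OF trig0_wave, of c' \<eta>], of c] by blast
next
  case (trig0_add P Q)
  then obtain \<delta> v g \<delta>' w h where *: "corrects T q \<beta> \<delta> P v g" "trig0 v" "corrects T q \<beta> \<delta>' Q w h" "trig0 w"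
    by blast
  then show ?case
    using corrects_add[OF *(1,3) \<beta>_cont] trig0.trig0_add[OF *(2,4)] by blast
qed

text \<open>A wave of frequency \<open>2 * pi * k / \<epsilon>\<close> has a corrector bounded by 2
  over the symbol there, which tends to 0; finitely many waves are added up.\<close>

lemma eventually_trig0_corrector:
  fixes T :: "real^'m \<Rightarrow> bool"
  assumes T: "Measurable.pred borel T" "\<And>z. norm z \<le> 1 \<Longrightarrow> T z"
    and lim: "symbol_diverges q \<beta>"
    and P: "trig0 P" and \<delta>: "\<delta> > 0"
  shows "eventually (\<lambda>\<epsilon>. \<exists>v g. corrects T q \<beta> \<delta> (\<lambda>x. P (x /\<^sub>R \<epsilon>)) v g) (at_right 0)"
  using P \<delta>
proof (induction arbitrary: \<delta> rule: trig0.induct)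
  case trig0_zero
  then show ?case using corrects_mono[OF corrects_zero, of \<delta> T q \<beta>] by (auto intro!: always_eventually)
next
  case (trig0_wave k c \<theta>)
  let ?m = "\<bar>c\<bar> + c\<^sup>2"
  \<comment> \<open>Yields \<open>?m * (2 / ?E) \<le> \<delta>\<close> once the symbol exceeds it;
    the summand 1 keeps it positive for \<open>c = 0\<close>.\<close>
  let ?C = "2 * ?m / \<delta> + 1"
  have C: "?C > 0" using trig0_wave by (intro add_nonneg_pos) auto
  have "eventually (\<lambda>\<epsilon>. ?C \<le> char_exp_real q \<beta> (((2 * pi) *\<^sub>R k) /\<^sub>R \<epsilon>)) (at_right 0)"
    using lim trig0_wave(1,2) unfolding symbol_diverges_def by blast
  then show ?case
  proof eventually_elim
    case (elim \<epsilon>)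
    let ?E = "char_exp_real q \<beta> (((2 * pi) *\<^sub>R k) /\<^sub>R \<epsilon>)"
    have E: "?E > 0" using C elim by linarith
    obtain c' \<eta> g where "corrects T q \<beta> (2 / ?E)
        (\<lambda>x. cos ((((2 * pi) *\<^sub>R k) /\<^sub>R \<epsilon>) \<bullet> x + \<theta>)) (\<lambda>y. c' * cos ((((2 * pi) *\<^sub>R k) /\<^sub>R \<epsilon>) \<bullet> y + \<eta>)) g"
      using wave_corrector[OF T E] by blast
    note c = corrects_cmult[OF this, of c]
    have "2 * ?m / \<delta> \<le> ?E" using elim by linarith
    then have "?m * (2 / ?E) \<le> \<delta>" using trig0_wave(3) E by (simp add: field_simps)
    note d = corrects_mono[OF c this]
    have e: "(((2 * pi) *\<^sub>R k) /\<^sub>R \<epsilon>) \<bullet> x = (2 * pi) *\<^sub>R k \<bullet> (x /\<^sub>R \<epsilon>)" for x by simp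
    show ?case using d unfolding e by blast
  qed
next
  case (trig0_add P Q)
  \<comment> \<open>Quarters, because \<open>corrects_add\<close> doubles the sum of the two
    bounds.\<close>
  have "\<delta> / 4 > 0" using trig0_add by simp
  from trig0_add(3)[OF this] trig0_add(4)[OF this] show ?case
  proof eventually_elim
    case (elim \<epsilon>)
    then obtain v g w h where "corrects T q \<beta> (\<delta> / 4) (\<lambda>x. P (x /\<^sub>R \<epsilon>)) v g"
      "corrects T q \<beta> (\<delta> / 4) (\<lambda>x. Q (x /\<^sub>R \<epsilon>)) w h" by blast
    from corrects_add[OF this \<beta>_cont] show ?case by auto
  qed
qed

text \<open>At a maximum of the periodic corrector of \<open>P\<close> the gradient vanishes and no
  jump increases the corrector, so the operator, whose value there is \<open>P\<close>, is
  nonpositive.\<close>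

lemma trig0_exists_nonpos:
  fixes P :: "real^'n \<Rightarrow> real"
  assumes B: "condB q \<beta>" and P: "trig0 P"
  shows "\<exists>y. P y \<le> 0"
proof -
  have "\<exists>\<delta> v g. corrects (\<lambda>_. True) q \<beta> \<delta> P v g \<and> trig0 v"
    by (rule trig0_corrector[OF _ _ char_exp_real_pos[OF B] P]) auto
  then obtain \<delta> v g where v: "corrects (\<lambda>_. True) q \<beta> \<delta> P v g" "trig0 v" by blast
  have "usc v" using continuous_imp_usc_lsc trig0_continuous[OF v(2)] by blast
  then obtain y where y: "\<And>y'. v y' \<le> v y"
    using usc_attains_sup_periodic trig0_periodic[OF v(2)] by blast
  have g0: "g y = 0" using smooth_with_max_zero v(1) y unfolding corrects_def by blast
  have "integrable (dens q) (tjump (\<lambda>_. True) \<beta> v y (g y))" using v(1) unfolding corrects_def by blast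
  then have "(\<integral>z. tjump (\<lambda>_. True) \<beta> v y (g y) z \<partial>(dens q)) \<le> (\<integral>z. 0 \<partial>(dens q))"
    by (rule integral_mono) (use y g0 in \<open>simp_all add: tjump_def\<close>)
  then have "P y \<le> 0" using v(1) unfolding corrects_def by simp
  then show ?thesis ..
qed

text \<open>Both \<open>P\<close> and \<open>- P\<close> take a nonpositive value, so adding
  \<open>P\<close> cannot bring \<open>\<bar>c + P y\<bar>\<close> below
  \<open>\<bar>c\<bar>\<close> everywhere. This does the work of the orthogonality of waves to
  constants.\<close>

lemma trig0_shift_le:
  fixes P :: "real^'n \<Rightarrow> real"
  assumes B: "condB q \<beta>" and P: "trig0 P" and le: "\<And>y. \<bar>c + P y\<bar> \<le> \<delta>"
  shows "\<bar>c\<bar> \<le> \<delta>"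
proof -
  obtain y where "P y \<le> 0" using trig0_exists_nonpos[OF B P] by blast
  moreover obtain y' where "- 1 * P y' \<le> 0" using trig0_exists_nonpos[OF B trig0_cmult[OF P, of "- 1"]] by blast
  ultimately show ?thesis using le[of y] le[of y'] by linarith
qed

text \<open>By \<open>trig0_shift_le\<close> the constants of approximations with error
  \<open>1 / (n + 1)\<close> form a Cauchy sequence; its limit is the mean.\<close>

lemma is_mean_exists:
  fixes b :: "real^'n \<Rightarrow> real"
  assumes B: "condB q \<beta>" and b: "continuous_on UNIV b" "zperiodic b"
  shows "\<exists>c. is_mean b c"
proof -
  have "\<forall>n. \<exists>c P. trig0 P \<and> (\<forall>y. \<bar>b y - c - P y\<bar> \<le> inverse (real (Suc n)))"
    by (intro allI trig0_dense[OF b]) simp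
  then obtain c P where P: "\<And>n. trig0 (P n)" "\<And>n y. \<bar>b y - c n - P n y\<bar> \<le> inverse (real (Suc n))" by metis
  have cc: "\<bar>c n - c m\<bar> \<le> inverse (real (Suc n)) + inverse (real (Suc m))" for n m
  proof (rule trig0_shift_le[OF B trig0_diff[OF P(1)[of n] P(1)[of m]]])
    show "\<bar>c n - c m + (P n y - P m y)\<bar> \<le> inverse (real (Suc n)) + inverse (real (Suc m))" for y
      using P(2)[of y n] P(2)[of y m] by linarith
  qed
  have inv: "(\<lambda>n. inverse (real (Suc n))) \<longlonglongrightarrow> 0" by (rule LIMSEQ_inverse_real_of_nat)
  have "Cauchy c"
  proof (rule metric_CauchyI)
    fix e :: real assume "e > 0"
    then have "e / 2 > 0" by simp
    from order_tendstoD(2)[OF inv this] obtain N where N: "\<And>n. n \<ge> N \<Longrightarrow> inverse (real (Suc n)) < e / 2"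
      unfolding eventually_sequentially by blast
    have "dist (c m) (c n) < e" if "m \<ge> N" "n \<ge> N" for m n
      using cc[of m n] N[OF that(1)] N[OF that(2)] unfolding dist_real_def by linarith
    then show "\<exists>M. \<forall>m\<ge>M. \<forall>n\<ge>M. dist (c m) (c n) < e" by blast
  qed
  then obtain c0 where c0: "c \<longlonglongrightarrow> c0" using convergent_eq_Cauchy by blast
  have cn: "\<bar>c n - c0\<bar> \<le> inverse (real (Suc n))" for n
  proof (rule LIMSEQ_le)
    show "(\<lambda>m. \<bar>c n - c m\<bar>) \<longlonglongrightarrow> \<bar>c n - c0\<bar>" by (intro tendsto_intros c0)
    show "(\<lambda>m. inverse (real (Suc n)) + inverse (real (Suc m))) \<longlonglongrightarrow> inverse (real (Suc n))"
      using tendsto_add[OF tendsto_const inv] by simp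
  qed (use cc in blast)
  have "is_mean b c0"
    unfolding is_mean_def
  proof (intro allI impI)
    fix \<delta> :: real assume "\<delta> > 0"
    then have "\<delta> / 2 > 0" by simp
    from order_tendstoD(2)[OF inv this] obtain n where n: "inverse (real (Suc n)) < \<delta> / 2"
      unfolding eventually_sequentially by blast
    have "\<bar>b y - c0 - P n y\<bar> \<le> \<delta>" for y using P(2)[of y n] cn[of n] n by linarith
    then show "\<exists>P. trig0 P \<and> (\<forall>y. \<bar>b y - c0 - P y\<bar> \<le> \<delta>)" using P(1) by blast
  qed
  then show ?thesis ..
qed

lemma is_mean_pos:
  fixes b :: "real^'n \<Rightarrow> real"
  assumes B: "condB q \<beta>" and b: "is_mean b c" "\<And>y. b y \<ge> b0" "b0 > 0"
  shows "c > 0"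
proof -
  have "b0 / 2 > 0" using b(3) by simp
  then obtain P where P: "trig0 P" "\<And>y. \<bar>b y - c - P y\<bar> \<le> b0 / 2" using b(1) unfolding is_mean_def by blast
  obtain y where "P y \<le> 0" using trig0_exists_nonpos[OF B P(1)] by blast
  then show ?thesis using P(2)[of y] b(2)[of y] b(3) by linarith
qed

text \<open>\<open>v\<close> is the corrector of \<open>d * P - Q\<close>, the approximate mean-free
  part of the divided equation; the constant part cancels because \<open>d * K = I + F\<close>,
  which is what determines \<open>d\<close>.\<close>

lemma approximate_cell_solution:
  assumes B: "condB q \<beta>" and a: "\<And>y. a y > 0" "\<And>y. a y \<le> a1"
    and K: "is_mean (\<lambda>y. inverse (a y)) K" "K > 0" and F: "is_mean (\<lambda>y. f y / a y) F" and \<delta>: "\<delta> > 0"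
  obtains v g where "smooth_with v g" "trig0 v" "\<And>y. integrable (dens q) (jump0 \<beta> v y (g y))"
    "\<And>y. \<bar>(I + F) / K - a y * (\<integral>z. jump0 \<beta> v y (g y) z \<partial>(dens q)) - a y * I - f y\<bar> \<le> \<delta>"
proof -
  define d where "d = (I + F) / K"
  have a1: "a1 > 0" using a[of 0] by linarith
  \<comment> \<open>Makes the bound \<open>a1 * ((\<bar>d\<bar> + 1) * \<eta>)\<close> of the
    residual equal to \<open>\<delta>\<close>.\<close>
  define \<eta> where "\<eta> = \<delta> / (a1 * (\<bar>d\<bar> + 1))"
  have \<eta>: "\<eta> > 0" unfolding \<eta>_def using \<delta> a1 by (intro divide_pos_pos mult_pos_pos) auto
  obtain P where P: "trig0 P" "\<And>y. \<bar>inverse (a y) - K - P y\<bar> \<le> \<eta>" using K \<eta> unfolding is_mean_def by blast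
  obtain Q where Q: "trig0 Q" "\<And>y. \<bar>f y / a y - F - Q y\<bar> \<le> \<eta>" using F \<eta> unfolding is_mean_def by blast
  have "trig0 (\<lambda>y. d * P y - Q y)" by (intro trig0_diff trig0_cmult P Q)
  then have "\<exists>\<delta> v g. corrects (\<lambda>_. True) q \<beta> \<delta> (\<lambda>y. d * P y - Q y) v g \<and> trig0 v"
    by (intro trig0_corrector char_exp_real_pos[OF B]) auto
  then obtain \<delta>' v g where v: "corrects (\<lambda>_. True) q \<beta> \<delta>' (\<lambda>y. d * P y - Q y) v g" "trig0 v" by blast
  have "\<bar>d - a y * (\<integral>z. jump0 \<beta> v y (g y) z \<partial>(dens q)) - a y * I - f y\<bar> \<le> \<delta>" for y
  proof -
    have "(\<integral>z. jump0 \<beta> v y (g y) z \<partial>(dens q)) = d * P y - Q y"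
      using v(1) unfolding corrects_def jump0_eq_tjump by blast
    moreover have "d * K = I + F" using K(2) by (simp add: d_def)
    moreover have "a y * inverse (a y) = 1" "a y * (f y / a y) = f y" using a(1)[of y] by simp_all
    ultimately have "d - a y * (\<integral>z. jump0 \<beta> v y (g y) z \<partial>(dens q)) - a y * I - f y
      = a y * (d * (inverse (a y) - K - P y) - (f y / a y - F - Q y))"
      by algebra
    also have "\<bar>\<dots>\<bar> \<le> a1 * ((\<bar>d\<bar> + 1) * \<eta>)"
    proof -
      have "\<bar>d * (inverse (a y) - K - P y)\<bar> \<le> \<bar>d\<bar> * \<eta>"
        unfolding abs_mult by (rule mult_left_mono[OF P(2)]) simp
      then have "\<bar>d * (inverse (a y) - K - P y) - (f y / a y - F - Q y)\<bar> \<le> (\<bar>d\<bar> + 1) * \<eta>"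
        using Q(2)[of y] unfolding distrib_right by linarith
      then show ?thesis
        unfolding abs_mult using a[of y] a1 by (intro mult_mono) auto
    qed
    also have "\<dots> = \<delta>" unfolding \<eta>_def using a1 by (simp add: field_simps add_nonneg_eq_0_iff)
    finally show ?thesis .
  qed
  then show ?thesis
    using that[of v g] v unfolding corrects_def jump0_eq_tjump d_def by blast
qed

text \<open>A test function touching the smooth \<open>v\<close> has the same gradient, and the
  inequalities see nothing else of it.\<close>

lemma cell_approximate_solution:
  assumes v: "smooth_with v g" "zperiodic v" "\<And>y. integrable (dens q) (jump0 \<beta> v y (g y))"
    and le: "\<And>y. \<bar>d - a y * (\<integral>z. jump0 \<beta> v y (g y) z \<partial>(dens q)) - a y * I - f y\<bar> \<le> \<delta>"
  shows "cell_sub q \<beta> a f I d \<delta> v" "cell_super q \<beta> a f I d \<delta> v"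
proof -
  have cont: "usc v" "lsc v" using smooth_with_continuous[OF v(1)] continuous_imp_usc_lsc by blast+
  have gr: "grad \<psi> y = g y" if "C2 \<psi>" "(\<forall>y'. v y' - \<psi> y' \<le> v y - \<psi> y) \<or> (\<forall>y'. v y' - \<psi> y' \<ge> v y - \<psi> y)" for \<psi> y
    using GDERIV_touch_eq[OF smooth_with_GDERIV[OF v(1)] C2_GDERIV[OF that(1)] that(2)] .
  have est: "d - a y * (\<integral>z. jump0 \<beta> v y (g y) z \<partial>(dens q)) - a y * I - f y \<le> \<delta>"
    "d - a y * (\<integral>z. jump0 \<beta> v y (g y) z \<partial>(dens q)) - a y * I - f y \<ge> - \<delta>" for y
    using le[of y] by linarith+
  show "cell_sub q \<beta> a f I d \<delta> v" unfolding cell_sub_def using cont(1) v(2,3) gr est by metis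
  show "cell_super q \<beta> a f I d \<delta> v" unfolding cell_super_def using cont(2) v(2,3) gr est by metis
qed

text \<open>Against a smooth supersolution no doubling of variables is involved: at a maximum of
  \<open>w - v\<close> the paraboloid with slope \<open>g y\<close> and the Taylor constant of
  \<open>v\<close> touches \<open>w\<close> from above, and the jumps of \<open>w\<close> lie below
  those of \<open>v\<close>.\<close>

lemma cell_sub_le:
  assumes sub: "cell_sub q \<beta> a f I d \<delta> w" and a: "\<And>y. a y > 0"
    and v: "smooth_with v g" "zperiodic v" "\<And>y. integrable (dens q) (jump0 \<beta> v y (g y))"
    and ge: "\<And>y. d' - a y * (\<integral>z. jump0 \<beta> v y (g y) z \<partial>(dens q)) - a y * I - f y \<ge> - \<delta>"
  shows "d \<le> d' + 2 * \<delta>"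
proof -
  have w: "usc w" "zperiodic w" using sub unfolding cell_sub_def by auto
  have "usc (\<lambda>x. w x - v x)" by (rule usc_diff_continuous[OF w(1) smooth_with_continuous[OF v(1)]])
  moreover have "zperiodic (\<lambda>x. w x - v x)" using w(2) v(2) unfolding zperiodic_def by simp
  ultimately obtain y where y: "y \<in> unit_cube" "\<And>y'. w y' - v y' \<le> w y - v y"
    using usc_attains_sup_periodic by blast
  obtain C where C: "\<And>x h. \<bar>v (x + h) - v x - g x \<bullet> h\<bar> \<le> C * (norm h)\<^sup>2"
    using v(1) unfolding smooth_with_def by blast
  let ?\<psi> = "\<lambda>y'. w y + g y \<bullet> (y' - y) + C * (norm (y' - y))\<^sup>2"
  have "w y' - ?\<psi> y' \<le> w y - ?\<psi> y" for y'
    using y(2)[of y'] C[of y "y' - y"] by (simp add: abs_le_iff)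
  then have "C2 ?\<psi> \<and> (\<forall>y'. w y' - ?\<psi> y' \<le> w y - ?\<psi> y) \<and> w y = ?\<psi> y"
    using C2_quadratic[of "w y" "g y" y C] by simp
  then have "integrable (dens q) (jump0 \<beta> w y (grad ?\<psi> y)) \<and>
      d - a y * (\<integral>z. jump0 \<beta> w y (grad ?\<psi> y) z \<partial>(dens q)) - a y * I - f y \<le> \<delta>"
    using sub[unfolded cell_sub_def, THEN conjunct2, THEN conjunct2, THEN bspec[OF _ y(1)], THEN spec[of _ ?\<psi>]]
    by (rule rev_mp)
  then have *: "integrable (dens q) (jump0 \<beta> w y (g y))"
      "d - a y * (\<integral>z. jump0 \<beta> w y (g y) z \<partial>(dens q)) - a y * I - f y \<le> \<delta>"
    unfolding grad_quadratic by blast+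
  have "(\<integral>z. jump0 \<beta> w y (g y) z \<partial>(dens q)) \<le> (\<integral>z. jump0 \<beta> v y (g y) z \<partial>(dens q))"
  proof (rule integral_mono[OF *(1) v(3)])
    show "jump0 \<beta> w y (g y) z \<le> jump0 \<beta> v y (g y) z" for z
      using y(2)[of "y + \<beta> z"] by (simp add: jump0_def)
  qed
  then have "a y * (\<integral>z. jump0 \<beta> w y (g y) z \<partial>(dens q)) \<le> a y * (\<integral>z. jump0 \<beta> v y (g y) z \<partial>(dens q))"
    using a[of y] by (intro mult_left_mono) auto
  then show ?thesis using *(2) ge[of y] by linarith
qed

lemma jump0_uminus: "jump0 \<beta> (\<lambda>x. - u x) x (- p) = (\<lambda>z. - jump0 \<beta> u x p z)"
  by (auto simp: jump0_def fun_eq_iff)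

lemma cell_super_uminus:
  assumes sup: "cell_super q \<beta> a f I d \<delta> w"
  shows "cell_sub q \<beta> a (\<lambda>y. - f y) (- I) (- d) \<delta> (\<lambda>y. - w y)"
  unfolding cell_sub_def
proof (intro conjI ballI allI impI)
  have w: "lsc w" "zperiodic w" using sup unfolding cell_super_def by auto
  show "usc (\<lambda>y. - w y)" unfolding usc_def
  proof (intro allI)
    fix c
    have "{x. - w x < c} = {x. w x > - c}" by auto
    then show "open {x. - w x < c}" using w(1) unfolding lsc_def by metis
  qed
  show "zperiodic (\<lambda>y. - w y)" using w(2) unfolding zperiodic_def by simp
  fix y \<psi> assume y: "y \<in> unit_cube" and t: "C2 \<psi> \<and> (\<forall>y'. - w y' - \<psi> y' \<le> - w y - \<psi> y) \<and> - w y = \<psi> y"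
  have C2: "C2 (\<lambda>y. - \<psi> y)" using C2_mult[OF C2_const[of "- 1"]] t by force
  have gr: "grad (\<lambda>y. - \<psi> y) y = - grad \<psi> y"
    using GDERIV_minus[OF C2_GDERIV] t by (intro grad_eqI) blast
  have "\<forall>y'. w y' - (- \<psi> y') \<ge> w y - (- \<psi> y)" "w y = - \<psi> y" using t by (auto simp: algebra_simps)
  with C2 have "C2 (\<lambda>y. - \<psi> y) \<and> (\<forall>y'. w y' - (- \<psi> y') \<ge> w y - (- \<psi> y)) \<and> w y = - \<psi> y" by blast
  then have *: "integrable (dens q) (jump0 \<beta> w y (- grad \<psi> y)) \<and>
      d - a y * (\<integral>z. jump0 \<beta> w y (- grad \<psi> y) z \<partial>(dens q)) - a y * I - f y \<ge> - \<delta>"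
    using sup[unfolded cell_super_def, THEN conjunct2, THEN conjunct2, THEN bspec[OF _ y], THEN spec[of _ "\<lambda>y. - \<psi> y"]]
    unfolding gr by (rule rev_mp)
  have j: "jump0 \<beta> (\<lambda>y. - w y) y (grad \<psi> y) = (\<lambda>z. - jump0 \<beta> w y (- grad \<psi> y) z)"
    using jump0_uminus[of w y "- grad \<psi> y"] by simp
  show "integrable (dens q) (jump0 \<beta> (\<lambda>y. - w y) y (grad \<psi> y))" unfolding j using * by simp
  show "- d - a y * (\<integral>z. jump0 \<beta> (\<lambda>y. - w y) y (grad \<psi> y) z \<partial>(dens q)) - a y * - I - - f y \<le> \<delta>"
    unfolding j using * by simp
qed

text \<open>The operator in the cell problem is linear and translation invariant, so dividing by \<open>a\<close> and
  averaging gives the effective constant explicitly.\<close>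

lemma eff_const_eq:
  assumes B: "condB q \<beta>" and a: "\<And>y. a y > 0" "\<And>y. a y \<le> a1"
    and K: "is_mean (\<lambda>y. inverse (a y)) K" "K > 0" and F: "is_mean (\<lambda>y. f y / a y) F"
  shows "eff_const q \<beta> a f I = (I + F) / K"
  unfolding eff_const_def
proof (rule the_equality)
  let ?d = "(I + F) / K"
  show "\<forall>\<delta>>0. (\<exists>v. cell_sub q \<beta> a f I ?d \<delta> v) \<and> (\<exists>w. cell_super q \<beta> a f I ?d \<delta> w)"
  proof (intro allI impI)
    fix \<delta> :: real assume \<delta>: "\<delta> > 0"
    obtain v g where v: "smooth_with v g" "trig0 v" "\<And>y. integrable (dens q) (jump0 \<beta> v y (g y))"
      "\<And>y. \<bar>?d - a y * (\<integral>z. jump0 \<beta> v y (g y) z \<partial>(dens q)) - a y * I - f y\<bar> \<le> \<delta>"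
      using approximate_cell_solution[OF B a K F \<delta>, of I] by blast
    show "(\<exists>v. cell_sub q \<beta> a f I ?d \<delta> v) \<and> (\<exists>w. cell_super q \<beta> a f I ?d \<delta> w)"
      using cell_approximate_solution[OF v(1) trig0_periodic[OF v(2)] v(3,4)] by blast
  qed
  fix d assume d: "\<forall>\<delta>>0. (\<exists>v. cell_sub q \<beta> a f I d \<delta> v) \<and> (\<exists>w. cell_super q \<beta> a f I d \<delta> w)"
  have "\<bar>d - ?d\<bar> \<le> e" if "e > 0" for e
  proof -
    have \<delta>: "e / 2 > 0" using that by simp
    obtain v g where v: "smooth_with v g" "trig0 v" "\<And>y. integrable (dens q) (jump0 \<beta> v y (g y))"
      "\<And>y. \<bar>?d - a y * (\<integral>z. jump0 \<beta> v y (g y) z \<partial>(dens q)) - a y * I - f y\<bar> \<le> e / 2"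
      using approximate_cell_solution[OF B a K F \<delta>, of I] by blast
    obtain u w where u: "cell_sub q \<beta> a f I d (e / 2) u" and w: "cell_super q \<beta> a f I d (e / 2) w"
      using d \<delta> by blast
    have lo: "?d - a y * (\<integral>z. jump0 \<beta> v y (g y) z \<partial>(dens q)) - a y * I - f y \<ge> - (e / 2)"
      and hi: "?d - a y * (\<integral>z. jump0 \<beta> v y (g y) z \<partial>(dens q)) - a y * I - f y \<le> e / 2" for y
      using v(4)[of y] by linarith+
    have "d \<le> ?d + 2 * (e / 2)"
      by (rule cell_sub_le[OF u a(1) v(1) trig0_periodic[OF v(2)] v(3) lo])
    \<comment> \<open>Negation turns the supersolution into a subsolution with \<open>f\<close>,
      \<open>I\<close> and \<open>d\<close> negated.\<close>
    moreover have "- d \<le> - ?d + 2 * (e / 2)"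
    proof (rule cell_sub_le[OF cell_super_uminus[OF w] a(1)])
      show "smooth_with (\<lambda>y. - v y) (\<lambda>y. - g y)" using smooth_with_cmult[OF v(1), of "- 1"] by simp
      show "zperiodic (\<lambda>y. - v y)" using trig0_periodic[OF v(2)] unfolding zperiodic_def by simp
      fix y
      show "integrable (dens q) (jump0 \<beta> (\<lambda>y. - v y) y (- g y))" unfolding jump0_uminus using v(3) by simp
      show "- ?d - a y * (\<integral>z. jump0 \<beta> (\<lambda>y. - v y) y (- g y) z \<partial>(dens q)) - a y * - I - - f y \<ge> - (e / 2)"
        unfolding jump0_uminus integral_minus mult_minus_right using hi[of y] by linarith
    qed
    ultimately show ?thesis by linarith
  qed
  then show "d = ?d" using dense_eq0_I[of "d - ?d"] by simp
qed

end

section \<open>Removing the oscillations\<close>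

lemma nn_integral_lborel_scaleR:
  fixes F :: "'a::euclidean_space \<Rightarrow> ennreal"
  assumes [measurable]: "F \<in> borel_measurable borel" and c: "c \<noteq> 0"
  shows "(\<integral>\<^sup>+ z. F z \<partial>lborel) = ennreal (\<bar>c\<bar> ^ DIM('a)) * (\<integral>\<^sup>+ z. F (c *\<^sub>R z) \<partial>lborel)"
proof -
  have "(\<integral>\<^sup>+ z. F z \<partial>lborel)
      = (\<integral>\<^sup>+ z. F z \<partial>(density (distr lborel borel (\<lambda>x. 0 + c *\<^sub>R x)) (\<lambda>_. ennreal (\<bar>c\<bar> ^ DIM('a)))))"
    by (rule arg_cong[where f = "\<lambda>M. nn_integral M F", OF lborel_affine[OF c]])
  also have "\<dots> = (\<integral>\<^sup>+ z. ennreal (\<bar>c\<bar> ^ DIM('a)) * F z \<partial>(distr lborel borel (\<lambda>x. 0 + c *\<^sub>R x)))"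
    by (rule nn_integral_density) auto
  also have "\<dots> = (\<integral>\<^sup>+ z. ennreal (\<bar>c\<bar> ^ DIM('a)) * F (0 + c *\<^sub>R z) \<partial>lborel)"
    by (rule nn_integral_distr) auto
  also have "\<dots> = ennreal (\<bar>c\<bar> ^ DIM('a)) * (\<integral>\<^sup>+ z. F (c *\<^sub>R z) \<partial>lborel)"
    by (subst nn_integral_cmult) auto
  finally show ?thesis .
qed

lemma (in levy) char_exp_real_nn_integral:
  "ennreal (char_exp_real q \<beta> \<xi>) = (\<integral>\<^sup>+ z. ennreal (q z * (1 - cos (\<xi> \<bullet> \<beta> z))) \<partial>lborel)"
proof -
  have [measurable]: "q \<in> borel_measurable borel" by (rule q_measurable)
  have "ennreal (char_exp_real q \<beta> \<xi>) = (\<integral>\<^sup>+ z. ennreal (1 - cos (\<xi> \<bullet> \<beta> z)) \<partial>(dens q))"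
    unfolding char_exp_real_def by (rule nn_integral_eq_integral[symmetric, OF integrable_one_minus_cos]) simp
  also have "\<dots> = (\<integral>\<^sup>+ z. ennreal (q z) * ennreal (1 - cos (\<xi> \<bullet> \<beta> z)) \<partial>lborel)"
    unfolding dens_def by (rule nn_integral_density) auto
  also have "\<dots> = (\<integral>\<^sup>+ z. ennreal (q z * (1 - cos (\<xi> \<bullet> \<beta> z))) \<partial>lborel)"
    by (intro nn_integral_cong ennreal_mult[symmetric] q_nonneg) simp
  finally show ?thesis .
qed

lemma powr_minus_ge:
  fixes x \<alpha> K :: real
  assumes "x > 0" "\<alpha> > 0" "K > 0" "x \<le> K powr (- 1 / \<alpha>)"
  shows "x powr (- \<alpha>) \<ge> K"
proof -
  have "(K powr (- 1 / \<alpha>)) powr (- \<alpha>) \<le> x powr (- \<alpha>)"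
    using assms by (intro powr_mono2') auto
  then show ?thesis using assms by (simp add: powr_powr)
qed

text \<open>Rescaling \<open>z\<close> by \<open>\<epsilon>\<close> turns the symbol at frequency \<open>\<xi> / \<epsilon>\<close> into \<open>\<epsilon> powr - \<alpha>\<close> times the symbol at \<open>\<xi>\<close>
  of the rescaled density, which Fatou's lemma bounds from below.\<close>

lemma eventually_char_exp_real_ge:
  fixes \<beta> :: "real^'m \<Rightarrow> real^'n"
  assumes q: "levy \<beta> q B" and q': "levy \<beta> q' B" and hom: "\<And>c z. c > 0 \<Longrightarrow> \<beta> (c *\<^sub>R z) = c *\<^sub>R \<beta> z"
    and \<alpha>: "\<alpha> > 0"
    and lim: "\<And>z. ((\<lambda>\<epsilon>. \<epsilon> powr (real CARD('m) + \<alpha>) * q (\<epsilon> *\<^sub>R z)) \<longlongrightarrow> q' z) (at_right 0)"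
    and pos: "char_exp_real q' \<beta> \<xi> > 0"
  shows "eventually (\<lambda>\<epsilon>. C \<le> char_exp_real q \<beta> (\<xi> /\<^sub>R \<epsilon>)) (at_right 0)"
\<comment> \<open>Fatou's lemma is about sequences, so an arbitrary positive null sequence replaces
  \<open>\<epsilon>\<close>.\<close>
proof (rule sequentially_imp_eventually_at_right[of 0 1])
  show "(0::real) < 1" by simp
  interpret q: levy \<beta> q B by (rule q)
  interpret q': levy \<beta> q' B by (rule q')
  have [measurable]: "q \<in> borel_measurable borel" by (rule q.q_measurable)
  define s where "s = char_exp_real q' \<beta> \<xi>"
  have s: "s > 0" using pos by (simp add: s_def)
  fix X :: "nat \<Rightarrow> real" assume X: "\<And>n. 0 < X n" "X \<longlonglongrightarrow> 0"
  define h where "h n z = ennreal (X n powr (real CARD('m) + \<alpha>) * q (X n *\<^sub>R z) * (1 - cos (\<xi> \<bullet> \<beta> z)))" for n z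
  have [measurable]: "h n \<in> borel_measurable borel" for n unfolding h_def by measurable
  have filt: "filterlim X (at_right 0) sequentially"
    unfolding filterlim_at using X(1) X(2) less_imp_neq[OF X(1), THEN not_sym]
    by (intro conjI always_eventually allI) auto
  have "ennreal s = (\<integral>\<^sup>+ z. ennreal (q' z * (1 - cos (\<xi> \<bullet> \<beta> z))) \<partial>lborel)"
    unfolding s_def by (rule q'.char_exp_real_nn_integral)
  also have "\<dots> = (\<integral>\<^sup>+ z. liminf (\<lambda>n. h n z) \<partial>lborel)"
  proof (intro nn_integral_cong)
    fix z
    have "(\<lambda>n. h n z) \<longlonglongrightarrow> ennreal (q' z * (1 - cos (\<xi> \<bullet> \<beta> z)))"
      unfolding h_def by (intro tendsto_intros filterlim_compose[OF lim filt])
    then show "ennreal (q' z * (1 - cos (\<xi> \<bullet> \<beta> z))) = liminf (\<lambda>n. h n z)"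
      by (simp add: lim_imp_Liminf)
  qed
  also have "\<dots> \<le> liminf (\<lambda>n. \<integral>\<^sup>+ z. h n z \<partial>lborel)" by (intro nn_integral_liminf) auto
  finally have "ennreal s \<le> liminf (\<lambda>n. \<integral>\<^sup>+ z. h n z \<partial>lborel)" .
  \<comment> \<open>Half of \<open>s\<close> leaves a strict inequality, as a bound on a lower limit
    requires in order to hold eventually.\<close>
  moreover have "ennreal (s / 2) < ennreal s" using s by (simp add: ennreal_less_iff)
  ultimately have "ennreal (s / 2) < liminf (\<lambda>n. \<integral>\<^sup>+ z. h n z \<partial>lborel)" by (rule less_le_trans[rotated])
  then have ev: "eventually (\<lambda>n. ennreal (s / 2) < (\<integral>\<^sup>+ z. h n z \<partial>lborel)) sequentially"
    by (rule less_LiminfD)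
  have scale: "ennreal (char_exp_real q \<beta> (\<xi> /\<^sub>R X n)) = ennreal (X n powr (- \<alpha>)) * (\<integral>\<^sup>+ z. h n z \<partial>lborel)" for n
  proof -
    let ?G = "\<integral>\<^sup>+ z. ennreal (q (X n *\<^sub>R z) * (1 - cos (\<xi> \<bullet> \<beta> z))) \<partial>lborel"
    have e1: "(\<xi> /\<^sub>R X n) \<bullet> \<beta> (X n *\<^sub>R z) = \<xi> \<bullet> \<beta> z" for z
      using hom[OF X(1), of n z] X(1)[of n] by simp
    \<comment> \<open>The Jacobian of the scaling, split into the growth factor and the power that
      condition (A) attaches to the density.\<close>
    have e2: "\<bar>X n\<bar> ^ DIM(real^'m) = X n powr (- \<alpha>) * X n powr (real CARD('m) + \<alpha>)"
      using X(1)[of n] by (simp add: powr_add[symmetric] powr_realpow)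
    have "ennreal (char_exp_real q \<beta> (\<xi> /\<^sub>R X n)) = (\<integral>\<^sup>+ z. ennreal (q z * (1 - cos ((\<xi> /\<^sub>R X n) \<bullet> \<beta> z))) \<partial>lborel)"
      by (rule q.char_exp_real_nn_integral)
    also have "\<dots> = ennreal (\<bar>X n\<bar> ^ DIM(real^'m))
        * (\<integral>\<^sup>+ z. ennreal (q (X n *\<^sub>R z) * (1 - cos ((\<xi> /\<^sub>R X n) \<bullet> \<beta> (X n *\<^sub>R z)))) \<partial>lborel)"
      by (rule nn_integral_lborel_scaleR) (use X(1)[of n] in \<open>measurable, simp\<close>)
    also have "\<dots> = ennreal (X n powr (- \<alpha>) * X n powr (real CARD('m) + \<alpha>)) * ?G"
      unfolding e1 e2 ..
    also have "\<dots> = ennreal (X n powr (- \<alpha>)) * (ennreal (X n powr (real CARD('m) + \<alpha>)) * ?G)"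
      by (simp add: ennreal_mult mult.assoc)
    also have "ennreal (X n powr (real CARD('m) + \<alpha>)) * ?G = (\<integral>\<^sup>+ z. h n z \<partial>lborel)"
      unfolding h_def mult.assoc
      by (subst nn_integral_cmult[symmetric]) (auto simp: ennreal_mult' intro!: nn_integral_cong)
    finally show ?thesis .
  qed
  \<comment> \<open>Gives \<open>K * (s / 2) = \<bar>C\<bar> + s / 2\<close>, which exceeds
    \<open>C\<close>.\<close>
  define K where "K = 2 * \<bar>C\<bar> / s + 1"
  have K: "K > 0" unfolding K_def using s by (intro add_nonneg_pos) auto
  have "eventually (\<lambda>n. X n < K powr (- 1 / \<alpha>)) sequentially"
    using X(2) K by (intro order_tendstoD(2)) auto
  with ev show "eventually (\<lambda>n. C \<le> char_exp_real q \<beta> (\<xi> /\<^sub>R X n)) sequentially"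
  proof eventually_elim
    case (elim n)
    have "K \<le> X n powr (- \<alpha>)" using elim by (intro powr_minus_ge X(1) \<alpha> K) auto
    then have "ennreal K * ennreal (s / 2) \<le> ennreal (char_exp_real q \<beta> (\<xi> /\<^sub>R X n))"
      unfolding scale using elim(1) by (intro mult_mono ennreal_leI) auto
    moreover have "ennreal (K * (s / 2)) = ennreal K * ennreal (s / 2)"
      using K s by (intro ennreal_mult) auto
    ultimately have "ennreal (K * (s / 2)) \<le> ennreal (char_exp_real q \<beta> (\<xi> /\<^sub>R X n))" by (simp only:)
    then have "K * (s / 2) \<le> char_exp_real q \<beta> (\<xi> /\<^sub>R X n)"
      using K s by (subst (asm) ennreal_le_iff2) (auto simp: not_le[symmetric] mult_le_0_iff)
    moreover have "K * (s / 2) = \<bar>C\<bar> + s / 2" unfolding K_def using s by (simp add: field_simps)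
    ultimately show ?case using s by linarith
  qed
qed

section \<open>Corrected subsolutions of the averaged equation\<close>

context levy
begin

text \<open>The corrector of the zero-order coefficient multiplies \<open>u\<close>. The resulting product of the
  increments of \<open>v\<close> and \<open>u\<close> is absorbed by the increment of \<open>\<mu> / 2 * u\<^sup>2\<close>, at the cost of the squared
  increment of \<open>v\<close> divided by \<open>2 * \<mu>\<close>, whose integral is small.\<close>

lemma corrected_quad_sub:
  fixes u :: "real^'n \<Rightarrow> real"
  assumes sub: "quad_sub q \<beta> \<Omega> c r u" and u: "continuous_on UNIV u" "\<And>x. \<bar>u x\<bar> \<le> R"
    and v: "corrects (\<lambda>z. norm z \<le> 1) q \<beta> \<delta> P v gv" and w: "corrects (\<lambda>z. norm z \<le> 1) q \<beta> \<delta> Q w gw"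
    and c: "\<And>x. \<bar>c x - K - P x\<bar> \<le> \<eta>" "\<And>x. \<bar>c x\<bar> \<le> c1"
    and r: "\<And>x. \<bar>r x - F - Q x\<bar> \<le> \<eta>" "\<And>x. \<bar>r x\<bar> \<le> r1"
    and \<mu>: "\<mu> > 0" "\<mu> * R \<le> 1/4" and \<delta>: "\<delta> \<le> 1/4"
  defines "U \<equiv> \<lambda>x. u x - v x * u x + \<mu> / 2 * (u x)\<^sup>2 + w x"
  defines "s \<equiv> \<delta> * R + \<mu> * R\<^sup>2 / 2 + \<delta>"
  shows "continuous_on UNIV U" "\<And>x. \<bar>U x - u x\<bar> \<le> s"
    "quad_sub q \<beta> \<Omega> (\<lambda>_. K)
       (\<lambda>_. F + (\<bar>K\<bar> * s + (\<delta> + \<mu> * R) * (c1 * R + r1) + (R + 1) * \<eta> + \<delta> / (2 * \<mu>))) U"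
proof -
  note v' = v[unfolded corrects_def] and w' = w[unfolded corrects_def]
  have sv: "smooth_with v gv" and sw: "smooth_with w gw" using v' w' by blast+
  have cont: "continuous_on UNIV v" "continuous_on UNIV w"
    using sv sw smooth_with_continuous by blast+
  show cU: "continuous_on UNIV U" unfolding U_def by (intro continuous_intros cont u)
  have R: "R \<ge> 0" using u(2)[of 0] by linarith
  have vb: "\<bar>v x\<bar> \<le> \<delta>" and wb: "\<bar>w x\<bar> \<le> \<delta>" for x using v' w' by blast+
  have \<delta>0: "\<delta> \<ge> 0" using vb[of 0] by linarith
  have \<eta>: "\<eta> \<ge> 0" using c(1)[of 0] by linarith
  show Us: "\<bar>U x - u x\<bar> \<le> s" for x
  proof -
    have "\<bar>v x * u x\<bar> \<le> \<delta> * R" unfolding abs_mult by (intro mult_mono vb u \<delta>0) auto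
    moreover have "(u x)\<^sup>2 \<le> R\<^sup>2" using u(2)[of x] R by (simp add: abs_le_square_iff[symmetric])
    then have "\<mu> / 2 * (u x)\<^sup>2 \<le> \<mu> / 2 * R\<^sup>2" using \<mu> by (intro mult_left_mono) auto
    moreover have "0 \<le> \<mu> / 2 * (u x)\<^sup>2" using \<mu> by simp
    ultimately show ?thesis using wb[of x] unfolding U_def s_def abs_le_iff by auto
  qed
  have UR: "\<bar>U x\<bar> \<le> R + s" for x using Us[of x] u(2)[of x] by linarith
  obtain Cv where Cv: "Cv \<ge> 0" "\<And>x h. \<bar>v (x + h) - v x - gv x \<bullet> h\<bar> \<le> Cv * (norm h)\<^sup>2"
    "\<And>x h. \<bar>v (x + h) - v x\<bar> \<le> Cv * norm h" using sv unfolding smooth_with_def by blast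
  obtain Cw where Cw: "Cw \<ge> 0" "\<And>x h. \<bar>w (x + h) - w x - gw x \<bullet> h\<bar> \<le> Cw * (norm h)\<^sup>2"
    using sw unfolding smooth_with_def by blast
  \<comment> \<open>The derivative of \<open>u - v * u + \<mu> / 2 * u^2\<close> in
    \<open>u\<close>. Smallness of \<open>\<delta>\<close> and \<open>\<mu> * R\<close> keeps it
    close to 1 and at least 1/2, so that division by it is harmless.\<close>
  define m where "m x = 1 - v x + \<mu> * u x" for x
  have lu: "\<bar>\<mu> * u x\<bar> \<le> \<mu> * R" for x unfolding abs_mult using \<mu> u(2)[of x] by (intro mult_mono) auto
  have m: "m x \<ge> 1/2" "\<bar>m x - 1\<bar> \<le> \<delta> + \<mu> * R" for x
    using vb[of x] lu[of x] \<delta> \<mu>(2) unfolding m_def abs_le_iff by linarith+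
  have inc: "U (x + h) - U x = m x * (u (x + h) - u x) - u x * (v (x + h) - v x)
      - (v (x + h) - v x) * (u (x + h) - u x) + \<mu> / 2 * (u (x + h) - u x)\<^sup>2 + (w (x + h) - w x)" for x h
    unfolding U_def m_def by (simp add: power2_eq_square algebra_simps)
  have young: "- (dv * du) + \<mu> / 2 * du\<^sup>2 \<ge> - (dv\<^sup>2 / (2 * \<mu>))" for dv du
  proof -
    have "0 \<le> (\<mu> * du - dv)\<^sup>2 / (2 * \<mu>)" using \<mu> by simp
    also have "\<dots> = \<mu> / 2 * du\<^sup>2 - dv * du + dv\<^sup>2 / (2 * \<mu>)"
      using \<mu> by (simp add: power2_eq_square field_simps)
    finally show ?thesis by linarith
  qed
  show "quad_sub q \<beta> \<Omega> (\<lambda>_. K)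
       (\<lambda>_. F + (\<bar>K\<bar> * s + (\<delta> + \<mu> * R) * (c1 * R + r1) + (R + 1) * \<eta> + \<delta> / (2 * \<mu>))) U"
  proof (rule quad_subI)
    fix x pU A assume x: "x \<in> \<Omega>" and A: "A \<ge> 0"
      and touch: "\<And>h. U (x + h) \<le> U x + pU \<bullet> h + A * (norm h)\<^sup>2"
    \<comment> \<open>The slope that the formal chain rule assigns to \<open>u\<close> when
      \<open>U\<close> has slope \<open>pU\<close>.\<close>
    define p where "p = (pU + u x *\<^sub>R gv x - gw x) /\<^sub>R m x"
    have mpos: "m x > 0" using m(1)[of x] by linarith
    have pU: "pU = m x *\<^sub>R p - u x *\<^sub>R gv x + gw x" unfolding p_def using mpos by simp
    \<comment> \<open>Openings collected from the contact of \<open>U\<close>, the Taylor bounds of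
      \<open>v\<close> and \<open>w\<close>, and Young's inequality; \<open>m x \<ge> 1/2\<close>
      doubles the total below.\<close>
    define A1 where "A1 = A + R * Cv + Cv\<^sup>2 / (2 * \<mu>) + Cw"
    have A1: "A1 \<ge> 0" unfolding A1_def using A R Cv(1) Cw(1) \<mu>(1) by simp
    have "u (x + h) \<le> u x + p \<bullet> h + (2 * A1) * (norm h)\<^sup>2" for h
    proof -
      let ?du = "u (x + h) - u x" and ?dv = "v (x + h) - v x" and ?dw = "w (x + h) - w x"
      have "m x * ?du \<le> pU \<bullet> h + A * (norm h)\<^sup>2 + u x * ?dv + ?dv\<^sup>2 / (2 * \<mu>) - ?dw"
        using touch[of h] inc[of x h] young[of ?dv ?du] by linarith
      moreover have "u x * ?dv \<le> (u x *\<^sub>R gv x) \<bullet> h + R * Cv * (norm h)\<^sup>2"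
      proof -
        have "\<bar>u x * (?dv - gv x \<bullet> h)\<bar> \<le> R * (Cv * (norm h)\<^sup>2)"
          unfolding abs_mult by (intro mult_mono u Cv R) auto
        then show ?thesis by (simp add: right_diff_distrib abs_le_iff mult.assoc)
      qed
      moreover have "?dv\<^sup>2 \<le> Cv\<^sup>2 * (norm h)\<^sup>2"
        using power_mono[OF Cv(3)[of x h], of 2] by (simp add: power_mult_distrib)
      then have "?dv\<^sup>2 / (2 * \<mu>) \<le> Cv\<^sup>2 / (2 * \<mu>) * (norm h)\<^sup>2"
        using divide_right_mono[of "?dv\<^sup>2" "Cv\<^sup>2 * (norm h)\<^sup>2" "2 * \<mu>"] \<mu> by simp
      moreover have "- ?dw \<le> - (gw x \<bullet> h) + Cw * (norm h)\<^sup>2" using Cw(2)[of x h] by (simp add: abs_le_iff)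
      ultimately have "m x * ?du \<le> (m x *\<^sub>R p) \<bullet> h + A1 * (norm h)\<^sup>2"
        unfolding pU A1_def by (simp add: inner_add_left inner_diff_left distrib_right)
      also have "\<dots> \<le> m x * (p \<bullet> h + (2 * A1) * (norm h)\<^sup>2)"
        using mult_right_mono[OF m(1)[of x], of "2 * (A1 * (norm h)\<^sup>2)"] A1
        by (simp add: distrib_left mult.assoc)
      finally have "?du \<le> p \<bullet> h + (2 * A1) * (norm h)\<^sup>2" using mpos by (simp only: mult_le_cancel_left_pos)
      then show ?thesis by linarith
    qed
    then have *: "integrable (dens q) (jump1 \<beta> u x p)" "c x * u x - (\<integral>z. jump1 \<beta> u x p z \<partial>(dens q)) \<le> r x"
      using sub x unfolding quad_sub_def by blast+
    have jv: "integrable (dens q) (jump1 \<beta> v x (gv x))" "(\<integral>z. jump1 \<beta> v x (gv x) z \<partial>(dens q)) = P x"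
      and jw: "integrable (dens q) (jump1 \<beta> w x (gw x))" "(\<integral>z. jump1 \<beta> w x (gw x) z \<partial>(dens q)) = Q x"
      and sq: "integrable (dens q) (\<lambda>z. (v (x + \<beta> z) - v x)\<^sup>2)" "(\<integral>z. (v (x + \<beta> z) - v x)\<^sup>2 \<partial>(dens q)) \<le> \<delta>"
      using v' w' unfolding jump1_eq_tjump by blast+
    \<comment> \<open>An integrable minorant of the jump of \<open>U\<close>, in which the product
      of increments and the square of that of \<open>u\<close> are traded for the squared increment
      of \<open>v\<close>. Together with the majorant from the contact it also yields integrability
      of the jump of \<open>U\<close>.\<close>
    define low where "low z = m x * jump1 \<beta> u x p z - u x * jump1 \<beta> v x (gv x) z + jump1 \<beta> w x (gw x) z
        - 1 / (2 * \<mu>) * (v (x + \<beta> z) - v x)\<^sup>2" for z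
    have low: "low z \<le> jump1 \<beta> U x pU z" for z
    proof -
      have "jump1 \<beta> U x pU z = m x * jump1 \<beta> u x p z - u x * jump1 \<beta> v x (gv x) z + jump1 \<beta> w x (gw x) z
        + (- ((v (x + \<beta> z) - v x) * (u (x + \<beta> z) - u x)) + \<mu> / 2 * (u (x + \<beta> z) - u x)\<^sup>2)"
        using inc[of x "\<beta> z"] unfolding jump1_def pU by (simp add: inner_add_left inner_diff_left algebra_simps)
      then show ?thesis using young[of "v (x + \<beta> z) - v x" "u (x + \<beta> z) - u x"] unfolding low_def by simp
    qed
    have ilow: "integrable (dens q) low" unfolding low_def
      by (intro Bochner_Integration.integrable_diff Bochner_Integration.integrable_add integrable_mult_right * jv jw sq)
    have "(\<integral>z. low z \<partial>(dens q)) = m x * (\<integral>z. jump1 \<beta> u x p z \<partial>(dens q)) - u x * P x + Q x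
        - 1 / (2 * \<mu>) * (\<integral>z. (v (x + \<beta> z) - v x)\<^sup>2 \<partial>(dens q))"
      unfolding low_def using *(1) jv jw sq(1) by simp
    moreover have "1 / (2 * \<mu>) * (\<integral>z. (v (x + \<beta> z) - v x)\<^sup>2 \<partial>(dens q)) \<le> \<delta> / (2 * \<mu>)"
      using mult_left_mono[OF sq(2), of "1 / (2 * \<mu>)"] \<mu> by simp
    ultimately have ilow_ge: "(\<integral>z. low z \<partial>(dens q)) \<ge> m x * (\<integral>z. jump1 \<beta> u x p z \<partial>(dens q)) - u x * P x + Q x - \<delta> / (2 * \<mu>)"
      by linarith
    let ?C = "A * B\<^sup>2 + 2 * (R + s)"
    have up: "jump1 \<beta> U x pU z \<le> ?C * weight z" for z
      by (rule jump1_le_weight[OF touch A UR])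
    have iU: "integrable (dens q) (jump1 \<beta> U x pU)"
    proof (rule Bochner_Integration.integrable_bound)
      show "integrable (dens q) (\<lambda>z. \<bar>low z\<bar> + \<bar>?C * weight z\<bar>)"
        by (intro Bochner_Integration.integrable_add integrable_abs ilow integrable_mult_right integrable_weight)
      show "jump1 \<beta> U x pU \<in> borel_measurable (dens q)" using jump1_measurable[OF cU] by simp
      show "AE z in dens q. norm (jump1 \<beta> U x pU z) \<le> norm (\<bar>low z\<bar> + \<bar>?C * weight z\<bar>)"
      proof (intro always_eventually allI)
        fix z
        show "norm (jump1 \<beta> U x pU z) \<le> norm (\<bar>low z\<bar> + \<bar>?C * weight z\<bar>)"
          using low[of z] up[of z] unfolding real_norm_def by linarith
      qed
    qed
    have "(\<integral>z. low z \<partial>(dens q)) \<le> (\<integral>z. jump1 \<beta> U x pU z \<partial>(dens q))"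
      by (rule integral_mono[OF ilow iU low])
    \<comment> \<open>Multiplying the inequality for \<open>u\<close> by \<open>m x\<close> first
      lets the error \<open>m x - 1\<close> fall on \<open>c x * u x - r x\<close>, which is
      bounded, and not on the integral.\<close>
    moreover have "m x * (\<integral>z. jump1 \<beta> u x p z \<partial>(dens q)) \<ge> (c x * u x - r x) - (\<delta> + \<mu> * R) * (c1 * R + r1)"
    proof -
      have "\<bar>c x * u x\<bar> \<le> c1 * R" unfolding abs_mult
        by (intro mult_mono c u) (use c(2)[of x] in auto)
      then have "\<bar>c x * u x - r x\<bar> \<le> c1 * R + r1" using r(2)[of x] by linarith
      then have "\<bar>(m x - 1) * (c x * u x - r x)\<bar> \<le> (\<delta> + \<mu> * R) * (c1 * R + r1)"
        unfolding abs_mult by (intro mult_mono m) (use \<delta>0 \<mu> R in auto)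
      moreover have "m x * (c x * u x - r x) \<le> m x * (\<integral>z. jump1 \<beta> u x p z \<partial>(dens q))"
        using *(2) mpos by (intro mult_left_mono) auto
      ultimately show ?thesis unfolding left_diff_distrib mult_1 abs_le_iff by linarith
    qed
    moreover have "u x * P x \<le> u x * c x - K * u x + R * \<eta>"
    proof -
      have "\<bar>u x * (c x - K - P x)\<bar> \<le> R * \<eta>" unfolding abs_mult by (intro mult_mono u c R) auto
      then show ?thesis by (simp add: right_diff_distrib abs_le_iff mult.commute)
    qed
    moreover have "- Q x \<le> F - r x + \<eta>" using r(1)[of x] unfolding abs_le_iff by linarith
    moreover have "K * U x \<le> K * u x + \<bar>K\<bar> * s"
    proof -
      have "\<bar>K * (U x - u x)\<bar> \<le> \<bar>K\<bar> * s" unfolding abs_mult by (intro mult_left_mono Us) simp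
      then show ?thesis by (simp add: right_diff_distrib abs_le_iff)
    qed
    moreover have "(R + 1) * \<eta> = R * \<eta> + \<eta>" "u x * c x = c x * u x" by (simp_all add: algebra_simps)
    ultimately have "K * U x - (\<integral>z. jump1 \<beta> U x pU z \<partial>(dens q))
        \<le> F + (\<bar>K\<bar> * s + (\<delta> + \<mu> * R) * (c1 * R + r1) + (R + 1) * \<eta> + \<delta> / (2 * \<mu>))"
      using ilow_ge by linarith
    with iU show "integrable (dens q) (jump1 \<beta> U x pU) \<and> K * U x - (\<integral>z. jump1 \<beta> U x pU z \<partial>(dens q))
        \<le> F + (\<bar>K\<bar> * s + (\<delta> + \<mu> * R) * (c1 * R + r1) + (R + 1) * \<eta> + \<delta> / (2 * \<mu>))" by blast
  qed
qed

text \<open>The quantifiers over \<open>\<Omega>\<close> and \<open>u\<close> stand inside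
  \<open>eventually\<close> because \<open>u\<close> will depend on \<open>\<epsilon>\<close>. The
  error \<open>\<delta> / (2 * \<mu>)\<close> dictates the order of choices: \<open>\<mu>\<close>,
  then \<open>\<delta>\<close>, and \<open>\<epsilon>\<close> last.\<close>

lemma eventually_homogenized_quad_sub:
  fixes b g :: "real^'n \<Rightarrow> real"
  assumes lim: "symbol_diverges q \<beta>"
    and b: "is_mean b K" "\<And>y. \<bar>b y\<bar> \<le> c1" and g: "is_mean g F" "\<And>y. \<bar>g y\<bar> \<le> r1"
    and R: "R \<ge> 0" and \<sigma>: "\<sigma> > 0"
  shows "eventually (\<lambda>\<epsilon>. \<forall>\<Omega> u. continuous_on UNIV u \<and> (\<forall>x. \<bar>u x\<bar> \<le> R) \<and>
      quad_sub q \<beta> \<Omega> (\<lambda>x. b (x /\<^sub>R \<epsilon>)) (\<lambda>x. g (x /\<^sub>R \<epsilon>)) u \<longrightarrow>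
      (\<exists>U. continuous_on UNIV U \<and> (\<forall>x. \<bar>U x - u x\<bar> \<le> \<sigma>) \<and> quad_sub q \<beta> \<Omega> (\<lambda>_. K) (\<lambda>_. F + \<sigma>) U)) (at_right 0)"
proof -
  have c1: "c1 \<ge> 0" and r1: "r1 \<ge> 0" using b(2)[of 0] g(2)[of 0] by linarith+
  define M where "M = c1 * R + r1"
  have M: "M \<ge> 0" unfolding M_def using c1 r1 R by simp
  \<comment> \<open>Collects the factors that multiply \<open>\<mu>\<close> in the error terms; the
    summand 1 keeps it away from 0.\<close>
  define S where "S = R + R\<^sup>2 + \<bar>K\<bar> * R\<^sup>2 + R * M + 1"
  have S: "S \<ge> 1" unfolding S_def using R M by simp
  define \<mu> where "\<mu> = min (1 / (4 * S)) (\<sigma> / (4 * S))"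
  have \<mu>: "\<mu> > 0" unfolding \<mu>_def using S \<sigma> by simp
  have \<mu>S: "\<mu> * S \<le> 1/4" "\<mu> * S \<le> \<sigma> / 4"
    unfolding \<mu>_def using mult_right_mono[OF min.cobounded1, of S "1 / (4 * S)" "\<sigma> / (4 * S)"]
      mult_right_mono[OF min.cobounded2, of S "1 / (4 * S)" "\<sigma> / (4 * S)"] S by simp_all
  have S_parts: "0 \<le> \<mu> * R" "0 \<le> \<mu> * R\<^sup>2" "0 \<le> \<mu> * (\<bar>K\<bar> * R\<^sup>2)" "0 \<le> \<mu> * (R * M)"
    using \<mu> R M by simp_all
  have S_sum: "\<mu> * S = \<mu> * R + \<mu> * R\<^sup>2 + \<mu> * (\<bar>K\<bar> * R\<^sup>2) + \<mu> * (R * M) + \<mu>"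
    unfolding S_def by (simp add: distrib_left)
  \<comment> \<open>The same for the factors of \<open>\<delta>\<close>, one of which is
    \<open>1 / (2 * \<mu>)\<close>.\<close>
  define S2 where "S2 = \<bar>K\<bar> * (R + 1) + M + 1 / (2 * \<mu>) + (R + 1)"
  have S2: "S2 \<ge> 1" unfolding S2_def using R M \<mu> by simp
  define \<delta> where "\<delta> = min (1/4) (\<sigma> / (4 * S2))"
  have \<delta>: "\<delta> > 0" "\<delta> \<le> 1/4" unfolding \<delta>_def using S2 \<sigma> by simp_all
  have "\<delta> * S2 \<le> \<sigma> / (4 * S2) * S2" unfolding \<delta>_def using S2 by (intro mult_right_mono) auto
  then have \<delta>S: "\<delta> * S2 \<le> \<sigma> / 4" using S2 by simp
  have S2_parts: "0 \<le> \<delta> * (\<bar>K\<bar> * (R + 1))" "0 \<le> \<delta> * M" "0 \<le> \<delta> * (1 / (2 * \<mu>))" "0 \<le> \<delta> * (R + 1)"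
    using \<delta> \<mu> R M by simp_all
  have S2_sum: "\<delta> * S2 = \<delta> * (\<bar>K\<bar> * (R + 1)) + \<delta> * M + \<delta> * (1 / (2 * \<mu>)) + \<delta> * (R + 1)"
    unfolding S2_def by (simp only: distrib_left)
  define \<eta> where "\<eta> = \<sigma> / (4 * (R + 1))"
  have \<eta>: "\<eta> > 0" "(R + 1) * \<eta> = \<sigma> / 4" unfolding \<eta>_def using R \<sigma> by (auto simp: field_simps)
  obtain P where P: "trig0 P" "\<And>y. \<bar>b y - K - P y\<bar> \<le> \<eta>" using b(1) \<eta>(1) unfolding is_mean_def by blast
  obtain Q where Q: "trig0 Q" "\<And>y. \<bar>g y - F - Q y\<bar> \<le> \<eta>" using g(1) \<eta>(1) unfolding is_mean_def by blast
  define s where "s = \<delta> * R + \<mu> * R\<^sup>2 / 2 + \<delta>"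
  have s: "s \<le> \<sigma>"
    using S_parts S2_parts S_sum S2_sum \<mu>S \<delta>S \<mu> \<sigma> distrib_left[of \<delta> R 1] unfolding s_def by linarith
  have "\<bar>K\<bar> * s = \<delta> * (\<bar>K\<bar> * (R + 1)) + \<mu> * (\<bar>K\<bar> * R\<^sup>2) / 2" unfolding s_def by (simp add: algebra_simps)
  moreover have "(\<delta> + \<mu> * R) * M = \<delta> * M + \<mu> * (R * M)" by (simp add: algebra_simps)
  moreover have "\<delta> / (2 * \<mu>) = \<delta> * (1 / (2 * \<mu>))" by simp
  ultimately have tot: "\<bar>K\<bar> * s + (\<delta> + \<mu> * R) * M + (R + 1) * \<eta> + \<delta> / (2 * \<mu>) \<le> \<sigma>"
    using S_parts S2_parts S_sum S2_sum \<mu>S \<delta>S \<mu> \<sigma> \<eta>(2) by linarith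
  have T: "Measurable.pred borel (\<lambda>z :: real^'m. norm z \<le> 1)" by measurable
  have "eventually (\<lambda>\<epsilon>. \<exists>v gv. corrects (\<lambda>z. norm z \<le> 1) q \<beta> \<delta> (\<lambda>x. P (x /\<^sub>R \<epsilon>)) v gv) (at_right 0)"
    by (rule eventually_trig0_corrector[OF T _ lim P(1) \<delta>(1)])
  moreover have "eventually (\<lambda>\<epsilon>. \<exists>w gw. corrects (\<lambda>z. norm z \<le> 1) q \<beta> \<delta> (\<lambda>x. Q (x /\<^sub>R \<epsilon>)) w gw) (at_right 0)"
    by (rule eventually_trig0_corrector[OF T _ lim Q(1) \<delta>(1)])
  ultimately show ?thesis
  proof eventually_elim
    case (elim \<epsilon>)
    then obtain v gv w gw where v: "corrects (\<lambda>z. norm z \<le> 1) q \<beta> \<delta> (\<lambda>x. P (x /\<^sub>R \<epsilon>)) v gv"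
      and w: "corrects (\<lambda>z. norm z \<le> 1) q \<beta> \<delta> (\<lambda>x. Q (x /\<^sub>R \<epsilon>)) w gw" by blast
    show ?case
    proof (intro allI impI)
      fix \<Omega> u assume u: "continuous_on UNIV u \<and> (\<forall>x. \<bar>u x\<bar> \<le> R) \<and>
        quad_sub q \<beta> \<Omega> (\<lambda>x. b (x /\<^sub>R \<epsilon>)) (\<lambda>x. g (x /\<^sub>R \<epsilon>)) u"
      have \<mu>R: "\<mu> * R \<le> 1/4" using \<mu>S S_sum S_parts \<mu> by linarith
      let ?U = "\<lambda>x. u x - v x * u x + \<mu> / 2 * (u x)\<^sup>2 + w x"
      have *: "continuous_on UNIV ?U" "\<And>x. \<bar>?U x - u x\<bar> \<le> s"
        "quad_sub q \<beta> \<Omega> (\<lambda>_. K) (\<lambda>_. F + (\<bar>K\<bar> * s + (\<delta> + \<mu> * R) * M + (R + 1) * \<eta> + \<delta> / (2 * \<mu>))) ?U"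
        using corrected_quad_sub[of \<Omega> "\<lambda>x. b (x /\<^sub>R \<epsilon>)" "\<lambda>x. g (x /\<^sub>R \<epsilon>)" u R \<delta> "\<lambda>x. P (x /\<^sub>R \<epsilon>)" v gv
            "\<lambda>x. Q (x /\<^sub>R \<epsilon>)" w gw K \<eta> c1 F r1 \<mu>] u v w P(2) Q(2) b(2) g(2) \<mu> \<mu>R \<delta>(2)
        unfolding s_def M_def by blast+
      have "quad_sub q \<beta> \<Omega> (\<lambda>_. K) (\<lambda>_. F + \<sigma>) ?U"
        using *(3) tot unfolding quad_sub_def by fastforce
      moreover have "\<bar>?U x - u x\<bar> \<le> \<sigma>" for x using *(2)[of x] s by linarith
      ultimately show "\<exists>U. continuous_on UNIV U \<and> (\<forall>x. \<bar>U x - u x\<bar> \<le> \<sigma>) \<and>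
          quad_sub q \<beta> \<Omega> (\<lambda>_. K) (\<lambda>_. F + \<sigma>) U" using *(1) by blast
    qed
  qed
qed

end

section \<open>The limit\<close>

lemma continuous_zperiodic_bounded:
  fixes b :: "real^'n \<Rightarrow> real"
  assumes "continuous_on UNIV b" "zperiodic b"
  obtains C where "\<And>y. \<bar>b y\<bar> \<le> C"
proof -
  have "usc b" "usc (\<lambda>y. - b y)"
    using continuous_imp_usc_lsc assms(1) continuous_on_minus by blast+
  moreover have "zperiodic (\<lambda>y. - b y)" using assms(2) unfolding zperiodic_def by simp
  ultimately obtain y y' where "\<And>z. b z \<le> b y" "\<And>z. - b z \<le> - b y'"
    using usc_attains_sup_periodic assms(2) by meson
  then have "\<bar>b z\<bar> \<le> \<bar>b y\<bar> + \<bar>b y'\<bar>" for z by (smt (verit))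
  then show ?thesis by (rule that)
qed

lemma bounded_of_exterior_bound:
  fixes u :: "real^'n \<Rightarrow> real"
  assumes "continuous_on UNIV u" "bounded \<Omega>" "\<And>x. x \<notin> \<Omega> \<Longrightarrow> \<bar>u x\<bar> \<le> R"
  obtains C where "\<And>x. \<bar>u x\<bar> \<le> C"
proof -
  have "compact (closure \<Omega>)" using assms(2) by simp
  then have "bounded (u ` closure \<Omega>)"
    by (intro compact_imp_bounded compact_continuous_image continuous_on_subset[OF assms(1)]) auto
  then obtain C where C: "\<And>x. x \<in> closure \<Omega> \<Longrightarrow> \<bar>u x\<bar> \<le> C" unfolding bounded_iff by auto
  have "\<bar>u x\<bar> \<le> max C R" for x
    using C[of x] assms(3)[of x] closure_subset[of \<Omega>] by (cases "x \<in> \<Omega>") auto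
  then show ?thesis by (rule that)
qed

text \<open>At a maximum above \<open>R\<close> a constant touches, and the nonlocal term is
  nonpositive there. The resulting bound does not see the oscillation of the coefficients, so it is
  uniform in \<open>\<epsilon>\<close>.\<close>

lemma quad_sub_max_principle:
  assumes u: "continuous_on UNIV u" and \<Omega>: "bounded \<Omega>" and out: "\<And>x. x \<notin> \<Omega> \<Longrightarrow> u x \<le> R"
    and sub: "quad_sub q \<beta> \<Omega> c r u" and c: "\<And>x. c x > 0" "\<And>x. r x \<le> c x * R"
  shows "u x \<le> R"
proof (rule ccontr)
  assume x: "\<not> u x \<le> R"
  then have x\<Omega>: "x \<in> \<Omega>" using out by blast
  have "compact (closure \<Omega>)" using \<Omega> by simp
  moreover have "closure \<Omega> \<noteq> {}" using x\<Omega> closure_subset by blast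
  ultimately obtain y where y: "y \<in> closure \<Omega>" "\<And>z. z \<in> closure \<Omega> \<Longrightarrow> u z \<le> u y"
    using continuous_attains_sup[of "closure \<Omega>" u] continuous_on_subset[OF u] by blast
  have yR: "u y > R" using y(2)[of x] x\<Omega> closure_subset x by force
  then have y\<Omega>: "y \<in> \<Omega>" using out by force
  have max: "u z \<le> u y" for z
  proof (cases "z \<in> \<Omega>")
    case True then show ?thesis using y(2) closure_subset by blast
  next
    case False then show ?thesis using out[of z] yR by linarith
  qed
  then have "\<forall>h. u (y + h) \<le> u y + 0 \<bullet> h + 0 * (norm h)\<^sup>2" by simp
  with sub y\<Omega> have "c y * u y - (\<integral>z. jump1 \<beta> u y 0 z \<partial>(dens q)) \<le> r y" unfolding quad_sub_def by blast
  moreover have "(\<integral>z. jump1 \<beta> u y 0 z \<partial>(dens q)) \<le> 0"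
  proof -
    have "0 \<le> (\<integral>z. - jump1 \<beta> u y 0 z \<partial>(dens q))"
      by (intro Bochner_Integration.integral_nonneg) (simp add: jump1_def max)
    then show ?thesis by simp
  qed
  ultimately have "c y * u y \<le> c y * R" using c(2)[of y] by linarith
  then show False using c(1)[of y] yR by simp
qed

section \<open>The effective equation as an equation with constant coefficients\<close>

lemma grad_uminus: "C2 \<psi> \<Longrightarrow> grad (\<lambda>y. - \<psi> y) x = - grad \<psi> x"
  by (intro grad_eqI GDERIV_minus C2_GDERIV)

lemma C2_uminus: "C2 \<psi> \<Longrightarrow> C2 (\<lambda>y. - \<psi> y)"
  using C2_mult[OF C2_const[of "- 1"], of \<psi>] by simp

lemma I1_uminus: "C2 \<psi> \<Longrightarrow> I1 q \<beta> (\<lambda>y. - \<psi> y) x = - I1 q \<beta> \<psi> x"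
  unfolding I1_def grad_uminus jump1_uminus by simp

context levy
begin

text \<open>With an affine effective constant, the effective inequality for a value \<open>t\<close>
  reads \<open>K * t - I \<le> F\<close>; what remains is the equivalence of the two classes of test
  functions.\<close>

lemma eff_sub_iff_quad_sub:
  assumes eff: "\<And>I. eff_const q0 \<beta> a f I = (I + F) / K" and K: "K > 0"
    and u: "continuous_on UNIV u" "\<And>x. \<bar>u x\<bar> \<le> R" and out: "\<And>x. x \<notin> \<Omega> \<Longrightarrow> u x = \<phi> x"
  shows "eff_sub q q0 \<beta> a f \<Omega> \<phi> u \<longleftrightarrow> quad_sub q \<beta> \<Omega> (\<lambda>_. K) (\<lambda>_. F) u"
proof -
  have e: "t + Ibar1 q0 \<beta> a f I \<le> 0 \<longleftrightarrow> K * t - I \<le> F" for t I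
    unfolding Ibar1_def eff using K by (simp add: pos_le_divide_eq mult.commute) linarith
  show ?thesis
  proof
    assume sub: "eff_sub q q0 \<beta> a f \<Omega> \<phi> u"
    show "quad_sub q \<beta> \<Omega> (\<lambda>_. K) (\<lambda>_. F) u"
    proof (rule C2_test_imp_quad_sub[OF u])
      fix x \<psi> assume "x \<in> \<Omega>" "C2 \<psi>" "integrable (dens q) (jump1 \<beta> \<psi> x (grad \<psi> x))"
        "\<And>y. u y - \<psi> y \<le> u x - \<psi> x" "u x = \<psi> x"
      then show "K * u x - I1 q \<beta> \<psi> x \<le> F"
        using sub unfolding eff_sub_def e by blast
    qed
  next
    assume sub: "quad_sub q \<beta> \<Omega> (\<lambda>_. K) (\<lambda>_. F) u"
    show "eff_sub q q0 \<beta> a f \<Omega> \<phi> u"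
      unfolding eff_sub_def e
      using continuous_imp_usc_lsc(1)[OF u(1)] out quad_sub_imp_C2_test[OF sub u(2)] by blast
  qed
qed

lemma eff_super_iff_quad_sub:
  assumes eff: "\<And>I. eff_const q0 \<beta> a f I = (I + F) / K" and K: "K > 0"
    and u: "continuous_on UNIV u" "\<And>x. \<bar>u x\<bar> \<le> R" and out: "\<And>x. x \<notin> \<Omega> \<Longrightarrow> u x = \<phi> x"
  shows "eff_super q q0 \<beta> a f \<Omega> \<phi> u \<longleftrightarrow> quad_sub q \<beta> \<Omega> (\<lambda>_. K) (\<lambda>_. - F) (\<lambda>x. - u x)"
proof -
  have e: "t + Ibar1 q0 \<beta> a f I \<ge> 0 \<longleftrightarrow> K * (- t) - (- I) \<le> - F" for t I
    unfolding Ibar1_def eff using K by (simp add: pos_divide_le_eq mult.commute) linarith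
  have u': "continuous_on UNIV (\<lambda>x. - u x)" "\<And>x. \<bar>- u x\<bar> \<le> R"
    using u by (auto intro: continuous_on_minus)
  show ?thesis
  proof
    assume sup: "eff_super q q0 \<beta> a f \<Omega> \<phi> u"
    show "quad_sub q \<beta> \<Omega> (\<lambda>_. K) (\<lambda>_. - F) (\<lambda>x. - u x)"
    proof (rule C2_test_imp_quad_sub[OF u'])
      fix x \<psi> assume x: "x \<in> \<Omega>" and \<psi>: "C2 \<psi>" "integrable (dens q) (jump1 \<beta> \<psi> x (grad \<psi> x))"
        "\<And>y. - u y - \<psi> y \<le> - u x - \<psi> x" "- u x = \<psi> x"
      have "integrable (dens q) (jump1 \<beta> (\<lambda>y. - \<psi> y) x (grad (\<lambda>y. - \<psi> y) x))"
        unfolding grad_uminus[OF \<psi>(1)] jump1_uminus using \<psi>(2) by simp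
      moreover have "\<forall>y. u y - - \<psi> y \<ge> u x - - \<psi> x"
        using \<psi>(3) by (simp add: algebra_simps)
      moreover have "u x = - \<psi> x" using \<psi>(4) by simp
      ultimately have "K * (- u x) - (- I1 q \<beta> (\<lambda>y. - \<psi> y) x) \<le> - F"
        using sup x C2_uminus[OF \<psi>(1)] unfolding eff_super_def e by blast
      then show "K * - u x - I1 q \<beta> \<psi> x \<le> - F" unfolding I1_uminus[OF \<psi>(1)] by simp
    qed
  next
    assume sub: "quad_sub q \<beta> \<Omega> (\<lambda>_. K) (\<lambda>_. - F) (\<lambda>x. - u x)"
    have "K * (- u x) - (- I1 q \<beta> \<psi> x) \<le> - F"
      if "x \<in> \<Omega>" "C2 \<psi>" "integrable (dens q) (jump1 \<beta> \<psi> x (grad \<psi> x))" "\<forall>y. u y - \<psi> y \<ge> u x - \<psi> x" for x \<psi>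
      unfolding I1_uminus[OF that(2), symmetric]
    proof (rule quad_sub_imp_C2_test[OF sub u'(2) that(1) C2_uminus[OF that(2)]])
      show "integrable (dens q) (jump1 \<beta> (\<lambda>y. - \<psi> y) x (grad (\<lambda>y. - \<psi> y) x))"
        unfolding grad_uminus[OF that(2)] jump1_uminus using that(3) by simp
      show "- u y - - \<psi> y \<le> - u x - - \<psi> x" for y using that(4) by (simp add: algebra_simps)
    qed
    then show "eff_super q q0 \<beta> a f \<Omega> \<phi> u"
      unfolding eff_super_def e
      using continuous_imp_usc_lsc(2)[OF u(1)] out by blast
  qed
qed

lemma eff_sol_iff_quad_sub:
  assumes "\<And>I. eff_const q0 \<beta> a f I = (I + F) / K" "K > 0"
    "continuous_on UNIV u" "\<And>x. \<bar>u x\<bar> \<le> R" "\<And>x. x \<notin> \<Omega> \<Longrightarrow> u x = \<phi> x"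
  shows "eff_sol q q0 \<beta> a f \<Omega> \<phi> u \<longleftrightarrow> quad_sub q \<beta> \<Omega> (\<lambda>_. K) (\<lambda>_. F) u \<and>
      quad_sub q \<beta> \<Omega> (\<lambda>_. K) (\<lambda>_. - F) (\<lambda>x. - u x)"
  unfolding eff_sol_def
  by (simp add: eff_sub_iff_quad_sub[OF assms] eff_super_iff_quad_sub[OF assms])

text \<open>A corrected subsolution built from one scale and a corrected supersolution built from
  another satisfy the same constant-coefficient equation up to a small error, so they can be
  compared directly, however different the scales are.\<close>

lemma uniform_limit_of_oscillating:
  fixes u :: "real \<Rightarrow> real^'n \<Rightarrow> real"
  assumes lim: "symbol_diverges q \<beta>"
    and b: "is_mean b K" "\<And>y. \<bar>b y\<bar> \<le> c1" "K > 0"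
    and g: "is_mean g F" "is_mean (\<lambda>y. - g y) (- F)" "\<And>y. \<bar>g y\<bar> \<le> r1"
    and \<Omega>: "open \<Omega>" and u: "\<And>\<epsilon>. \<epsilon> > 0 \<Longrightarrow> continuous_on UNIV (u \<epsilon>)" "\<And>\<epsilon> x. \<epsilon> > 0 \<Longrightarrow> \<bar>u \<epsilon> x\<bar> \<le> R"
      "\<And>\<epsilon> x. \<epsilon> > 0 \<Longrightarrow> x \<notin> \<Omega> \<Longrightarrow> u \<epsilon> x = \<phi> x"
    and sub: "\<And>\<epsilon>. \<epsilon> > 0 \<Longrightarrow> quad_sub q \<beta> \<Omega> (\<lambda>x. b (x /\<^sub>R \<epsilon>)) (\<lambda>x. g (x /\<^sub>R \<epsilon>)) (u \<epsilon>)"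
    and super: "\<And>\<epsilon>. \<epsilon> > 0 \<Longrightarrow> quad_sub q \<beta> \<Omega> (\<lambda>x. b (x /\<^sub>R \<epsilon>)) (\<lambda>x. - g (x /\<^sub>R \<epsilon>)) (\<lambda>x. - u \<epsilon> x)"
  obtains ubar where "\<And>x. ((\<lambda>\<epsilon>. u \<epsilon> x) \<longlongrightarrow> ubar x) (at_right 0)"
    "continuous_on UNIV ubar" "\<And>x. \<bar>ubar x\<bar> \<le> R" "\<And>x. x \<notin> \<Omega> \<Longrightarrow> ubar x = \<phi> x"
    "quad_sub q \<beta> \<Omega> (\<lambda>_. K) (\<lambda>_. F) ubar" "quad_sub q \<beta> \<Omega> (\<lambda>_. K) (\<lambda>_. - F) (\<lambda>x. - ubar x)"
proof -
  have R: "R \<ge> 0" using u(2)[of 1 0] by simp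
  \<comment> \<open>Taken with \<open>G = F\<close> for \<open>u \<epsilon>\<close> and with
    \<open>G = - F\<close> for its negative.\<close>
  define near where "near \<sigma> G w \<longleftrightarrow> (\<exists>U. continuous_on UNIV U \<and> (\<forall>x. \<bar>U x - w x\<bar> \<le> \<sigma>) \<and>
      quad_sub q \<beta> \<Omega> (\<lambda>_. K) (\<lambda>_. G + \<sigma>) U)" for \<sigma> G and w :: "real^'n \<Rightarrow> real"
  have ev: "\<exists>d>0. \<forall>\<epsilon>. 0 < \<epsilon> \<and> \<epsilon> < d \<longrightarrow> near \<sigma> F (u \<epsilon>) \<and> near \<sigma> (- F) (\<lambda>x. - u \<epsilon> x)" if "\<sigma> > 0" for \<sigma>
  proof -
    have "\<bar>- g y\<bar> \<le> r1" for y using g(3)[of y] by simp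
    note e2 = eventually_homogenized_quad_sub[OF lim b(1,2) g(2) this R that]
    note e1 = eventually_homogenized_quad_sub[OF lim b(1,2) g(1,3) R that]
    have "eventually (\<lambda>\<epsilon>. near \<sigma> F (u \<epsilon>) \<and> near \<sigma> (- F) (\<lambda>x. - u \<epsilon> x)) (at_right 0)"
      using e1 e2 eventually_at_right_less[of 0]
    proof eventually_elim
      case (elim \<epsilon>)
      have "continuous_on UNIV (\<lambda>x. - u \<epsilon> x)" using u(1)[OF elim(3)] by (rule continuous_on_minus)
      moreover have "\<bar>- u \<epsilon> x\<bar> \<le> R" for x using u(2)[OF elim(3), of x] by simp
      ultimately have "near \<sigma> (- F) (\<lambda>x. - u \<epsilon> x)"
        using elim(2) super[OF elim(3)] unfolding near_def by blast
      moreover have "near \<sigma> F (u \<epsilon>)"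
        using elim(1) sub[OF elim(3)] u(1,2)[OF elim(3)] unfolding near_def by blast
      ultimately show ?case by blast
    qed
    then show ?thesis unfolding eventually_at_right_field by auto
  qed
  \<comment> \<open>\<open>2 * \<sigma>\<close> from the exterior, \<open>2 * \<sigma> / K\<close>
    from the right-hand sides, and \<open>2 * \<sigma>\<close> for returning from \<open>U\<close>
    and \<open>V\<close> to the solutions.\<close>
  have diff: "u \<epsilon> x - u \<epsilon>' x \<le> 4 * \<sigma> + 2 * \<sigma> / K"
    if n: "near \<sigma> F (u \<epsilon>)" "near \<sigma> (- F) (\<lambda>x. - u \<epsilon>' x)" and e: "\<epsilon> > 0" "\<epsilon>' > 0" and \<sigma>: "\<sigma> > 0" for \<epsilon> \<epsilon>' \<sigma> x
  proof -
    obtain U where U: "continuous_on UNIV U" "\<And>x. \<bar>U x - u \<epsilon> x\<bar> \<le> \<sigma>" "quad_sub q \<beta> \<Omega> (\<lambda>_. K) (\<lambda>_. F + \<sigma>) U"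
      using n(1) unfolding near_def by blast
    obtain V where V: "continuous_on UNIV V" "\<And>x. \<bar>V x - - u \<epsilon>' x\<bar> \<le> \<sigma>" "quad_sub q \<beta> \<Omega> (\<lambda>_. K) (\<lambda>_. - F + \<sigma>) V"
      using n(2) unfolding near_def by blast
    have UR: "\<bar>U x\<bar> \<le> R + \<sigma>" for x using U(2)[of x] u(2)[OF e(1), of x] by linarith
    have VR: "\<bar>V x\<bar> \<le> R + \<sigma>" for x using V(2)[of x] u(2)[OF e(2), of x] by linarith
    have "U y + V y \<le> 2 * \<sigma>" if "y \<notin> \<Omega>" for y
      using U(2)[of y] V(2)[of y] u(3)[OF e(1) that] u(3)[OF e(2) that] by linarith
    from comparison[OF \<Omega> U(1) UR V(1) VR b(3) U(3) V(3) this]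
    have "U x + V x \<le> max (2 * \<sigma>) ((F + \<sigma> + (- F + \<sigma>)) / K)" .
    also have "\<dots> \<le> 2 * \<sigma> + 2 * \<sigma> / K" using \<sigma> b(3) by simp
    finally show ?thesis using U(2)[of x] V(2)[of x] by linarith
  qed
  have cauchy: "\<exists>d>0. \<forall>\<epsilon> \<epsilon>' x. 0 < \<epsilon> \<and> \<epsilon> < d \<and> 0 < \<epsilon>' \<and> \<epsilon>' < d \<longrightarrow> \<bar>u \<epsilon> x - u \<epsilon>' x\<bar> \<le> e" if "e > 0" for e
  proof -
    define \<sigma> where "\<sigma> = e / (4 + 2 / K)"
    have p: "4 + 2 / K > 0" using b(3) by (simp add: add_pos_pos)
    have \<sigma>: "\<sigma> > 0" unfolding \<sigma>_def using that p by simp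
    have "\<sigma> * (4 + 2 / K) = e" unfolding \<sigma>_def using p by simp
    then have se: "4 * \<sigma> + 2 * \<sigma> / K = e" by (simp add: distrib_left mult.commute)
    obtain d where d: "d > 0" "\<And>\<epsilon>. 0 < \<epsilon> \<Longrightarrow> \<epsilon> < d \<Longrightarrow> near \<sigma> F (u \<epsilon>) \<and> near \<sigma> (- F) (\<lambda>x. - u \<epsilon> x)"
      using ev[OF \<sigma>] by blast
    have "\<bar>u \<epsilon> x - u \<epsilon>' x\<bar> \<le> e" if "0 < \<epsilon>" "\<epsilon> < d" "0 < \<epsilon>'" "\<epsilon>' < d" for \<epsilon> \<epsilon>' x
      using diff[of \<sigma> \<epsilon> \<epsilon>' x] diff[of \<sigma> \<epsilon>' \<epsilon> x] d(2)[of \<epsilon>] d(2)[of \<epsilon>'] that \<sigma> se by (simp add: abs_le_iff)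
    with d(1) show ?thesis by blast
  qed
  have inv: "(\<lambda>n. inverse (real (Suc n))) \<longlonglongrightarrow> 0" by (rule LIMSEQ_inverse_real_of_nat)
  have small: "\<exists>N. \<forall>n\<ge>N. inverse (real (Suc n)) < d" if "d > 0" for d
    using order_tendstoD(2)[OF inv that] unfolding eventually_sequentially .
  have "\<exists>l. (\<lambda>n. u (inverse (real (Suc n))) x) \<longlonglongrightarrow> l" for x
  proof -
    have "Cauchy (\<lambda>n. u (inverse (real (Suc n))) x)"
    proof (rule metric_CauchyI)
      fix e :: real assume "e > 0"
      then have "e / 2 > 0" by simp
      from cauchy[OF this] obtain d where d: "d > 0"
        "\<And>\<epsilon> \<epsilon>' x. 0 < \<epsilon> \<Longrightarrow> \<epsilon> < d \<Longrightarrow> 0 < \<epsilon>' \<Longrightarrow> \<epsilon>' < d \<Longrightarrow> \<bar>u \<epsilon> x - u \<epsilon>' x\<bar> \<le> e / 2" by blast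
      obtain N where N: "\<And>n. n \<ge> N \<Longrightarrow> inverse (real (Suc n)) < d" using small[OF d(1)] by blast
      have "dist (u (inverse (real (Suc m))) x) (u (inverse (real (Suc n))) x) < e" if "m \<ge> N" "n \<ge> N" for m n
      proof -
        have "0 < inverse (real (Suc m))" "0 < inverse (real (Suc n))" by simp_all
        from d(2)[OF this(1) N[OF that(1)] this(2) N[OF that(2)], of x] show ?thesis
          using \<open>e > 0\<close> unfolding dist_real_def by linarith
      qed
      then show "\<exists>M. \<forall>m\<ge>M. \<forall>n\<ge>M. dist (u (inverse (real (Suc m))) x) (u (inverse (real (Suc n))) x) < e" by blast
    qed
    then show ?thesis using convergent_eq_Cauchy by blast
  qed
  then obtain ubar where ubar: "\<And>x. (\<lambda>n. u (inverse (real (Suc n))) x) \<longlonglongrightarrow> ubar x" by metis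
  have unif: "\<exists>d>0. \<forall>\<epsilon> x. 0 < \<epsilon> \<and> \<epsilon> < d \<longrightarrow> \<bar>u \<epsilon> x - ubar x\<bar> \<le> e" if e: "e > 0" for e
  proof -
    obtain d where d: "d > 0"
      "\<And>\<epsilon> \<epsilon>' x. 0 < \<epsilon> \<Longrightarrow> \<epsilon> < d \<Longrightarrow> 0 < \<epsilon>' \<Longrightarrow> \<epsilon>' < d \<Longrightarrow> \<bar>u \<epsilon> x - u \<epsilon>' x\<bar> \<le> e"
      using cauchy[OF e] by blast
    obtain N where N: "\<And>n. n \<ge> N \<Longrightarrow> inverse (real (Suc n)) < d" using small[OF d(1)] by blast
    have "\<bar>u \<epsilon> x - ubar x\<bar> \<le> e" if \<epsilon>: "0 < \<epsilon>" "\<epsilon> < d" for \<epsilon> x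
    proof (rule LIMSEQ_le_const2)
      show "(\<lambda>n. \<bar>u \<epsilon> x - u (inverse (real (Suc n))) x\<bar>) \<longlonglongrightarrow> \<bar>u \<epsilon> x - ubar x\<bar>"
        by (intro tendsto_intros ubar)
      have "0 < inverse (real (Suc n))" for n by simp
      then show "\<exists>N. \<forall>n\<ge>N. \<bar>u \<epsilon> x - u (inverse (real (Suc n))) x\<bar> \<le> e"
        using d(2)[OF \<epsilon>] N by blast
    qed
    with d(1) show ?thesis by blast
  qed
  have conv: "((\<lambda>\<epsilon>. u \<epsilon> x) \<longlongrightarrow> ubar x) (at_right 0)" for x
  proof (rule tendstoI)
    fix e :: real assume e: "e > 0"
    then have "e / 2 > 0" by simp
    from unif[OF this] obtain d where d: "d > 0" "\<And>\<epsilon>. 0 < \<epsilon> \<Longrightarrow> \<epsilon> < d \<Longrightarrow> \<bar>u \<epsilon> x - ubar x\<bar> \<le> e / 2" by blast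
    show "eventually (\<lambda>\<epsilon>. dist (u \<epsilon> x) (ubar x) < e) (at_right 0)"
      unfolding eventually_at_right_field dist_real_def using d e by (intro exI[of _ d]) force
  qed
  have ulim: "uniform_limit UNIV (\<lambda>n. u (inverse (real (Suc n)))) ubar sequentially"
  proof (rule uniform_limitI)
    fix e :: real assume e: "e > 0"
    then have "e / 2 > 0" by simp
    from unif[OF this] obtain d where d: "d > 0" "\<And>\<epsilon> x. 0 < \<epsilon> \<Longrightarrow> \<epsilon> < d \<Longrightarrow> \<bar>u \<epsilon> x - ubar x\<bar> \<le> e / 2" by blast
    show "\<forall>\<^sub>F n in sequentially. \<forall>x\<in>UNIV. dist (u (inverse (real (Suc n))) x) (ubar x) < e"
      using order_tendstoD(2)[OF inv d(1)]
    proof eventually_elim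
      case (elim n)
      have "\<bar>u (inverse (real (Suc n))) x - ubar x\<bar> \<le> e / 2" for x by (rule d(2)[OF _ elim]) simp
      then show ?case using e unfolding dist_real_def by (smt (verit) field_sum_of_halves)
    qed
  qed
  have cont: "continuous_on UNIV ubar"
    by (rule uniform_limit_theorem[OF _ ulim]) (auto intro!: always_eventually u(1))
  have uR: "\<bar>ubar x\<bar> \<le> R" for x
    by (rule LIMSEQ_le_const2[OF tendsto_rabs[OF ubar]]) (use u(2) in simp)
  have uphi: "ubar x = \<phi> x" if "x \<notin> \<Omega>" for x
    using LIMSEQ_unique[OF ubar[of x]] u(3)[OF _ that] by simp
  have limit_sub: "quad_sub q \<beta> \<Omega> (\<lambda>_. K) (\<lambda>_. G) w"
    if w: "continuous_on UNIV w" "\<And>x. \<bar>w x\<bar> \<le> R"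
      and ap: "\<And>\<sigma>. \<sigma> > 0 \<Longrightarrow> \<exists>w'. near \<sigma> G w' \<and> (\<forall>x. \<bar>w' x - w x\<bar> \<le> \<sigma>)" for w G
  proof -
    have "\<exists>U. continuous_on UNIV U \<and> (\<forall>x. \<bar>U x - w x\<bar> \<le> 2 * inverse (real (Suc n))) \<and>
        quad_sub q \<beta> \<Omega> (\<lambda>_. K) (\<lambda>_. G + inverse (real (Suc n))) U" for n
    proof -
      have "inverse (real (Suc n)) > 0" by simp
      from ap[OF this] obtain w' where w': "near (inverse (real (Suc n))) G w'"
        "\<And>x. \<bar>w' x - w x\<bar> \<le> inverse (real (Suc n))" by blast
      then obtain U where U: "continuous_on UNIV U" "\<And>x. \<bar>U x - w' x\<bar> \<le> inverse (real (Suc n))"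
        "quad_sub q \<beta> \<Omega> (\<lambda>_. K) (\<lambda>_. G + inverse (real (Suc n))) U" unfolding near_def by blast
      have "\<bar>U x - w x\<bar> \<le> 2 * inverse (real (Suc n))" for x using U(2)[of x] w'(2)[of x] by linarith
      with U show ?thesis by blast
    qed
    then obtain U where U: "\<And>n. continuous_on UNIV (U n)" "\<And>n x. \<bar>U n x - w x\<bar> \<le> 2 * inverse (real (Suc n))"
      "\<And>n. quad_sub q \<beta> \<Omega> (\<lambda>_. K) (\<lambda>_. G + inverse (real (Suc n))) (U n)" by metis
    show ?thesis
    proof (rule quad_sub_uniform_limit[where U = U and R = "R + 2", OF \<Omega> U(1) _ w(1) U(2) _ U(3)])
      fix n x
      have "inverse (real (Suc n)) \<le> 1" by (simp add: inverse_eq_divide)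
      then show "\<bar>U n x\<bar> \<le> R + 2" using U(2)[of n x] w(2)[of x] by linarith
    next
      show "(\<lambda>n. 2 * inverse (real (Suc n))) \<longlonglongrightarrow> 0" by (intro tendsto_mult_right_zero inv)
      show "(\<lambda>n. G + inverse (real (Suc n))) \<longlonglongrightarrow> G"
        using tendsto_add[OF tendsto_const inv, of G] by simp
    qed
  qed
  have pick: "\<exists>\<epsilon>>0. near \<sigma> F (u \<epsilon>) \<and> near \<sigma> (- F) (\<lambda>x. - u \<epsilon> x) \<and> (\<forall>x. \<bar>u \<epsilon> x - ubar x\<bar> \<le> \<sigma>)" if \<sigma>: "\<sigma> > 0" for \<sigma>
  proof -
    obtain d d' where "d > 0" "\<forall>\<epsilon>. 0 < \<epsilon> \<and> \<epsilon> < d \<longrightarrow> near \<sigma> F (u \<epsilon>) \<and> near \<sigma> (- F) (\<lambda>x. - u \<epsilon> x)"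
      and "d' > 0" "\<forall>\<epsilon> x. 0 < \<epsilon> \<and> \<epsilon> < d' \<longrightarrow> \<bar>u \<epsilon> x - ubar x\<bar> \<le> \<sigma>"
      using ev[OF \<sigma>] unif[OF \<sigma>] by blast
    then show ?thesis by (intro exI[of _ "min d d' / 2"]) (auto simp: min_def)
  qed
  have "quad_sub q \<beta> \<Omega> (\<lambda>_. K) (\<lambda>_. F) ubar"
    by (rule limit_sub[OF cont uR]) (use pick in blast)
  moreover have "quad_sub q \<beta> \<Omega> (\<lambda>_. K) (\<lambda>_. - F) (\<lambda>x. - ubar x)"
  proof (rule limit_sub)
    show "continuous_on UNIV (\<lambda>x. - ubar x)" using cont by (rule continuous_on_minus)
    show "\<bar>- ubar x\<bar> \<le> R" for x using uR[of x] by simp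
    fix \<sigma> :: real assume "\<sigma> > 0"
    from pick[OF this] obtain \<epsilon> where "near \<sigma> (- F) (\<lambda>x. - u \<epsilon> x)" "\<forall>x. \<bar>u \<epsilon> x - ubar x\<bar> \<le> \<sigma>" by blast
    then show "\<exists>w'. near \<sigma> (- F) w' \<and> (\<forall>x. \<bar>w' x - - ubar x\<bar> \<le> \<sigma>)"
      by (intro exI[of _ "\<lambda>x. - u \<epsilon> x"]) (auto simp: abs_le_iff)
  qed
  ultimately show ?thesis using that[OF conv cont uR uphi] by blast
qed

end

theorem theorem4p6:
  fixes \<Omega> :: "(real^'n) set" and \<phi> :: "real^'n \<Rightarrow> real"
    and \<beta> :: "real^'m \<Rightarrow> real^'n" and a f :: "real^'n \<Rightarrow> real"
    and q :: "real^'m \<Rightarrow> real" and q0 :: "real^'m \<Rightarrow> real" and S0 :: "(real^'m) set"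
    and \<alpha> B1 a0 L \<theta>1 \<theta>2 :: real
    and u :: "real \<Rightarrow> real^'n \<Rightarrow> real"
  assumes dims: "CARD('m) \<le> CARD('n)"
    and \<Omega>: "open \<Omega>" "bounded \<Omega>"
    and \<phi>: "continuous_on (-\<Omega>) \<phi>" "bounded (\<phi> ` (-\<Omega>))"
    and \<beta>: "continuous_on UNIV \<beta>" "\<And>c z. c > 0 \<Longrightarrow> \<beta> (c *\<^sub>R z) = c *\<^sub>R \<beta> z"
      "\<And>z. norm (\<beta> z) \<le> B1 * norm z"
    and a: "continuous_on UNIV a" "zperiodic a" "a0 > 0" "\<And>y. a y \<ge> a0"
      "\<And>y y'. \<bar>a y - a y'\<bar> \<le> L * dist y y' powr \<theta>1"
    and f: "continuous_on UNIV f" "zperiodic f"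
      "\<And>y y'. \<bar>f y - f y'\<bar> \<le> L * dist y y' powr \<theta>2"
    and \<theta>: "0 < \<theta>1" "\<theta>1 \<le> 1" "0 < \<theta>2" "\<theta>2 \<le> 1"
    and q: "q \<in> borel_measurable lborel" "\<And>z. q z \<ge> 0" "levy_moment q"
    and A: "condA q \<alpha> S0 q0"
    and B: "condB (rescaled S0 q0) \<beta>"
    and q0_moment: "levy_moment (rescaled S0 q0)"
    and sol: "\<And>\<epsilon>. \<epsilon> > 0 \<Longrightarrow> eps_sol q \<beta> a f \<Omega> \<phi> \<epsilon> (u \<epsilon>)"
  shows "\<exists>ubar. (\<forall>x. ((\<lambda>\<epsilon>. u \<epsilon> x) \<longlongrightarrow> ubar x) (at_right 0))
            \<and> eff_sol q (rescaled S0 q0) \<beta> a f \<Omega> \<phi> ubar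
            \<and> (\<forall>v. eff_sol q (rescaled S0 q0) \<beta> a f \<Omega> \<phi> v \<longrightarrow> v = ubar)"
proof -
  let ?q = "rescaled S0 q0"
  have apos: "a y > 0" for y using a(3) a(4)[of y] by linarith
  have \<alpha>: "\<alpha> > 0" using A unfolding condA_def by blast
  have lim: "((\<lambda>\<epsilon>. \<epsilon> powr (real CARD('m) + \<alpha>) * q (\<epsilon> *\<^sub>R z)) \<longlongrightarrow> ?q z) (at_right 0)" for z
    using A unfolding condA_def rescaled_def by blast
  have q_borel [measurable]: "q \<in> borel_measurable borel" using q(1) by simp
  have seq: "filterlim (\<lambda>n. inverse (real (Suc n))) (at_right 0) sequentially"
    unfolding filterlim_at using LIMSEQ_inverse_real_of_nat by (auto intro!: always_eventually)
  \<comment> \<open>Measurability of the rescaled density comes from condition (A): it is the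
    pointwise limit of measurable functions along the scales \<open>1 / (n + 1)\<close>.\<close>
  have "?q \<in> borel_measurable borel"
    by (rule borel_measurable_LIMSEQ_real[OF filterlim_compose[OF lim seq]]) measurable
  moreover have "?q z \<ge> 0" for z
    using A unfolding condA_def rescaled_def by (auto simp: less_imp_le)
  ultimately have levy0: "levy \<beta> ?q B1" using \<beta> q0_moment by unfold_locales auto
  have levy1: "levy \<beta> q B1" using \<beta> q q_borel by unfold_locales auto
  interpret q0: levy \<beta> ?q B1 by (rule levy0)
  interpret q: levy \<beta> q B1 by (rule levy1)
  have symbol: "symbol_diverges q \<beta>"
    unfolding symbol_diverges_def
    using eventually_char_exp_real_ge[OF levy1 levy0 \<beta>(2) \<alpha> lim q0.char_exp_real_pos[OF B]] by blast
  obtain a1 where a1: "\<And>y. \<bar>a y\<bar> \<le> a1" using continuous_zperiodic_bounded[OF a(1,2)] by blast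
  obtain f1 where f1: "\<And>y. \<bar>f y\<bar> \<le> f1" using continuous_zperiodic_bounded[OF f(1,2)] by blast
  have a1': "a y \<le> a1" for y using a1[of y] by linarith
  have a1pos: "a1 > 0" using apos[of 0] a1'[of 0] by linarith
  define b where "b y = inverse (a y)" for y
  define g where "g y = f y / a y" for y
  have cont: "continuous_on UNIV b" "continuous_on UNIV g"
    unfolding b_def g_def using a(1) f(1) apos by (intro continuous_intros; metis less_irrefl)+
  have per: "zperiodic b" "zperiodic g" using a(2) f(2) unfolding b_def g_def zperiodic_def by auto
  \<comment> \<open>Condition (B) concerns the rescaled density, so the means are obtained through
    \<open>q0\<close>; being properties of \<open>b\<close> and \<open>g\<close> alone, they serve
    \<open>q\<close> as well.\<close>
  obtain K F where K: "is_mean b K" and F: "is_mean g F"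
    using q0.is_mean_exists[OF B] cont per by metis
  have Kpos: "K > 0"
    by (rule q0.is_mean_pos[OF B K, of "inverse a1"]) (use apos a1' a1pos in \<open>auto simp: b_def intro: le_imp_inverse_le\<close>)
  have F': "is_mean (\<lambda>y. - g y) (- F)"
    unfolding is_mean_def
  proof (intro allI impI)
    fix \<delta> :: real assume "\<delta> > 0"
    then obtain P where P: "trig0 P" "\<And>y. \<bar>g y - F - P y\<bar> \<le> \<delta>" using F unfolding is_mean_def by blast
    have "\<bar>- g y - - F - (- 1) * P y\<bar> \<le> \<delta>" for y using P(2)[of y] by linarith
    then show "\<exists>P. trig0 P \<and> (\<forall>y. \<bar>- g y - - F - P y\<bar> \<le> \<delta>)" using trig0_cmult[OF P(1)] by blast
  qed
  have eff: "eff_const ?q \<beta> a f I = (I + F) / K" for I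
  proof (rule q0.eff_const_eq[OF B])
    show "is_mean (\<lambda>y. inverse (a y)) K" using K unfolding b_def[abs_def] .
    show "is_mean (\<lambda>y. f y / a y) F" using F unfolding g_def[abs_def] .
  qed (rule apos a1' Kpos)+
  obtain c1 where c1: "\<And>y. \<bar>b y\<bar> \<le> c1" using continuous_zperiodic_bounded[OF cont(1) per(1)] by blast
  obtain r1 where r1: "\<And>y. \<bar>g y\<bar> \<le> r1" using continuous_zperiodic_bounded[OF cont(2) per(2)] by blast
  obtain p1 where p1: "\<And>x. x \<notin> \<Omega> \<Longrightarrow> \<bar>\<phi> x\<bar> \<le> p1" using \<phi>(2) unfolding bounded_iff by auto
  \<comment> \<open>\<open>p1\<close> bounds the exterior data; \<open>f1\<close> enters because
    \<open>g = b * f\<close>, so that \<open>g\<close> and \<open>- g\<close> are at most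
    \<open>b * R\<close>.\<close>
  define R where "R = max p1 f1"
  have u_cont: "continuous_on UNIV (u \<epsilon>)" if "\<epsilon> > 0" for \<epsilon>
    using sol[OF that] unfolding eps_sol_def eps_sub_def eps_super_def by (intro usc_lsc_imp_continuous) auto
  have u_out: "u \<epsilon> x = \<phi> x" if "\<epsilon> > 0" "x \<notin> \<Omega>" for \<epsilon> x
    using sol[OF that(1)] that(2) unfolding eps_sol_def eps_sub_def by auto
  have sub: "quad_sub q \<beta> \<Omega> (\<lambda>x. b (x /\<^sub>R \<epsilon>)) (\<lambda>x. g (x /\<^sub>R \<epsilon>)) (u \<epsilon>)" if "\<epsilon> > 0" for \<epsilon>
    using eps_sub_imp_quad_sub[where a = a] apos sol[OF that] unfolding eps_sol_def b_def g_def by blast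
  have super: "quad_sub q \<beta> \<Omega> (\<lambda>x. b (x /\<^sub>R \<epsilon>)) (\<lambda>x. - g (x /\<^sub>R \<epsilon>)) (\<lambda>x. - u \<epsilon> x)" if "\<epsilon> > 0" for \<epsilon>
    using eps_super_imp_quad_sub[where a = a] apos sol[OF that] unfolding eps_sol_def b_def g_def minus_divide_left by blast
  have bpos: "b y > 0" for y unfolding b_def using apos by simp
  have gb: "g y \<le> b y * R" "- g y \<le> b y * R" for y
  proof -
    have "f y \<le> R" "- f y \<le> R" using f1[of y] unfolding R_def by linarith+
    then have "b y * f y \<le> b y * R" "b y * (- f y) \<le> b y * R"
      using less_imp_le[OF bpos[of y]] by (blast intro: mult_left_mono)+
    moreover have "g y = b y * f y" "- g y = b y * (- f y)"
      by (simp_all add: b_def g_def divide_inverse mult.commute)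
    ultimately show "g y \<le> b y * R" "- g y \<le> b y * R" by (simp_all only:)
  qed
  have u_bound: "\<bar>u \<epsilon> x\<bar> \<le> R" if e: "\<epsilon> > 0" for \<epsilon> x
  proof -
    have o: "u \<epsilon> y \<le> R" "- u \<epsilon> y \<le> R" if "y \<notin> \<Omega>" for y
      using p1[OF that] u_out[OF e that] unfolding R_def by linarith+
    have "u \<epsilon> x \<le> R"
      by (rule quad_sub_max_principle[OF u_cont[OF e] \<Omega>(2) o(1) sub[OF e] bpos gb(1)])
    moreover have "- u \<epsilon> x \<le> R"
      by (rule quad_sub_max_principle[OF continuous_on_minus[OF u_cont[OF e]] \<Omega>(2) o(2) super[OF e] bpos gb(2)])
    ultimately show ?thesis by linarith
  qed
  obtain ubar where ubar: "\<And>x. ((\<lambda>\<epsilon>. u \<epsilon> x) \<longlongrightarrow> ubar x) (at_right 0)"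
    "continuous_on UNIV ubar" "\<And>x. \<bar>ubar x\<bar> \<le> R" "\<And>x. x \<notin> \<Omega> \<Longrightarrow> ubar x = \<phi> x"
    "quad_sub q \<beta> \<Omega> (\<lambda>_. K) (\<lambda>_. F) ubar" "quad_sub q \<beta> \<Omega> (\<lambda>_. K) (\<lambda>_. - F) (\<lambda>x. - ubar x)"
    using q.uniform_limit_of_oscillating[OF symbol K c1 Kpos F F' r1 \<Omega>(1) u_cont u_bound u_out sub super] by blast
  have "eff_sol q ?q \<beta> a f \<Omega> \<phi> ubar"
    using q.eff_sol_iff_quad_sub[OF eff Kpos ubar(2,3,4)] ubar(5,6) by blast
  moreover have "v = ubar" if v: "eff_sol q ?q \<beta> a f \<Omega> \<phi> v" for v
  proof
    have v_cont: "continuous_on UNIV v"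
      using v unfolding eff_sol_def eff_sub_def eff_super_def by (intro usc_lsc_imp_continuous) auto
    have v_out: "v x = \<phi> x" if "x \<notin> \<Omega>" for x
      using v that unfolding eff_sol_def eff_sub_def by auto
    \<comment> \<open>Boundedness is not part of the notion of solution; it follows from continuity
      on the compact closure of \<open>\<Omega>\<close> and the bounded exterior data.\<close>
    obtain V where V: "\<And>x. \<bar>v x\<bar> \<le> V"
      using bounded_of_exterior_bound[OF v_cont \<Omega>(2), of p1] p1 v_out by auto
    have v_sub: "quad_sub q \<beta> \<Omega> (\<lambda>_. K) (\<lambda>_. F) v" "quad_sub q \<beta> \<Omega> (\<lambda>_. K) (\<lambda>_. - F) (\<lambda>x. - v x)"
      using q.eff_sol_iff_quad_sub[OF eff Kpos v_cont V v_out] v by blast+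
    fix x
    have bd: "\<bar>ubar x\<bar> \<le> max R V" "\<bar>v x\<bar> \<le> max R V" "\<bar>- ubar x\<bar> \<le> max R V" "\<bar>- v x\<bar> \<le> max R V" for x
      using ubar(3)[of x] V[of x] by simp_all
    have out: "v x + - ubar x \<le> 0" "ubar x + - v x \<le> 0" if "x \<notin> \<Omega>" for x
      using v_out[OF that] ubar(4)[OF that] by simp_all
    \<comment> \<open>The exterior values agree and the right-hand sides are opposite, so the
      comparison bound is 0.\<close>
    have "v x + - ubar x \<le> max 0 ((F + - F) / K)"
      by (rule q.comparison[OF \<Omega>(1) v_cont bd(2) continuous_on_minus[OF ubar(2)] bd(3) Kpos v_sub(1) ubar(6) out(1)])
    moreover have "ubar x + - v x \<le> max 0 ((F + - F) / K)"
      by (rule q.comparison[OF \<Omega>(1) ubar(2) bd(1) continuous_on_minus[OF v_cont] bd(4) Kpos ubar(5) v_sub(2) out(2)])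
    ultimately show "v x = ubar x" by simp
  qed
  ultimately show ?thesis using ubar(1) by blast
qed

end
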